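(* Let $1<p<\infty$, $1/p+1/p'=1$, and let $\lambda=(\lambda_k)_{k\in\mathbb{Z}}$, $\beta=(\beta_k)_{k\in\mathbb{Z}}$ be sequences with nonzero components such that $\varphi_\lambda\in L_{p'}(\mathbb{T})$ and $\varphi_\beta\in L_p(\mathbb{T})$. For $m\in\mathbb{N}$ define $$\varepsilon_m=\max\Big\{\sum_{|k|>m}|\Delta\lambda_k^{-1}|,\ \sum_{|k|>m}|\Delta\gamma_k|+\sum_{k\in\mathbb{Z}}|\gamma_{k(2m+1)+m}|\Big\},$$ where $\gamma_k=\alpha_{k'}\beta_k^{-1}$, $k'$ is the unique integer in $[-m,m]$ such that $(k-k')/(2m+1)$ is an integer, and $\Delta\theta_k=\theta_k-\theta_{k+1}$. Then there exists a positive constant $c$ such that for all $f\in\Phi_{\lambda,p}(\mathbb{T})$ and $m\in\mathbb{N}$ $$\|f-Q_m(f)\|_p\le c\,\varepsilon_m\|f\|_{\Phi_{\lambda,p}(\mathbb{T})},$$ and consequently $M_{2m+1}(U_{\lambda,p}(\mathbb{T}),\varphi_\beta)_p\le c\,\varepsilon_m$.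
   Context: $\mathbb{N}=\{1,2,\dots\}$; $\mathbb{T}=[0,2\pi]$ with endpoints identified. Functions are real-valued (in particular $\varphi_\lambda$ and $\varphi_\beta$). $\|f\|_p=(2\pi)^{-1/p}(\int_{\mathbb{T}}|f|^p)^{1/p}$; $(f_1*f_2)(x)=(2\pi)^{-1}\int_{\mathbb{T}}f_1(y)f_2(x-y)dy$. For a sequence $\lambda$ with nonzero components, $\varphi_\lambda=\sum_{k\in\mathbb{Z}}\lambda_k^{-1}e^{ik\cdot}$ in the distributional sense; similarly $\varphi_\beta=\sum_{k\in\mathbb{Z}}\beta_k^{-1}e^{ik\cdot}$. $\Phi_{\lambda,p}(\mathbb{T})=\{f=\varphi_\lambda*g: g\in L_p(\mathbb{T})\}$ with $\|f\|_{\Phi_{\lambda,p}(\mathbb{T})}=\|g\|_p$, and $U_{\lambda,p}(\mathbb{T})$ is its unit ball. Put $\alpha_k=\beta_k/\lambda_k$, $H_m(x)=\sum_{|k|\le m}\alpha_k e^{ikx}$, $\delta_m=2\pi/(2m+1)$, $V_m(g)=H_m*g$, and for $f=\varphi_\lambda*g$ with $g\in L_p(\mathbb{T})$, $$Q_m(f)=\frac1{2m+1}\sum_{l=0}^{2m}V_m(g)(\delta_m l)\,\varphi_\beta(\cdot-\delta_m l).$$ For $\mathbb{W}\subset L_p(\mathbb{T})$ and $\psi\in L_p(\mathbb{T})$, $M_n(\mathbb{W},\psi)_p=\sup_{f\in\mathbb{W}}\inf_{c_l\in\mathbb{R},\,y_l\in\mathbb{T}}\|f-\sum_{l=1}^n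 c_l\psi(\cdot-y_l)\|_p$. The quantity $\varepsilon_m$ may be $+\infty$, in which case the bound is trivial. *)

theory Defs
  imports "HOL-Analysis.Analysis"
begin

(* Functions on the circle [0, 2 pi] with endpoints identified are represented by
   2 pi-periodic functions on the real line. *)

definition circle_periodic :: "(real \<Rightarrow> 'a) \<Rightarrow> bool" where
  "circle_periodic f \<longleftrightarrow> (\<forall>x. f (x + 2 * pi) = f x)"

definition Lp_circle :: "real \<Rightarrow> (real \<Rightarrow> real) set" where
  "Lp_circle p = {f. circle_periodic f \<and> f \<in> borel_measurable lebesgue \<and>
     set_integrable lebesgue {0..2*pi} (\<lambda>x. \<bar>f x\<bar> powr p)}"

definition Lp_norm :: "real \<Rightarrow> (real \<Rightarrow> 'a::real_normed_vector) \<Rightarrow> real" where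
  "Lp_norm p f = (2 * pi) powr (- 1 / p) * (LINT x:{0..2*pi}|lebesgue. norm (f x) powr p) powr (1 / p)"

definition circle_conv ::
  "(real \<Rightarrow> 'a) \<Rightarrow> (real \<Rightarrow> 'a) \<Rightarrow> real \<Rightarrow> 'a::{real_normed_field, banach, second_countable_topology}" where
  "circle_conv f1 f2 x = (LINT y:{0..2*pi}|lebesgue. f1 y * f2 (x - y)) /\<^sub>R (2 * pi)"

definition circle_test_function :: "(real \<Rightarrow> complex) \<Rightarrow> bool" where
  "circle_test_function u \<longleftrightarrow> circle_periodic u \<and>
     (\<exists>U :: nat \<Rightarrow> real \<Rightarrow> complex. U 0 = u \<and>
        (\<forall>n x. (U n has_vector_derivative U (Suc n) x) (at x)))"

(* phi is the sum of the series of c k * exp (i k x) over all integers k in the sense of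
   distributions: the series converges to phi when tested against every smooth u. *)

definition has_distributional_series :: "(real \<Rightarrow> real) \<Rightarrow> (int \<Rightarrow> complex) \<Rightarrow> bool" where
  "has_distributional_series \<phi> c \<longleftrightarrow>
     (\<forall>u. circle_test_function u \<longrightarrow>
        ((\<lambda>k. c k * (LINT x:{0..2*pi}|lebesgue. cis (of_int k * x) * u x)) has_sum
         (LINT x:{0..2*pi}|lebesgue. complex_of_real (\<phi> x) * u x)) UNIV)"

(* Elements of Lp are classes modulo null sets, hence equality almost everywhere. *)

definition conv_generates :: "(real \<Rightarrow> real) \<Rightarrow> real \<Rightarrow> (real \<Rightarrow> real) \<Rightarrow> (real \<Rightarrow> real) \<Rightarrow> bool" where
  "conv_generates \<phi> p g f \<longleftrightarrow> g \<in> Lp_circle p \<and> (AE x in lebesgue. f x = circle_conv \<phi> g x)"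

definition Phi_space :: "(real \<Rightarrow> real) \<Rightarrow> real \<Rightarrow> (real \<Rightarrow> real) set" where
  "Phi_space \<phi> p = {f \<in> Lp_circle p. \<exists>g. conv_generates \<phi> p g f}"

(* When no Fourier coefficient of phi vanishes, g is determined by f up to a null set, so
   Phi_norm and Q_op below do not depend on which representative is chosen here. *)

definition Phi_generator :: "(real \<Rightarrow> real) \<Rightarrow> real \<Rightarrow> (real \<Rightarrow> real) \<Rightarrow> real \<Rightarrow> real" where
  "Phi_generator \<phi> p f = (SOME g. conv_generates \<phi> p g f)"

definition Phi_norm :: "(real \<Rightarrow> real) \<Rightarrow> real \<Rightarrow> (real \<Rightarrow> real) \<Rightarrow> real" where
  "Phi_norm \<phi> p f = Lp_norm p (Phi_generator \<phi> p f)"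

definition Phi_ball :: "(real \<Rightarrow> real) \<Rightarrow> real \<Rightarrow> (real \<Rightarrow> real) set" where
  "Phi_ball \<phi> p = {f \<in> Phi_space \<phi> p. Phi_norm \<phi> p f \<le> 1}"

definition alpha_seq :: "(int \<Rightarrow> complex) \<Rightarrow> (int \<Rightarrow> complex) \<Rightarrow> int \<Rightarrow> complex" where
  "alpha_seq lam bet k = bet k / lam k"

definition H_kernel :: "(int \<Rightarrow> complex) \<Rightarrow> (int \<Rightarrow> complex) \<Rightarrow> nat \<Rightarrow> real \<Rightarrow> complex" where
  "H_kernel lam bet m x = (\<Sum>k = - int m..int m. alpha_seq lam bet k * cis (of_int k * x))"

definition V_op ::
  "(int \<Rightarrow> complex) \<Rightarrow> (int \<Rightarrow> complex) \<Rightarrow> nat \<Rightarrow> (real \<Rightarrow> real) \<Rightarrow> real \<Rightarrow> complex" where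
  "V_op lam bet m g = circle_conv (H_kernel lam bet m) (\<lambda>x. complex_of_real (g x))"

definition mesh :: "nat \<Rightarrow> real" where
  "mesh m = 2 * pi / (2 * real m + 1)"

(* The values of V_op used here are real numbers whenever phi_lam and phi_bet are real
   functions with coefficient sequences 1/lam and 1/bet. *)

definition Q_op ::
  "(int \<Rightarrow> complex) \<Rightarrow> (int \<Rightarrow> complex) \<Rightarrow> (real \<Rightarrow> real) \<Rightarrow> (real \<Rightarrow> real) \<Rightarrow> real \<Rightarrow> nat
     \<Rightarrow> (real \<Rightarrow> real) \<Rightarrow> real \<Rightarrow> complex" where
  "Q_op lam bet \<phi>lam \<phi>bet p m f x =
     (\<Sum>l = 0..2 * m. V_op lam bet m (Phi_generator \<phi>lam p f) (mesh m * real l) *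
        complex_of_real (\<phi>bet (x - mesh m * real l))) / of_nat (2 * m + 1)"

definition translate_approx :: "nat \<Rightarrow> (real \<Rightarrow> real) set \<Rightarrow> (real \<Rightarrow> real) \<Rightarrow> real \<Rightarrow> ennreal" where
  "translate_approx n W \<psi> p =
     (SUP f\<in>W. INF c\<in>(UNIV :: (nat \<Rightarrow> real) set). INF y\<in>{1..n} \<rightarrow> {0..2*pi}.
        ennreal (Lp_norm p (\<lambda>x. f x - (\<Sum>l = 1..n. c l * \<psi> (x - y l)))))"

definition centred_residue :: "nat \<Rightarrow> int \<Rightarrow> int" where
  "centred_residue m k = (THE j. j \<in> {- int m..int m} \<and> (2 * int m + 1) dvd (k - j))"

definition gamma_seq :: "(int \<Rightarrow> complex) \<Rightarrow> (int \<Rightarrow> complex) \<Rightarrow> nat \<Rightarrow> int \<Rightarrow> complex" where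
  "gamma_seq lam bet m k = alpha_seq lam bet (centred_residue m k) * inverse (bet k)"

definition fdiff :: "(int \<Rightarrow> complex) \<Rightarrow> int \<Rightarrow> complex" where
  "fdiff \<theta> k = \<theta> k - \<theta> (k + 1)"

definition eps :: "(int \<Rightarrow> complex) \<Rightarrow> (int \<Rightarrow> complex) \<Rightarrow> nat \<Rightarrow> ennreal" where
  "eps lam bet m =
     max (\<Sum>\<^sub>\<infinity>k\<in>{k. \<bar>k\<bar> > int m}. ennreal (norm (fdiff (\<lambda>j. inverse (lam j)) k)))
         ((\<Sum>\<^sub>\<infinity>k\<in>{k. \<bar>k\<bar> > int m}. ennreal (norm (fdiff (gamma_seq lam bet m) k))) +
          (\<Sum>\<^sub>\<infinity>k\<in>UNIV. ennreal (norm (gamma_seq lam bet m (k * (2 * int m + 1) + int m)))))"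

end

theory Submission
  imports Defs "HOL-Complex_Analysis.Complex_Analysis"
begin

text \<open>The coefficients of \<open>f - Q\<^sub>m f\<close> are \<open>g\<^sub>k / \<lambda>\<^sub>k - \<gamma>\<^sub>k g\<^sub>j\<close>, with \<open>j = k'\<close>, which vanish for
  \<open>|k| \<le> m\<close>. Summation by parts, on the two tails for the first term and on blocks of length
  \<open>2 m + 1\<close> for the second, expresses the pairing with a trigonometric polynomial through partial sums
  of \<open>g\<close>, which are bounded in \<open>L\<^sub>p\<close> by M. Riesz's theorem. For \<open>p \<le> 2\<close> the latter follows from
  \<open>|w|\<^sup>p \<le> A (Re w)\<^sup>p - B Re (w\<^sup>p)\<close> on the right half plane and the mean value property of \<open>F\<^sup>p\<close>,
  where \<open>F\<close> is the analytic completion of the Poisson integral of a nonnegative function;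
  duality gives the remaining \<open>p\<close>.\<close>

section \<open>Function spaces on the circle\<close>

text \<open>The two halves of \<open>eps\<close> pay for boundary terms differently. Inside a block
  k' runs through consecutive integers, but it jumps from m back to -m at the block edge, so parts
  cannot be summed across edges. Each block leaves one boundary value of \<open>gamma_seq\<close>,
  at an index r (2m+1) + m, and the last sum in \<open>eps\<close> collects these. The first half of
  \<open>eps\<close> has no such term: each tail leaves a boundary value of 1/lam, which is under
  control because the numbers 1/lam k are Fourier coefficients of an integrable function. These tend
  to 0 in mean, hence are bounded by their variation further out. Within a block, coefficients of g
  meet those of the test function at indices shifted by a multiple of 2m+1; the shift is a
  modulation of the test function and keeps its norm. Testing only against trigonometric polynomials
  makes every pairing a finite sum, so convergence of Fourier series is never an issue and ranges
  may be rounded up to whole blocks. Riesz's bound must be uniform in the start and length of the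
  window of frequencies.\<close>

abbreviation circ :: "real measure" where
  "circ \<equiv> lebesgue_on {0..2*pi}"

definition fcoef :: "(real \<Rightarrow> complex) \<Rightarrow> int \<Rightarrow> complex" where
  "fcoef g k = (LINT x|circ. g x * cis (- (of_int k * x))) / (2 * pi)"

definition Lpc :: "real \<Rightarrow> (real \<Rightarrow> complex) set" where
  "Lpc p = {f. f \<in> borel_measurable circ \<and> integrable circ (\<lambda>x. norm (f x) powr p)}"

text \<open>The factor \<open>(2 * pi) powr (- 1 / p)\<close> of \<open>Lp_norm\<close> is left out
  so that Hoelder's inequality has constant 1 for integrals over \<open>circ\<close>; it returns in
  \<open>Lp_norm_eq_pnorm\<close>.\<close>

definition pnorm :: "real \<Rightarrow> (real \<Rightarrow> complex) \<Rightarrow> real" where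
  "pnorm p f = (LINT x|circ. norm (f x) powr p) powr (1 / p)"

lemma finite_measure_circ: "finite_measure circ"
  by (rule finite_measure_lebesgue_on) (simp add: lmeasurable_cbox flip: box_real)

interpretation circ: finite_measure circ
  by (rule finite_measure_circ)

lemma space_circ [simp]: "space circ = {0..2*pi}"
  by (simp add: space_restrict_space)

lemma measure_circ [simp]: "measure circ {0..2*pi} = 2 * pi"
  by (simp add: measure_restrict_space)

lemma continuous_measurable_circ:
  "continuous_on UNIV f \<Longrightarrow> (f :: real \<Rightarrow> 'a::euclidean_space) \<in> borel_measurable circ"
  by (rule continuous_imp_measurable_on_sets_lebesgue) (auto intro: continuous_on_subset)

lemma set_integrable_circ:
  fixes f :: "real \<Rightarrow> 'a::{banach, second_countable_topology}"
  shows "set_integrable lebesgue {0..2*pi} f \<longleftrightarrow> integrable circ f"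
  by (rule set_integrable_eq) simp

lemma set_lebesgue_integral_circ:
  fixes f :: "real \<Rightarrow> 'a::{banach, second_countable_topology}"
  shows "set_lebesgue_integral lebesgue {0..2*pi} f = integral\<^sup>L circ f"
  unfolding set_lebesgue_integral_def by (rule integral_restrict_space[symmetric]) simp

section \<open>Powers of norms and the spaces \<open>Lpc\<close>\<close>

lemma powr_add_le:
  fixes a b p :: real
  assumes "0 \<le> a" "0 \<le> b" "0 \<le> p"
  shows "(a + b) powr p \<le> 2 powr p * (a powr p + b powr p)"
proof -
  have "(a + b) powr p \<le> (2 * max a b) powr p"
    using assms by (intro powr_mono2) auto
  also have "\<dots> = 2 powr p * max a b powr p"
    using assms by (simp add: powr_mult)
  also have "\<dots> \<le> 2 powr p * (a powr p + b powr p)"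
    by (intro mult_left_mono) (auto simp: max_def)
  finally show ?thesis .
qed

lemma norm_add_powr_le:
  fixes a b :: "'a::real_normed_vector"
  assumes "0 \<le> p"
  shows "norm (a + b) powr p \<le> 2 powr p * (norm a powr p + norm b powr p)"
proof -
  have "norm (a + b) powr p \<le> (norm a + norm b) powr p"
    using assms by (intro powr_mono2) (auto simp: norm_triangle_ineq)
  also have "\<dots> \<le> 2 powr p * (norm a powr p + norm b powr p)"
    by (rule powr_add_le) (use assms in auto)
  finally show ?thesis .
qed

text \<open>This embeds L^p into L^1: the constant 1 is integrable because the measure is
  finite.\<close>

lemma le_one_plus_powr:
  fixes a p :: real
  assumes "0 \<le> a" "1 \<le> p"
  shows "a \<le> 1 + a powr p"
proof (cases "a \<le> 1")
  case False
  then have "a powr 1 \<le> a powr p"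
    using assms by (intro powr_mono) auto
  then show ?thesis using False by simp
qed (simp add: add_increasing2)

lemma Lpc_measurable [measurable_dest]: "f \<in> Lpc p \<Longrightarrow> f \<in> borel_measurable circ"
  by (simp add: Lpc_def)

lemma Lpc_integrable_powr: "f \<in> Lpc p \<Longrightarrow> integrable circ (\<lambda>x. norm (f x) powr p)"
  by (simp add: Lpc_def)

lemma Lpc_integrable:
  assumes "f \<in> Lpc p" "1 \<le> p"
  shows "integrable circ f"
proof (rule Bochner_Integration.integrable_bound)
  show "integrable circ (\<lambda>x. 1 + norm (f x) powr p)"
    using Lpc_integrable_powr[OF assms(1)] by simp
  show "f \<in> borel_measurable circ" using assms(1) by (rule Lpc_measurable)
  show "AE x in circ. norm (f x) \<le> norm (1 + norm (f x) powr p)"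
    using assms by (intro AE_I2) (simp add: le_one_plus_powr)
qed

lemma Lpc_bound:
  assumes g: "g \<in> Lpc p" and f[measurable]: "f \<in> borel_measurable circ" and "0 \<le> p"
    and le: "\<And>x. norm (f x) \<le> C * norm (g x)" and "0 \<le> C"
  shows "f \<in> Lpc p"
proof -
  have "integrable circ (\<lambda>x. norm (f x) powr p)"
  proof (rule Bochner_Integration.integrable_bound)
    show "integrable circ (\<lambda>x. C powr p * norm (g x) powr p)"
      using Lpc_integrable_powr[OF g] by simp
    show "(\<lambda>x. norm (f x) powr p) \<in> borel_measurable circ" by measurable
    have "norm (f x) powr p \<le> C powr p * norm (g x) powr p" for x
      using powr_mono2[OF assms(3) _ le, of x] assms(5) by (simp add: powr_mult)
    then show "AE x in circ. norm (norm (f x) powr p) \<le> norm (C powr p * norm (g x) powr p)"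
      by (intro AE_I2) simp
  qed
  then show ?thesis using f by (simp add: Lpc_def)
qed

lemma Lpc_bounded:
  assumes f[measurable]: "f \<in> borel_measurable circ" and "0 \<le> p" and le: "\<And>x. norm (f x) \<le> C"
  shows "f \<in> Lpc p"
proof -
  have "0 \<le> C" using norm_ge_zero le by (rule order_trans)
  have "(\<lambda>x. 1) \<in> Lpc p" by (simp add: Lpc_def)
  then show ?thesis
    by (rule Lpc_bound[where C = C]) (use assms \<open>0 \<le> C\<close> in auto)
qed

lemma Lpc_add:
  assumes f: "f \<in> Lpc p" and g: "g \<in> Lpc p" and "0 \<le> p"
  shows "(\<lambda>x. f x + g x) \<in> Lpc p"
proof -
  note [measurable] = Lpc_measurable[OF f] Lpc_measurable[OF g]
  have "integrable circ (\<lambda>x. norm (f x + g x) powr p)"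
  proof (rule Bochner_Integration.integrable_bound)
    show "integrable circ (\<lambda>x. 2 powr p * (norm (f x) powr p + norm (g x) powr p))"
      using Lpc_integrable_powr[OF g] Lpc_integrable_powr[OF f] by simp
    show "(\<lambda>x. norm (f x + g x) powr p) \<in> borel_measurable circ" by measurable
    show "AE x in circ. norm (norm (f x + g x) powr p)
        \<le> norm (2 powr p * (norm (f x) powr p + norm (g x) powr p))"
      using norm_add_powr_le[OF \<open>0 \<le> p\<close>] by (intro AE_I2) simp
  qed
  then show ?thesis by (simp add: Lpc_def)
qed

lemma Lpc_cmult:
  assumes "f \<in> Lpc p" "0 \<le> p"
  shows "(\<lambda>x. c * f x) \<in> Lpc p"
proof (rule Lpc_bound[OF assms(1), where C = "norm c"])
  note [measurable] = Lpc_measurable[OF assms(1)]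
  show "(\<lambda>x. c * f x) \<in> borel_measurable circ" by measurable
qed (use assms in \<open>auto simp: norm_mult\<close>)

lemma Lpc_sum:
  assumes "\<And>i. i \<in> I \<Longrightarrow> f i \<in> Lpc p" "0 \<le> p"
  shows "(\<lambda>x. \<Sum>i\<in>I. f i x) \<in> Lpc p"
  using assms(1)
proof (induction I rule: infinite_finite_induct)
  case (insert i I)
  then show ?case using Lpc_add[of "f i" p "\<lambda>x. \<Sum>i\<in>I. f i x"] assms(2) by simp
qed (use assms(2) in \<open>auto intro!: Lpc_bounded[where C = 0]\<close>)

section \<open>Hoelder's inequality\<close>

lemma conjugate_gt1:
  fixes p q :: real
  assumes "1 < p" "1 / p + 1 / q = 1"
  shows "1 < q"
proof -
  have "0 < 1 / p" "1 / p < 1" using assms by simp_all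
  then have "0 < 1 / q" "1 / q < 1" using assms(2) by linarith+
  then show ?thesis by (metis zero_less_divide_1_iff divide_less_eq_1_pos)
qed

text \<open>Young's inequality applied to \<open>|f| / A\<close> and \<open>|g| / B\<close>.\<close>

lemma Hoelder_integral:
  fixes f g :: "'a \<Rightarrow> real"
  assumes p: "1 < p" "1 / p + 1 / q = 1"
    and f[measurable]: "f \<in> borel_measurable M" and g[measurable]: "g \<in> borel_measurable M"
    and fp: "integrable M (\<lambda>x. \<bar>f x\<bar> powr p)" and gq: "integrable M (\<lambda>x. \<bar>g x\<bar> powr q)"
  shows "integrable M (\<lambda>x. f x * g x)"
    and "(LINT x|M. \<bar>f x * g x\<bar>)
      \<le> (LINT x|M. \<bar>f x\<bar> powr p) powr (1 / p) * (LINT x|M. \<bar>g x\<bar> powr q) powr (1 / q)"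
proof -
  have q: "1 < q" using conjugate_gt1 p by blast
  show int: "integrable M (\<lambda>x. f x * g x)"
  proof (rule Bochner_Integration.integrable_bound)
    show "integrable M (\<lambda>x. \<bar>f x\<bar> powr p / p + \<bar>g x\<bar> powr q / q)"
      using fp gq by simp
    show "(\<lambda>x. f x * g x) \<in> borel_measurable M" by measurable
    show "AE x in M. norm (f x * g x) \<le> norm (\<bar>f x\<bar> powr p / p + \<bar>g x\<bar> powr q / q)"
      using Youngs_inequality[OF p(1) q p(2)] p q by (intro AE_I2) (simp add: abs_mult)
  qed
  define A where "A = (LINT x|M. \<bar>f x\<bar> powr p) powr (1 / p)"
  define B where "B = (LINT x|M. \<bar>g x\<bar> powr q) powr (1 / q)"
  have IA: "(LINT x|M. \<bar>f x\<bar> powr p) = A powr p" and IB: "(LINT x|M. \<bar>g x\<bar> powr q) = B powr q"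
    using p q by (auto simp: A_def B_def powr_powr intro!: integral_nonneg_AE)
  \<comment> \<open>Normalising by \<open>A\<close> and \<open>B\<close> fails when one of them is
    0. Then the factor \<open>u\<close> whose power integral vanishes is 0 almost everywhere, and so
    is the product.\<close>
  have z: "(LINT x|M. \<bar>f x * g x\<bar>) = 0"
    if "u \<in> {f, g}" and 1: "integrable M (\<lambda>x. \<bar>u x\<bar> powr r)" and "(LINT x|M. \<bar>u x\<bar> powr r) = 0" for u r
  proof -
    have "AE x in M. \<bar>u x\<bar> powr r = 0"
      using integral_nonneg_eq_0_iff_AE[OF 1] that by simp
    then have "AE x in M. \<bar>f x * g x\<bar> = 0"
      by (rule eventually_mono) (use that(1) in auto)
    then show ?thesis by (rule integral_eq_zero_AE)
  qed
  show "(LINT x|M. \<bar>f x * g x\<bar>)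
      \<le> (LINT x|M. \<bar>f x\<bar> powr p) powr (1 / p) * (LINT x|M. \<bar>g x\<bar> powr q) powr (1 / q)"
    unfolding A_def[symmetric] B_def[symmetric]
  proof (cases "A = 0 \<or> B = 0")
    case True
    then have "(LINT x|M. \<bar>f x\<bar> powr p) = 0 \<or> (LINT x|M. \<bar>g x\<bar> powr q) = 0"
      using IA IB p q by auto
    then have "(LINT x|M. \<bar>f x * g x\<bar>) = 0" using z fp gq by blast
    moreover have "0 \<le> A" "0 \<le> B" by (auto simp: A_def B_def)
    ultimately show "(LINT x|M. \<bar>f x * g x\<bar>) \<le> A * B" by simp
  next
    case False
    then have AB: "0 < A" "0 < B" by (auto simp: A_def B_def)
    have "(LINT x|M. \<bar>f x * g x\<bar>)
        \<le> (LINT x|M. (A * B) * (\<bar>f x\<bar> powr p / (p * A powr p) + \<bar>g x\<bar> powr q / (q * B powr q)))"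
    proof (rule integral_mono)
      show "integrable M (\<lambda>x. (A * B) * (\<bar>f x\<bar> powr p / (p * A powr p) + \<bar>g x\<bar> powr q / (q * B powr q)))"
        using fp gq by simp
      fix x
      have "(\<bar>f x\<bar> / A) * (\<bar>g x\<bar> / B) \<le> (\<bar>f x\<bar> / A) powr p / p + (\<bar>g x\<bar> / B) powr q / q"
        by (rule Youngs_inequality) (use p q AB in auto)
      then have "(A * B) * ((\<bar>f x\<bar> / A) * (\<bar>g x\<bar> / B))
        \<le> (A * B) * ((\<bar>f x\<bar> / A) powr p / p + (\<bar>g x\<bar> / B) powr q / q)"
        using AB by (intro mult_left_mono) auto
      then show "\<bar>f x * g x\<bar> \<le> (A * B) * (\<bar>f x\<bar> powr p / (p * A powr p) + \<bar>g x\<bar> powr q / (q * B powr q))"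
        using AB by (simp add: abs_mult powr_divide field_simps)
    qed (use int in auto)
    also have "\<dots> = (A * B) * (1 / p + 1 / q)"
      using fp gq AB p q by (simp add: IA IB)
    finally show "(LINT x|M. \<bar>f x * g x\<bar>) \<le> A * B" using p by simp
  qed
qed

lemma Lpc_Hoelder:
  assumes p: "1 < p" "1 / p + 1 / q = 1" and f: "f \<in> Lpc p" and g: "g \<in> Lpc q"
  shows "integrable circ (\<lambda>x. f x * g x)"
    and "norm (LINT x|circ. f x * g x) \<le> pnorm p f * pnorm q g"
proof -
  note [measurable] = Lpc_measurable[OF f] Lpc_measurable[OF g]
  have "(\<lambda>x. norm (f x)) \<in> borel_measurable circ" "(\<lambda>x. norm (g x)) \<in> borel_measurable circ"
    by measurable
  note H = Hoelder_integral[OF p this]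
  have 1: "integrable circ (\<lambda>x. norm (f x) * norm (g x))"
    using H(1) Lpc_integrable_powr[OF f] Lpc_integrable_powr[OF g] by simp
  have [measurable]: "(\<lambda>x. f x * g x) \<in> borel_measurable circ" by measurable
  show "integrable circ (\<lambda>x. f x * g x)"
    by (rule integrable_norm_cancel) (use 1 in \<open>simp_all add: norm_mult\<close>)
  have "norm (LINT x|circ. f x * g x) \<le> (LINT x|circ. norm (f x * g x))"
    by (rule integral_norm_bound)
  also have "\<dots> \<le> pnorm p f * pnorm q g"
    using H(2) Lpc_integrable_powr[OF f] Lpc_integrable_powr[OF g]
    by (simp add: norm_mult pnorm_def)
  finally show "norm (LINT x|circ. f x * g x) \<le> pnorm p f * pnorm q g" .
qed

lemma integrable_circ_mult_cis:
  assumes "integrable circ f"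
  shows "integrable circ (\<lambda>x. f x * cis (a * x))"
proof (rule Bochner_Integration.integrable_bound[OF assms])
  have [measurable]: "(\<lambda>x. cis (a * x)) \<in> borel_measurable circ"
    by (intro continuous_measurable_circ continuous_intros)
  note [measurable] = borel_measurable_integrable[OF assms]
  show "(\<lambda>x. f x * cis (a * x)) \<in> borel_measurable circ" by measurable
qed (auto simp: norm_mult)

section \<open>The Szego and Poisson kernels\<close>

interpretation circ_pair: pair_sigma_finite circ circ
  by unfold_locales

text \<open>Dividing by \<open>norm w powr p\<close> leaves an inequality in t = Arg w for |t| <
  pi/2, namely \<open>1 \<le> A * cos t powr p - B * cos (p * t)\<close>. Near the ends cos t
  degenerates, but p t then lies beyond pi/2 and not beyond pi, where the cosine is negative; away
  from the ends cos t is bounded below and a large A suffices.\<close>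

lemma right_half_plane_powr_ineq:
  fixes p :: real
  assumes "1 < p" "p \<le> 2"
  obtains A B where "0 \<le> A" "0 \<le> B"
    "\<And>w. 0 < Re w \<Longrightarrow> norm w powr p \<le> A * Re w powr p - B * Re (w powr of_real p)"
proof -
  \<comment> \<open>The midpoint of pi/(2p) and pi/2: beyond it \<open>cos (p * t)\<close> is
    negative, below it \<open>cos t\<close> stays away from 0.\<close>
  define \<theta>0 where "\<theta>0 = (pi / (2 * p) + pi / 2) / 2"
  have less: "pi / (2 * p) < pi / 2"
    using assms by (intro divide_strict_left_mono) auto
  have \<theta>0: "0 < \<theta>0" "\<theta>0 < pi / 2" "pi / (2 * p) < \<theta>0"
    using less assms by (auto simp: \<theta>0_def add_pos_pos)
  have "p * (pi / (2 * p)) < p * \<theta>0"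
    using \<theta>0 assms by (intro mult_strict_left_mono) auto
  then have 1: "pi / 2 < p * \<theta>0" using assms by simp
  \<comment> \<open>Here \<open>p \<le> 2\<close> enters: the angles p t stay in [0, pi], where the
    cosine decreases.\<close>
  have le_pi: "p * t \<le> pi" if "0 \<le> t" "t \<le> pi / 2" for t
    using mult_mono[of p 2 t "pi/2"] that assms by simp
  have neg: "cos (p * \<theta>0) < 0"
  proof -
    have "cos (p * \<theta>0) < cos (pi / 2)"
      using 1 le_pi[of \<theta>0] \<theta>0 by (intro cos_monotone_0_pi) auto
    then show ?thesis by simp
  qed
  \<comment> \<open>\<open>B\<close> makes \<open>- B * cos (p * \<theta>0)\<close> equal to 1; then
    \<open>A * cos \<theta>0 powr p = 1 + B\<close> also covers the largest possible value
    \<open>B\<close> of \<open>B * cos (p * t)\<close>.\<close>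
  define B where "B = 1 / (- cos (p * \<theta>0))"
  define A where "A = (1 + B) / cos \<theta>0 powr p"
  have cpos: "0 < cos \<theta>0" using \<theta>0 by (intro cos_gt_zero_pi) auto
  have B: "0 \<le> B" using neg by (simp add: B_def)
  have A: "0 \<le> A" using B by (simp add: A_def)
  have key: "1 \<le> A * cos t powr p - B * cos (p * t)" if "\<bar>t\<bar> < pi / 2" for t
  proof -
    have cos_abs: "cos \<bar>t\<bar> = cos t" "cos (p * \<bar>t\<bar>) = cos (p * t)"
      by (simp_all add: abs_if)
    show ?thesis
    proof (cases "\<theta>0 \<le> \<bar>t\<bar>")
      case True
      have "cos (p * \<bar>t\<bar>) \<le> cos (p * \<theta>0)"
        using True assms le_pi[of "\<bar>t\<bar>"] that \<theta>0 by (intro cos_monotone_0_pi_le) auto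
      then have "B * cos (p * \<bar>t\<bar>) \<le> B * cos (p * \<theta>0)"
        using B by (rule mult_left_mono)
      also have "\<dots> = -1" using neg by (simp add: B_def)
      finally have "B * cos (p * \<bar>t\<bar>) \<le> -1" .
      moreover have "0 \<le> A * cos t powr p" using A by simp
      ultimately show ?thesis unfolding cos_abs by linarith
    next
      case False
      have "cos \<theta>0 \<le> cos \<bar>t\<bar>"
        using False \<theta>0 by (intro cos_monotone_0_pi_le) auto
      then have "cos \<theta>0 powr p \<le> cos \<bar>t\<bar> powr p"
        using cpos assms by (intro powr_mono2) auto
      then have "A * cos \<theta>0 powr p \<le> A * cos \<bar>t\<bar> powr p"
        using A by (rule mult_left_mono)
      moreover have "A * cos \<theta>0 powr p = 1 + B" using cpos by (simp add: A_def)
      moreover have "B * cos (p * \<bar>t\<bar>) \<le> B * 1" using B by (intro mult_left_mono) auto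
      ultimately show ?thesis by (simp add: cos_abs)
    qed
  qed
  show ?thesis
  proof (rule that[OF A B])
    fix w :: complex assume w: "0 < Re w"
    then have "w \<noteq> 0" by auto
    have arg: "\<bar>Arg w\<bar> < pi / 2" using w Arg_Re_pos by blast
    have Re: "Re w = norm w * cos (Arg w)"
      by (metis Re_rcis rcis_cmod_Arg)
    have cos: "0 < cos (Arg w)" using arg by (intro cos_gt_zero_pi) auto
    have Rep: "Re (w powr of_real p) = norm w powr p * cos (p * Arg w)"
      using \<open>w \<noteq> 0\<close> by (simp add: powr_def Re_exp Arg_def)
    have "norm w powr p * 1 \<le> norm w powr p * (A * cos (Arg w) powr p - B * cos (p * Arg w))"
      by (intro mult_left_mono key arg) auto
    also have "\<dots> = A * Re w powr p - B * Re (w powr of_real p)"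
      using cos by (simp add: Re Rep powr_mult algebra_simps)
    finally show "norm w powr p \<le> A * Re w powr p - B * Re (w powr of_real p)" by simp
  qed
qed

section \<open>Mean values over circles\<close>

lemma integrable_circ_continuous:
  fixes f :: "real \<Rightarrow> 'a::euclidean_space"
  assumes "continuous_on UNIV f"
  shows "integrable circ f"
proof -
  have "f absolutely_integrable_on {0..2*pi}"
    using assms by (metis absolutely_integrable_continuous_real continuous_on_subset top_greatest)
  then show ?thesis by (simp add: set_integrable_circ)
qed

lemma circle_mean_value:
  assumes f: "f holomorphic_on ball 0 1" and r: "0 < r" "r < 1"
  shows "(LINT x|circ. f (of_real r * cis x)) = of_real (2 * pi) * f 0"
proof -
  have cont: "continuous_on UNIV (\<lambda>x. f (of_real r * cis x))"
    by (rule continuous_on_compose2[where g = f, OF holomorphic_on_imp_continuous_on[OF f]])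
      (use r in \<open>auto simp: norm_mult intro!: continuous_intros\<close>)
  have "f holomorphic_on cball 0 r"
    using r by (intro holomorphic_on_subset[OF f]) auto
  then have "((\<lambda>u. f u/(u-0)) has_contour_integral (2 * of_real pi * \<i> * f 0)) (circlepath 0 r)"
    by (rule Cauchy_integral_circlepath_simple) (use r in auto)
  then have "((\<lambda>t. f (0 + r * cis t) / (0 + r * cis t - 0) * r * \<i> * cis t)
      has_integral (2 * of_real pi * \<i> * f 0)) {0..2*pi}"
    unfolding circlepath_def by (subst (asm) has_contour_integral_part_circlepath_iff) auto
  also have "(\<lambda>t. f (0 + r * cis t) / (0 + r * cis t - 0) * r * \<i> * cis t)
      = (\<lambda>t. \<i> * f (r * cis t))"
    using r by (auto simp: fun_eq_iff field_simps)
  \<comment> \<open>Multiplication by -i removes the factor i that stems from the derivative of the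
    parametrisation.\<close>
  finally have "((\<lambda>t. (-\<i>) * (\<i> * f (r * cis t))) has_integral (-\<i>) * (2 * of_real pi * \<i> * f 0)) {0..2*pi}"
    by (rule has_integral_mult_right)
  note int = this
  have h1: "((\<lambda>t. f (r * cis t)) has_integral (2 * of_real pi * f 0)) {0..2*pi}"
  proof -
    have 1: "(-\<i>) * (\<i> * w) = w" for w by simp
    from 1[of "2 * of_real pi * f 0"]
    have 2: "(-\<i>) * (2 * of_real pi * \<i> * f 0) = 2 * of_real pi * f 0" by (simp add: ac_simps)
    show ?thesis using int unfolding 1 2 .
  qed
  have h2: "((\<lambda>t. f (r * cis t)) has_integral (LINT x|circ. f (of_real r * cis x))) {0..2*pi}"
    by (intro has_integral_integral_lebesgue_on integrable_circ_continuous cont) auto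
  show ?thesis using has_integral_unique[OF h2 h1] by simp
qed

text \<open>Positive frequencies come from the mean value of z ^ n over the circle of radius 1/2,
  negative ones by conjugation.\<close>

lemma integral_cis:
  "(LINT x|circ. cis (of_int k * x)) = (if k = 0 then 2 * pi else 0)"
proof -
  have pos: "(LINT x|circ. cis (real n * x)) = 0" if "0 < n" for n :: nat
  proof -
    have "(LINT x|circ. (of_real (1/2) * cis x) ^ n) = complex_of_real (2 * pi) * 0 ^ n"
      using circle_mean_value[of "\<lambda>z::complex. z ^ n" "1/2"] by (simp add: holomorphic_on_power)
    also have "(LINT x|circ. (of_real (1/2) * cis x) ^ n) = (LINT x|circ. (1/2) ^ n * cis (real n * x))"
    proof -
      have "(of_real (1/2) * cis x) ^ n = (1/2) ^ n * cis (real n * x)" for x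
        by (simp only: power_mult_distrib Complex.DeMoivre) simp
      then show ?thesis by simp
    qed
    finally have "(1 / 2) ^ n * (LINT x|circ. cis (real n * x)) = 0" using that by simp
    then show ?thesis by (simp only: mult_eq_0_iff power_eq_0_iff) simp
  qed
  consider "k = 0" | n where "0 < n" "k = int n" | n where "0 < n" "k = - int n"
    by (cases k rule: int_cases3) auto
  then show ?thesis
  proof cases
    case 3
    have "(LINT x|circ. cis (of_int k * x)) = (LINT x|circ. cnj (cis (real n * x)))"
      using 3 by (simp add: cis_cnj)
    also have "\<dots> = cnj (LINT x|circ. cis (real n * x))"
      by simp
    finally show ?thesis using pos 3 by simp
  qed (use pos in \<open>auto simp: scaleR_conv_of_real\<close>)
qed

text \<open>The Cauchy integral of g over the unit circle: with \<zeta> = cis t, the form d\<zeta> /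
  (2 pi i (\<zeta> - z)) becomes dt / (2 pi (1 - z cis (-t))). Formally, its boundary values are the
  part of the Fourier series of g with nonnegative frequencies.\<close>

definition szego :: "(real \<Rightarrow> complex) \<Rightarrow> complex \<Rightarrow> complex" where
  "szego g z = (LINT t|circ. g t / (1 - z * cis (- t))) / (2 * pi)"

lemma borel_measurable_cis [measurable]: "(\<lambda>t. cis (f t)) \<in> borel_measurable M"
  if [measurable]: "f \<in> borel_measurable M" for f :: "_ \<Rightarrow> real"
proof -
  have [measurable]: "cis \<in> borel_measurable borel"
    by (intro borel_measurable_continuous_onI continuous_intros)
  show ?thesis by measurable
qed

lemma id_measurable_circ [measurable]: "(\<lambda>x. x) \<in> borel_measurable circ"
  by (intro continuous_measurable_circ continuous_intros)

lemma one_minus_mult_cis_ge: "1 - norm z \<le> norm (1 - z * cis t)"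
  using norm_triangle_ineq2[of 1 "z * cis t"] by (simp add: norm_mult)

lemma one_minus_mult_cis_nonzero: "norm z < 1 \<Longrightarrow> 1 - z * cis t \<noteq> 0"
  using one_minus_mult_cis_ge[of z t] by auto

lemma szego_integrable:
  assumes "integrable circ g" "norm z < 1"
  shows "integrable circ (\<lambda>t. g t / (1 - z * cis (- t)))"
proof (rule Bochner_Integration.integrable_bound)
  note [measurable] = borel_measurable_integrable[OF assms(1)]
  show "integrable circ (\<lambda>t. norm (g t) / (1 - norm z))" using assms by simp
  show "(\<lambda>t. g t / (1 - z * cis (- t))) \<in> borel_measurable circ" by measurable
  show "AE t in circ. norm (g t / (1 - z * cis (- t))) \<le> norm (norm (g t) / (1 - norm z))"
    using one_minus_mult_cis_ge[of z] one_minus_mult_cis_nonzero[OF assms(2)] assms(2)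
    by (intro AE_I2) (auto simp: norm_divide intro!: divide_left_mono mult_pos_pos)
qed

text \<open>The kernel is expanded in a geometric series and integrated termwise, with majorant
  \<open>norm z ^ k * norm (g t)\<close>. That the Taylor coefficients are Fourier coefficients is
  what later isolates windows of frequencies.\<close>

lemma szego_sums:
  assumes g: "integrable circ g" and z: "norm z < 1"
  shows "(\<lambda>k. fcoef g (int k) * z ^ k) sums szego g z"
proof -
  let ?f = "\<lambda>k t. g t * (z * cis (- t)) ^ k"
  note [measurable] = borel_measurable_integrable[OF g]
  have f_eq: "?f k t = z ^ k * (g t * cis (- (of_int (int k) * t)))" for k t
    by (simp add: power_mult_distrib Complex.DeMoivre)
  have norm_f: "norm (?f k t) = norm z ^ k * norm (g t)" for k t
    by (simp add: norm_mult norm_power)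
  have "(\<lambda>k. integral\<^sup>L circ (?f k)) sums (LINT t|circ. (\<Sum>k. ?f k t))"
  proof (rule sums_integral)
    show "integrable circ (?f k)" for k
      unfolding f_eq
      using integrable_circ_mult_cis[OF g, of "- of_int (int k)"]
      by (intro integrable_mult_right) simp
    show "AE t in circ. summable (\<lambda>k. norm (?f k t))"
      unfolding norm_f using z by (intro AE_I2 summable_mult2 summable_geometric) auto
    show "summable (\<lambda>k. LINT t|circ. norm (?f k t))"
      unfolding norm_f using z by (simp add: summable_mult2 summable_geometric)
  qed
  moreover have "(\<Sum>k. ?f k t) = g t / (1 - z * cis (- t))" for t
    using z by (subst suminf_mult) (auto simp: summable_geometric suminf_geometric norm_mult)
  ultimately have "(\<lambda>k. integral\<^sup>L circ (?f k) / (2 * pi)) sums szego g z"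
    unfolding szego_def by (intro sums_divide) simp
  moreover have "integral\<^sup>L circ (?f k) / (2 * pi) = fcoef g (int k) * z ^ k" for k
    unfolding f_eq by (simp add: fcoef_def)
  ultimately show ?thesis by simp
qed

lemma szego_holomorphic:
  assumes "integrable circ g"
  shows "szego g holomorphic_on ball 0 1"
  by (rule power_series_holomorphic[where a = "\<lambda>k. fcoef g (int k)"])
    (use szego_sums[OF assms] in simp)

lemma szego_0: "szego g 0 = fcoef g 0"
  by (simp add: szego_def fcoef_def)

lemma szego_1:
  assumes "norm z < 1"
  shows "szego (\<lambda>_. 1) z = 1"
proof -
  have "fcoef (\<lambda>_. 1) (int k) = (if k = 0 then 1 else 0)" for k
    using integral_cis[of "- int k"] by (simp add: fcoef_def)
  then have "(\<lambda>k. fcoef (\<lambda>_. 1) (int k) * z ^ k) = (\<lambda>k. if k = 0 then 1 else 0)"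
    by (auto simp: fun_eq_iff)
  then have "(\<lambda>k. if k = 0 then 1 else 0) sums szego (\<lambda>_. 1) z"
    using szego_sums[of "\<lambda>_. 1" z] assms by simp
  then show ?thesis using sums_single[of 0 "\<lambda>_. 1::complex"] sums_unique2 by fastforce
qed

text \<open>With w = z cis (-t) this is Re ((1 + w) / (1 - w)), split so that integrating u against
  it gives, up to 2 pi, the real part of twice the Cauchy integral of u minus its mean.\<close>

definition poisson :: "complex \<Rightarrow> real \<Rightarrow> real" where
  "poisson z t = Re (2 / (1 - z * cis (- t)) - 1)"

lemma poisson_altdef:
  assumes "norm z < 1"
  shows "poisson z t = (1 - (norm z)\<^sup>2) / (norm (1 - z * cis (- t)))\<^sup>2"
proof -
  let ?w = "1 - z * cis (- t)"
  have nz: "?w \<noteq> 0" by (rule one_minus_mult_cis_nonzero[OF assms])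
  have "(norm (1 - w))\<^sup>2 = 1 - 2 * Re w + (norm w)\<^sup>2" for w
    unfolding cmod_power2 by (simp add: power2_eq_square algebra_simps)
  from this[of ?w] have 1: "1 - (norm z)\<^sup>2 = 2 * Re ?w - (norm ?w)\<^sup>2"
    by (simp only: diff_diff_eq2 add_diff_cancel_left' norm_mult norm_cis) simp
  have "Re (2 / w - 1) = 2 * Re w / (norm w)\<^sup>2 - 1" for w
    by (simp add: cmod_power2 Re_divide)
  then have 2: "poisson z t = 2 * Re ?w / (norm ?w)\<^sup>2 - 1"
    unfolding poisson_def by blast
  have "(norm ?w)\<^sup>2 \<noteq> 0" using nz by (metis norm_eq_zero power_eq_0_iff)
  then show ?thesis unfolding 1 2 by (simp only: diff_divide_distrib divide_self if_False) simp
qed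

text \<open>A Harnack bound, uniform in t; it makes Poisson integrals of nonzero nonnegative
  functions strictly positive.\<close>

lemma poisson_ge:
  assumes "norm z < 1"
  shows "(1 - norm z) / (1 + norm z) \<le> poisson z t"
proof -
  let ?w = "1 - z * cis (- t)"
  have nz: "?w \<noteq> 0" by (rule one_minus_mult_cis_nonzero[OF assms])
  have "norm ?w \<le> 1 + norm z"
    using norm_triangle_ineq4[of 1 "z * cis (- t)"] by (simp add: norm_mult)
  then have "(norm ?w)\<^sup>2 \<le> (1 + norm z)\<^sup>2" by (intro power_mono) auto
  moreover have "0 \<le> 1 - (norm z)\<^sup>2" using assms by (simp add: power_le_one)
  ultimately have "(1 - (norm z)\<^sup>2) / (1 + norm z)\<^sup>2 \<le> poisson z t"
    unfolding poisson_altdef[OF assms] using nz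
    by (intro divide_left_mono mult_pos_pos) (auto intro!: add_pos_nonneg)
  moreover have "(1 - (norm z)\<^sup>2) / (1 + norm z)\<^sup>2 = (1 - norm z) / (1 + norm z)"
  proof -
    have "1 + norm z \<noteq> 0" using norm_ge_zero[of z] by linarith
    then show ?thesis by (simp add: divide_simps power2_eq_square) (simp add: algebra_simps)
  qed
  ultimately show ?thesis by simp
qed

lemma poisson_pos: "norm z < 1 \<Longrightarrow> 0 < poisson z t"
  by (rule less_le_trans[OF _ poisson_ge]) (auto intro!: divide_pos_pos add_pos_nonneg)

text \<open>The expressions under Re are complex conjugates. The symmetry is used after Tonelli,
  where the kernel has to be integrated over the angle x of the point of evaluation.\<close>

lemma poisson_sym: "poisson (of_real r * cis x) t = poisson (of_real r * cis t) x"
proof -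
  have "cis x * cis (- t) = cnj (cis t * cis (- x))"
    by (simp add: cis_mult cis_cnj)
  then have "1 - of_real r * cis x * cis (- t) = cnj (1 - of_real r * cis t * cis (- x))"
    by (simp add: mult.assoc)
  then have "2 / (1 - of_real r * cis x * cis (- t)) - 1
    = cnj (2 / (1 - of_real r * cis t * cis (- x)) - 1)" by simp
  then show ?thesis unfolding poisson_def by (metis complex_cnj(1) cnj.sel(1))
qed

lemma poisson_measurable [measurable]:
  assumes [measurable]: "f \<in> borel_measurable M" "g \<in> borel_measurable M"
  shows "(\<lambda>x. poisson (f x) (g x)) \<in> borel_measurable M"
  unfolding poisson_def by measurable

lemma poisson_integral_eq:
  assumes u: "integrable circ u" and z: "norm z < 1"
  shows "integrable circ (\<lambda>t. u t * poisson z t)"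
    and "(LINT t|circ. u t * poisson z t)
      = 2 * pi * Re (2 * szego (\<lambda>t. of_real (u t)) z - fcoef (\<lambda>t. of_real (u t)) 0)"
proof -
  let ?g = "\<lambda>t. complex_of_real (u t)"
  have g: "integrable circ ?g" using u by simp
  have 1: "integrable circ (\<lambda>t. 2 * (?g t / (1 - z * cis (- t))) - ?g t)"
    by (intro Bochner_Integration.integrable_diff integrable_mult_right szego_integrable g z)
  have eq: "u t * poisson z t = Re (2 * (?g t / (1 - z * cis (- t))) - ?g t)" for t
  proof -
    have "2 * (?g t / (1 - z * cis (- t))) - ?g t = ?g t * (2 / (1 - z * cis (- t)) - 1)"
      by (simp add: algebra_simps)
    then show ?thesis by (simp only: poisson_def) simp
  qed
  show "integrable circ (\<lambda>t. u t * poisson z t)"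
    unfolding eq by (rule integrable_Re[OF 1])
  have "(LINT t|circ. u t * poisson z t) = Re (LINT t|circ. 2 * (?g t / (1 - z * cis (- t))) - ?g t)"
    unfolding eq by (rule integral_Re[OF 1])
  also have "(LINT t|circ. 2 * (?g t / (1 - z * cis (- t))) - ?g t)
      = 2 * pi * (2 * szego ?g z - fcoef ?g 0)"
  proof -
    have "(LINT t|circ. 2 * (?g t / (1 - z * cis (- t))) - ?g t)
      = 2 * (LINT t|circ. ?g t / (1 - z * cis (- t))) - (LINT t|circ. ?g t)"
      by (subst Bochner_Integration.integral_diff)
        (auto intro!: integrable_mult_right szego_integrable g z simp del: times_divide_eq_right)
    then show ?thesis by (simp add: szego_def fcoef_def right_diff_distrib)
  qed
  finally show "(LINT t|circ. u t * poisson z t) = 2 * pi * Re (2 * szego ?g z - fcoef ?g 0)"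
    by simp
qed

lemma poisson_integral: "norm z < 1 \<Longrightarrow> (LINT t|circ. poisson z t) = 2 * pi"
  using poisson_integral_eq[of "\<lambda>_. 1" z]
  by (simp add: szego_1 fcoef_def scaleR_conv_of_real)

lemma Re_schwarz_eq:
  assumes "integrable circ u" "norm z < 1"
  shows "Re (2 * szego (\<lambda>t. of_real (u t)) z - fcoef (\<lambda>t. of_real (u t)) 0)
    = (LINT t|circ. u t * poisson z t) / (2 * pi)"
  using poisson_integral_eq(2)[OF assms] by simp

text \<open>Strict positivity keeps F off the nonpositive real axis, so that the principal branch of
  F powr p is holomorphic on the disc.\<close>

lemma Re_schwarz_pos:
  assumes u: "integrable circ u" "\<And>t. 0 \<le> u t" "0 < (LINT t|circ. u t)" and z: "norm z < 1"
  shows "0 < Re (2 * szego (\<lambda>t. of_real (u t)) z - fcoef (\<lambda>t. of_real (u t)) 0)"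
proof -
  let ?c = "(1 - norm z) / (1 + norm z)"
  have "0 < ?c" using z by (intro divide_pos_pos add_pos_nonneg) auto
  with u(3) have "0 < (LINT t|circ. u t) * ?c" by (rule mult_pos_pos)
  also have "\<dots> = (LINT t|circ. u t * ?c)" by simp
  also have "\<dots> \<le> (LINT t|circ. u t * poisson z t)"
    using u(1) z by (intro integral_mono poisson_integral_eq(1) mult_left_mono poisson_ge u) auto
  finally show ?thesis
    unfolding Re_schwarz_eq[OF u(1) z] by simp
qed

text \<open>Jensen's inequality for the probability density \<open>poisson z / (2 \<pi>)\<close>, from Young's
  inequality \<open>p a b powr (p - 1) \<le> a powr p + (p - 1) b powr p\<close> with \<open>b\<close> the average.\<close>

lemma poisson_jensen:
  assumes p: "1 < p" and u: "integrable circ u" "\<And>t. 0 \<le> u t" "integrable circ (\<lambda>t. u t powr p)"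
    and z: "norm z < 1"
  shows "((LINT t|circ. u t * poisson z t) / (2 * pi)) powr p
    \<le> (LINT t|circ. u t powr p * poisson z t) / (2 * pi)"
proof -
  define b where "b = (LINT t|circ. u t * poisson z t) / (2 * pi)"
  define q where "q = p / (p - 1)"
  have q: "1 < q" "1 / p + 1 / q = 1" using p by (auto simp: q_def field_simps)
  have "0 \<le> b"
    unfolding b_def using poisson_pos[OF z]
    by (intro divide_nonneg_pos integral_nonneg_AE AE_I2 mult_nonneg_nonneg u) (auto intro: less_imp_le)
  have young: "p * (u t * b powr (p - 1)) \<le> u t powr p + (p - 1) * b powr p" for t
  proof -
    have "u t * b powr (p - 1) \<le> u t powr p / p + (b powr (p - 1)) powr q / q"
      by (rule Youngs_inequality) (use p q u in auto)
    also have "(b powr (p - 1)) powr q = b powr p"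
      using p by (simp add: powr_powr q_def)
    also have "1 / q = (p - 1) / p" using p by (simp add: q_def)
    then have "b powr p / q = (p - 1) * b powr p / p" by (metis mult.commute times_divide_eq_left times_divide_eq_right mult_1)
    finally have "p * (u t * b powr (p - 1)) \<le> p * (u t powr p / p + (p - 1) * b powr p / p)"
      using p by simp
    also have "\<dots> = u t powr p + (p - 1) * b powr p" using p by (simp add: distrib_left)
    finally show ?thesis .
  qed
  have int1: "integrable circ (\<lambda>t. u t * poisson z t)"
    and int2: "integrable circ (\<lambda>t. u t powr p * poisson z t)"
    and int3: "integrable circ (poisson z)"
    using poisson_integral_eq(1)[OF u(1) z] poisson_integral_eq(1)[OF u(3) z]
      poisson_integral_eq(1)[of "\<lambda>_. 1" z] z by simp_all
  have "p * b powr (p - 1) * (2 * pi * b) = (LINT t|circ. p * b powr (p - 1) * (u t * poisson z t))"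
    by (simp add: b_def)
  also have "\<dots> \<le> (LINT t|circ. u t powr p * poisson z t + (p - 1) * b powr p * poisson z t)"
  proof (rule integral_mono)
    fix t
    show "p * b powr (p - 1) * (u t * poisson z t)
        \<le> u t powr p * poisson z t + (p - 1) * b powr p * poisson z t"
      using mult_right_mono[OF young[of t] less_imp_le[OF poisson_pos[OF z, of t]]]
      by (simp add: algebra_simps)
  qed (use int1 int2 int3 in auto)
  also have "\<dots> = (LINT t|circ. u t powr p * poisson z t) + (p - 1) * b powr p * (2 * pi)"
    using int1 int2 int3 by (simp add: poisson_integral[OF z])
  also have "p * b powr (p - 1) * (2 * pi * b) = p * (2 * pi) * b powr p"
  proof -
    have "b powr (p - 1) * b = b powr p"
      using powr_mult_base[OF \<open>0 \<le> b\<close>, of "p - 1"] by (simp add: mult.commute)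
    then show ?thesis by (simp add: algebra_simps)
  qed
  finally have "2 * pi * b powr p \<le> (LINT t|circ. u t powr p * poisson z t)"
    by (simp add: algebra_simps)
  then show ?thesis unfolding b_def[symmetric] by (simp add: pos_le_divide_eq mult.commute)
qed

lemma continuous_szego_circle:
  assumes "integrable circ g" "0 \<le> r" "r < 1"
  shows "continuous_on UNIV (\<lambda>x. szego g (of_real r * cis x))"
  by (rule continuous_on_compose2[where g = "szego g",
        OF holomorphic_on_imp_continuous_on[OF szego_holomorphic[OF assms(1)]]])
    (use assms in \<open>auto simp: norm_mult intro!: continuous_intros\<close>)

lemma integrable_szego_powr:
  assumes "integrable circ g" "0 \<le> r" "r < 1" "0 < p"
  shows "integrable circ (\<lambda>x. norm (szego g (of_real r * cis x)) powr p)"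
  using continuous_szego_circle[OF assms(1-3)] assms(4)
  by (intro integrable_circ_continuous continuous_on_powr' continuous_on_norm continuous_on_const) auto

text \<open>Jensen's inequality holds pointwise in x; Tonelli and the symmetry of the kernel, whose
  integral over x is 2 pi, then give constant 1. Nonnegative integrals make the exchange of order
  free of integrability conditions.\<close>

lemma integral_Re_schwarz_powr_le:
  assumes p: "1 < p" and u: "integrable circ u" "\<And>t. 0 \<le> u t" "integrable circ (\<lambda>t. u t powr p)"
    and r: "0 \<le> r" "r < 1"
  shows "(LINT x|circ. Re (2 * szego (\<lambda>t. of_real (u t)) (of_real r * cis x)
      - fcoef (\<lambda>t. of_real (u t)) 0) powr p) \<le> (LINT t|circ. u t powr p)"
proof -
  let ?z = "\<lambda>x. complex_of_real r * cis x"
  let ?F = "\<lambda>x. Re (2 * szego (\<lambda>t. of_real (u t)) (?z x) - fcoef (\<lambda>t. of_real (u t)) 0)"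
  have nz: "norm (?z x) < 1" for x using r by (simp add: norm_mult)
  note [measurable] = borel_measurable_integrable[OF u(3)]
  have le: "ennreal (2 * pi * ?F x powr p) \<le> (\<integral>\<^sup>+t. ennreal (u t powr p * poisson (?z x) t) \<partial>circ)" for x
  proof -
    have "?F x powr p \<le> (LINT t|circ. u t powr p * poisson (?z x) t) / (2 * pi)"
      unfolding Re_schwarz_eq[OF u(1) nz] by (rule poisson_jensen[OF p u nz])
    then have "2 * pi * ?F x powr p \<le> (LINT t|circ. u t powr p * poisson (?z x) t)"
      by (simp add: pos_le_divide_eq mult.commute)
    also have "ennreal \<dots> = (\<integral>\<^sup>+t. ennreal (u t powr p * poisson (?z x) t) \<partial>circ)"
      using poisson_pos[OF nz] 
      by (intro nn_integral_eq_integral[symmetric] poisson_integral_eq u nz)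
        (auto intro!: AE_I2 mult_nonneg_nonneg intro: less_imp_le)
    finally show ?thesis by (simp add: ennreal_leI)
  qed
  have cont: "continuous_on UNIV (\<lambda>x. ?F x powr p)"
  proof -
    have "continuous_on UNIV ?F"
      by (intro continuous_intros continuous_szego_circle r) (use u in auto)
    moreover have "0 \<le> ?F x" for x
      unfolding Re_schwarz_eq[OF u(1) nz] using poisson_pos[OF nz]
      by (intro divide_nonneg_pos integral_nonneg_AE AE_I2 mult_nonneg_nonneg u) (auto intro: less_imp_le)
    ultimately show ?thesis
      using p by (intro continuous_on_powr') (auto intro!: continuous_intros)
  qed
  have "ennreal (LINT x|circ. 2 * pi * ?F x powr p) = (\<integral>\<^sup>+x. ennreal (2 * pi * ?F x powr p) \<partial>circ)"
    by (intro nn_integral_eq_integral[symmetric] integrable_mult_right integrable_circ_continuous cont) auto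
  also have "\<dots> \<le> (\<integral>\<^sup>+x. (\<integral>\<^sup>+t. ennreal (u t powr p * poisson (?z x) t) \<partial>circ) \<partial>circ)"
    by (intro nn_integral_mono le)
  also have "\<dots> = (\<integral>\<^sup>+t. (\<integral>\<^sup>+x. ennreal (u t powr p * poisson (?z x) t) \<partial>circ) \<partial>circ)"
    by (rule circ_pair.Fubini'[symmetric]) measurable
  also have "\<dots> = (\<integral>\<^sup>+t. ennreal (2 * pi * u t powr p) \<partial>circ)"
  proof (rule nn_integral_cong)
    fix t
    have "(\<integral>\<^sup>+x. ennreal (u t powr p * poisson (?z x) t) \<partial>circ)
      = (\<integral>\<^sup>+x. ennreal (u t powr p * poisson (?z t) x) \<partial>circ)"
      by (simp add: poisson_sym)
    also have "\<dots> = ennreal (LINT x|circ. u t powr p * poisson (?z t) x)"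
      using poisson_pos[OF nz] poisson_integral_eq(1)[of "\<lambda>_. 1", OF _ nz]
      by (intro nn_integral_eq_integral integrable_mult_right)
        (auto intro!: AE_I2 mult_nonneg_nonneg intro: less_imp_le)
    also have "(LINT x|circ. u t powr p * poisson (?z t) x) = 2 * pi * u t powr p"
      by (simp add: poisson_integral[OF nz])
    finally show "(\<integral>\<^sup>+x. ennreal (u t powr p * poisson (?z x) t) \<partial>circ) = ennreal (2 * pi * u t powr p)" .
  qed
  also have "\<dots> = ennreal (LINT t|circ. 2 * pi * u t powr p)"
    by (intro nn_integral_eq_integral integrable_mult_right u) auto
  finally have "(LINT x|circ. 2 * pi * ?F x powr p) \<le> (LINT t|circ. 2 * pi * u t powr p)"
    by (subst (asm) ennreal_le_iff) (auto intro!: integral_nonneg_AE)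
  then show ?thesis by simp
qed

lemma szego_bound_nonneg:
  fixes p :: real
  assumes p: "1 < p" "p \<le> 2"
  shows "\<exists>C\<ge>0. \<forall>u r. integrable circ u \<longrightarrow> (\<forall>t. 0 \<le> u t) \<longrightarrow> integrable circ (\<lambda>t. u t powr p) \<longrightarrow>
    0 < r \<longrightarrow> r < 1 \<longrightarrow>
    (LINT x|circ. norm (szego (\<lambda>t. of_real (u t)) (of_real r * cis x)) powr p)
      \<le> C * (LINT t|circ. u t powr p)"
proof -
  obtain A B where A: "0 \<le> A" and B: "0 \<le> B" and
    AB: "\<And>w. 0 < Re w \<Longrightarrow> norm w powr p \<le> A * Re w powr p - B * Re (w powr of_real p)"
    using right_half_plane_powr_ineq[OF p] by metis
  show ?thesis
  proof (intro exI[of _ "2 powr p * (A + 1)"] conjI allI impI)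
    fix u :: "real \<Rightarrow> real" and r :: real
    assume u: "integrable circ u" "\<forall>t. 0 \<le> u t" "integrable circ (\<lambda>t. u t powr p)"
      and r: "0 < r" "r < 1"
    let ?g = "\<lambda>t. complex_of_real (u t)"
    let ?z = "\<lambda>x. complex_of_real r * cis x"
    let ?I = "LINT t|circ. u t powr p"
    have g: "integrable circ ?g" using u by simp
    have nz: "norm (?z x) < 1" for x using r by (simp add: norm_mult)
    have I: "0 \<le> ?I" by (intro integral_nonneg_AE) auto
    show "(LINT x|circ. norm (szego ?g (?z x)) powr p) \<le> 2 powr p * (A + 1) * ?I"
    \<comment> \<open>If u vanishes almost everywhere, F would be 0 and leave the open half plane;
      the Cauchy integral is then 0 as well.\<close>
    proof (cases "(LINT t|circ. u t) = 0")
      case True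
      then have "AE t in circ. u t = 0"
        using integral_nonneg_eq_0_iff_AE[OF u(1)] u(2) by simp
      then have "szego ?g z = 0" for z
        unfolding szego_def
        by (subst integral_eq_zero_AE) (auto elim: eventually_mono)
      then show ?thesis using I A by simp
    next
      case False
      moreover have "0 \<le> (LINT t|circ. u t)"
        using u(2) by (intro integral_nonneg_AE) auto
      ultimately have pos: "0 < (LINT t|circ. u t)" by simp
      define F where "F = (\<lambda>z. 2 * szego ?g z - fcoef ?g 0)"
      have Fpos: "0 < Re (F z)" if "norm z < 1" for z
        unfolding F_def using Re_schwarz_pos[OF u(1) _ pos that] u(2) by blast
      have F0: "F 0 = fcoef ?g 0" by (simp add: F_def szego_0)
      have holF: "F holomorphic_on ball 0 1"
        unfolding F_def by (intro holomorphic_intros szego_holomorphic g)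
      have holFp: "(\<lambda>z. F z powr of_real p) holomorphic_on ball 0 1"
        using Fpos by (intro holomorphic_intros holF) (auto simp: complex_nonpos_Reals_iff, force)
      have contF: "continuous_on UNIV (\<lambda>x. F (?z x))"
        unfolding F_def by (intro continuous_intros continuous_szego_circle g) (use r in auto)
      have contFp: "continuous_on UNIV (\<lambda>x. F (?z x) powr of_real p)"
        by (rule continuous_on_compose2[where g = "\<lambda>z. F z powr of_real p",
              OF holomorphic_on_imp_continuous_on[OF holFp]])
          (use nz in \<open>auto intro!: continuous_intros\<close>)
      have int1: "integrable circ (\<lambda>x. norm (F (?z x)) powr p)"
        using p by (intro integrable_circ_continuous continuous_on_powr' continuous_intros contF) auto
      have int2: "integrable circ (\<lambda>x. Re (F (?z x)) powr p)"
        using p Fpos[OF nz]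
        by (intro integrable_circ_continuous continuous_on_powr' continuous_intros contF)
          (auto intro: less_imp_le)
      have int3: "integrable circ (\<lambda>x. F (?z x) powr of_real p)"
        by (intro integrable_circ_continuous contFp)
      have F0real: "F 0 = of_real (Re (F 0))"
        unfolding F0 by (simp add: fcoef_def)
      have "(LINT x|circ. F (?z x) powr of_real p) = of_real (2 * pi) * (F 0 powr of_real p)"
        by (rule circle_mean_value[OF holFp r])
      also have "F 0 powr of_real p = of_real (Re (F 0) powr p)"
        using Fpos[of 0] by (subst F0real) (simp add: powr_of_real)
      finally have "Re (LINT x|circ. F (?z x) powr of_real p) = 2 * pi * Re (F 0) powr p"
        by simp
      then have mean: "0 \<le> (LINT x|circ. Re (F (?z x) powr of_real p))"
        by (subst integral_Re[OF int3]) simp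
      have "(LINT x|circ. norm (F (?z x)) powr p)
        \<le> (LINT x|circ. A * Re (F (?z x)) powr p - B * Re (F (?z x) powr of_real p))"
        using int1 int2 int3 nz by (intro integral_mono AB Fpos) auto
      also have "\<dots> = A * (LINT x|circ. Re (F (?z x)) powr p) - B * (LINT x|circ. Re (F (?z x) powr of_real p))"
        using int2 int3 by simp
      also have "\<dots> \<le> A * (LINT x|circ. Re (F (?z x)) powr p)"
        using B mean by simp
      also have "\<dots> \<le> A * ?I"
        unfolding F_def using integral_Re_schwarz_powr_le[OF p(1) u(1) _ u(3), of r] u(2) r A
        by (intro mult_left_mono) auto
      finally have 1: "(LINT x|circ. norm (F (?z x)) powr p) \<le> A * ?I" .
      \<comment> \<open>Jensen at z = 0, where the kernel is 1, bounds the mean of u.\<close>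
      have "Re (F 0) powr p \<le> ?I / (2 * pi)"
        using poisson_jensen[OF p(1) u(1) _ u(3), of 0] u(2) Re_schwarz_eq[OF u(1), of 0]
        by (simp add: F_def poisson_def)
      then have 2: "norm (fcoef ?g 0) powr p * (2 * pi) \<le> ?I"
        unfolding F0[symmetric] using Fpos[of 0]
        by (subst F0real) (simp add: pos_le_divide_eq)
      \<comment> \<open>\<open>szego\<close> is half the sum of F and the mean; the factor 1/2 is
        thrown away.\<close>
      have "norm (szego ?g z) powr p \<le> 2 powr p * (norm (F z) powr p + norm (fcoef ?g 0) powr p)" for z
      proof -
        have "norm (szego ?g z) powr p \<le> norm (F z + fcoef ?g 0) powr p"
          using p by (intro powr_mono2) (auto simp: F_def norm_mult)
        also have "\<dots> \<le> 2 powr p * (norm (F z) powr p + norm (fcoef ?g 0) powr p)"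
          using p by (intro norm_add_powr_le) auto
        finally show ?thesis .
      qed
      then have "(LINT x|circ. norm (szego ?g (?z x)) powr p)
        \<le> (LINT x|circ. 2 powr p * (norm (F (?z x)) powr p + norm (fcoef ?g 0) powr p))"
        using int1 r p integrable_szego_powr[OF g, of r p] by (intro integral_mono) auto
      also have "\<dots> = 2 powr p * ((LINT x|circ. norm (F (?z x)) powr p) + norm (fcoef ?g 0) powr p * (2 * pi))"
        using int1 by simp
      also have "\<dots> \<le> 2 powr p * (A * ?I + ?I)"
        using 1 2 by (intro mult_left_mono add_mono) auto
      finally show ?thesis by (simp add: algebra_simps)
    qed
  qed (use A in auto)
qed

section \<open>M. Riesz's theorem\<close>

lemma szego_diff_add:
  assumes "integrable circ a" "integrable circ b" "integrable circ c" "integrable circ d" "norm z < 1"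
  shows "szego (\<lambda>t. (a t - b t) + \<i> * (c t - d t)) z
    = (szego a z - szego b z) + (\<i> * szego c z - \<i> * szego d z)"
proof -
  have "(\<lambda>t. ((a t - b t) + \<i> * (c t - d t)) / (1 - z * cis (- t)))
    = (\<lambda>t. (a t / (1 - z * cis (- t)) - b t / (1 - z * cis (- t)))
      + (\<i> * (c t / (1 - z * cis (- t))) - \<i> * (d t / (1 - z * cis (- t)))))"
    by (simp add: fun_eq_iff add_divide_distrib diff_divide_distrib right_diff_distrib)
  then have "(LINT t|circ. ((a t - b t) + \<i> * (c t - d t)) / (1 - z * cis (- t)))
    = (LINT t|circ. a t / (1 - z * cis (- t))) - (LINT t|circ. b t / (1 - z * cis (- t)))
      + (\<i> * (LINT t|circ. c t / (1 - z * cis (- t))) - \<i> * (LINT t|circ. d t / (1 - z * cis (- t))))"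
    using szego_integrable[OF assms(1,5)] szego_integrable[OF assms(2,5)]
      szego_integrable[OF assms(3,5)] szego_integrable[OF assms(4,5)]
    by (simp del: times_divide_eq_right)
  then show ?thesis
    unfolding szego_def by (simp add: add_divide_distrib diff_divide_distrib)
qed

lemma norm_add4_powr_le:
  fixes a b c d :: "'a::real_normed_vector"
  assumes "0 \<le> p"
  shows "norm (a + b + (c + d)) powr p
    \<le> 4 powr p * (norm a powr p + norm b powr p + norm c powr p + norm d powr p)"
proof -
  have "norm (a + b + (c + d)) powr p \<le> 2 powr p * (norm (a + b) powr p + norm (c + d) powr p)"
    by (rule norm_add_powr_le[OF assms])
  also have "\<dots> \<le> 2 powr p * (2 powr p * (norm a powr p + norm b powr p)
      + 2 powr p * (norm c powr p + norm d powr p))"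
    by (intro mult_left_mono add_mono norm_add_powr_le assms) auto
  also have "\<dots> = (2 powr p * 2 powr p) * (norm a powr p + norm b powr p + norm c powr p + norm d powr p)"
    by (simp add: algebra_simps)
  also have "2 powr p * 2 powr p = (4::real) powr p"
    by (simp flip: powr_mult)
  finally show ?thesis .
qed

lemma szego_bound:
  fixes p :: real
  assumes p: "1 < p" "p \<le> 2"
  shows "\<exists>C\<ge>0. \<forall>g\<in>Lpc p. \<forall>r. 0 < r \<longrightarrow> r < 1 \<longrightarrow>
    (LINT x|circ. norm (szego g (of_real r * cis x)) powr p) \<le> C * (LINT t|circ. norm (g t) powr p)"
proof -
  obtain C where C: "0 \<le> C" and bound: "\<And>u r. integrable circ u \<Longrightarrow> (\<And>t. 0 \<le> u t) \<Longrightarrow>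
    integrable circ (\<lambda>t. u t powr p) \<Longrightarrow> 0 < r \<Longrightarrow> r < 1 \<Longrightarrow>
    (LINT x|circ. norm (szego (\<lambda>t. of_real (u t)) (of_real r * cis x)) powr p)
      \<le> C * (LINT t|circ. u t powr p)"
    using szego_bound_nonneg[OF p] by metis
  show ?thesis
  proof (intro exI[of _ "4 powr p * (4 * C)"] conjI ballI allI impI)
    fix g :: "real \<Rightarrow> complex" and r :: real
    assume g: "g \<in> Lpc p" and r: "0 < r" "r < 1"
    let ?z = "\<lambda>x. complex_of_real r * cis x"
    let ?I = "LINT t|circ. norm (g t) powr p"
    have nz: "norm (?z x) < 1" for x using r by (simp add: norm_mult)
    note [measurable] = Lpc_measurable[OF g]
    have *: "integrable circ u \<and> integrable circ (\<lambda>t. u t powr p) \<and> (LINT t|circ. u t powr p) \<le> ?I"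
      if [measurable]: "u \<in> borel_measurable circ" and u: "\<And>t. 0 \<le> u t" "\<And>t. u t \<le> norm (g t)"
      for u :: "real \<Rightarrow> real"
    proof -
      have "(\<lambda>t. complex_of_real (u t)) \<in> Lpc p"
        by (rule Lpc_bound[OF g, where C = 1]) (use p u in auto)
      then have 1: "integrable circ (\<lambda>t. complex_of_real (u t))" and 2: "integrable circ (\<lambda>t. u t powr p)"
        using Lpc_integrable[of "\<lambda>t. complex_of_real (u t)" p] p u
        by (auto dest!: Lpc_integrable_powr)
      have "(LINT t|circ. u t powr p) \<le> ?I"
        by (intro integral_mono 2 Lpc_integrable_powr g powr_mono2 u) (use p in auto)
      then show ?thesis using 1 2 by (simp add: complex_of_real_integrable_eq)
    qed
    \<comment> \<open>Positive and negative parts of Re g and Im g, each bounded by norm g; indexing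
      them by a list position lets one argument treat all four.\<close>
    define u where "u = (\<lambda>j t. max 0 ([Re (g t), - Re (g t), Im (g t), - Im (g t)] ! j))"
    have u: "integrable circ (u j)" "\<And>t. 0 \<le> u j t" "integrable circ (\<lambda>t. u j t powr p)"
      "(LINT t|circ. u j t powr p) \<le> ?I" if "j \<in> {0, 1, 2, 3}" for j
    proof -
      have "u j \<in> borel_measurable circ" "0 \<le> u j t" "u j t \<le> norm (g t)" for t
        using that abs_Re_le_cmod[of "g t"] abs_Im_le_cmod[of "g t"]
        by (auto simp: u_def numeral_eq_Suc)
      from *[OF this] show "integrable circ (u j)" "\<And>t. 0 \<le> u j t" "integrable circ (\<lambda>t. u j t powr p)"
        "(LINT t|circ. u j t powr p) \<le> ?I" by (auto simp: u_def)
    qed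
    define S where "S = (\<lambda>j x. szego (\<lambda>t. of_real (u j t)) (?z x))"
    have S_int: "integrable circ (\<lambda>x. norm (S j x) powr p)" if "j \<in> {0, 1, 2, 3}" for j
      unfolding S_def using u(1)[OF that] r p by (intro integrable_szego_powr) auto
    have S_le: "(LINT x|circ. norm (S j x) powr p) \<le> C * ?I" if "j \<in> {0, 1, 2, 3}" for j
    proof -
      have "(LINT x|circ. norm (S j x) powr p) \<le> C * (LINT t|circ. u j t powr p)"
        unfolding S_def by (rule bound) (use u[OF that] r in auto)
      also have "\<dots> \<le> C * ?I" using u(4)[OF that] C by (rule mult_left_mono)
      finally show ?thesis .
    qed
    have g_eq: "g = (\<lambda>t. (of_real (u 0 t) - of_real (u 1 t)) + \<i> * (of_real (u 2 t) - of_real (u 3 t)))"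
      by (auto simp: fun_eq_iff complex_eq_iff u_def numeral_eq_Suc max_def)
    have eq: "szego g (?z x) = S 0 x + (- S 1 x) + (\<i> * S 2 x + (- (\<i> * S 3 x)))" for x
      unfolding S_def
      by (subst g_eq, subst szego_diff_add) (use u(1) nz in auto)
    have "norm (szego g (?z x)) powr p \<le> 4 powr p * (norm (S 0 x) powr p + norm (S 1 x) powr p
        + norm (S 2 x) powr p + norm (S 3 x) powr p)" for x
      unfolding eq using norm_add4_powr_le[of p "S 0 x" "- S 1 x" "\<i> * S 2 x" "- (\<i> * S 3 x)"] p
      by (simp add: norm_mult)
    then have "(LINT x|circ. norm (szego g (?z x)) powr p) \<le> (LINT x|circ. 4 powr p * (norm (S 0 x) powr p
        + norm (S 1 x) powr p + norm (S 2 x) powr p + norm (S 3 x) powr p))"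
      using S_int Lpc_integrable[OF g] p r integrable_szego_powr[of g r p]
      by (intro integral_mono) auto
    also have "\<dots> = 4 powr p * ((LINT x|circ. norm (S 0 x) powr p) + (LINT x|circ. norm (S 1 x) powr p)
        + (LINT x|circ. norm (S 2 x) powr p) + (LINT x|circ. norm (S 3 x) powr p))"
      using S_int by simp
    also have "\<dots> \<le> 4 powr p * (C * ?I + C * ?I + C * ?I + C * ?I)"
      by (intro mult_left_mono add_mono S_le) auto
    finally show "(LINT x|circ. norm (szego g (?z x)) powr p) \<le> 4 powr p * (4 * C) * ?I"
      by (simp add: algebra_simps)
  qed (use C in auto)
qed

section \<open>Partial sums over arbitrary windows of frequencies\<close>

lemma fcoef_modulate: "fcoef (\<lambda>t. g t * cis (- (of_int a * t))) k = fcoef g (a + k)"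
proof -
  have "g t * cis (- (of_int a * t)) * cis (- (of_int k * t)) = g t * cis (- (of_int (a + k) * t))" for t
    by (simp add: mult.assoc cis_mult distrib_right)
  then show ?thesis by (simp only: fcoef_def)
qed

lemma continuous_Lpc:
  fixes f :: "real \<Rightarrow> complex"
  assumes "continuous_on UNIV f" "0 < p"
  shows "f \<in> Lpc p"
proof -
  have "continuous_on UNIV (\<lambda>x. norm (f x) powr p)"
    by (rule continuous_on_powr') (use assms in \<open>auto intro: continuous_on_norm\<close>)
  then show ?thesis
    by (simp add: Lpc_def integrable_circ_continuous continuous_measurable_circ assms)
qed

text \<open>The start a is arbitrary because the summations by parts use windows that begin at m +
  1, at -m, or far to the left.\<close>

definition fpart :: "(real \<Rightarrow> complex) \<Rightarrow> int \<Rightarrow> nat \<Rightarrow> real \<Rightarrow> complex" where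
  "fpart g a n x = (\<Sum>k<n. fcoef g (a + int k) * cis (of_int (a + int k) * x))"

text \<open>A window is the series from frequency a on minus the series from a + n on. Up to
  modulation each is a Cauchy integral of a modulation of g, which has the same norm as g; hence a
  constant independent of a and n.\<close>

lemma fpart_bound:
  fixes p :: real
  assumes p: "1 < p" "p \<le> 2"
  shows "\<exists>C\<ge>0. \<forall>g\<in>Lpc p. \<forall>a n.
    (LINT x|circ. norm (fpart g a n x) powr p) \<le> C * (LINT t|circ. norm (g t) powr p)"
proof -
  obtain C where C: "0 \<le> C" and bound: "\<And>g r. g \<in> Lpc p \<Longrightarrow> 0 < r \<Longrightarrow> r < 1 \<Longrightarrow>
    (LINT x|circ. norm (szego g (of_real r * cis x)) powr p) \<le> C * (LINT t|circ. norm (g t) powr p)"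
    using szego_bound[OF p] by metis
  show ?thesis
  proof (intro exI[of _ "2 powr p * (2 * C)"] conjI ballI allI)
    fix g :: "real \<Rightarrow> complex" and a :: int and n :: nat
    assume g: "g \<in> Lpc p"
    let ?I = "LINT t|circ. norm (g t) powr p"
    note [measurable] = Lpc_measurable[OF g]
    define h where "h = (\<lambda>b t. g t * cis (- (of_int b * t)))"
    have h: "h b \<in> Lpc p" for b
      by (rule Lpc_bound[OF g, where C = 1]) (use p in \<open>auto simp: norm_mult h_def\<close>)
    have hI: "(LINT t|circ. norm (h b t) powr p) = ?I" for b by (simp add: h_def norm_mult)
    have h_int: "integrable circ (h b)" for b using Lpc_integrable[OF h] p by simp
    \<comment> \<open>The window damped by powers of r, with the factor cis (a x) split off; inside
      the disc it is a difference of two Cauchy integrals.\<close>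
    define T where "T = (\<lambda>r x. \<Sum>k<n. fcoef g (a + int k) * (complex_of_real r * cis x) ^ k)"
    have T_eq: "T r x = szego (h a) (complex_of_real r * cis x)
        - (complex_of_real r * cis x) ^ n * szego (h (a + int n)) (complex_of_real r * cis x)"
      if "0 < r" "r < 1" for r x
    proof -
      let ?z = "complex_of_real r * cis x"
      have nz: "norm ?z < 1" using that by (simp add: norm_mult)
      have 1: "(\<lambda>k. fcoef g (a + int k) * ?z ^ k) sums szego (h a) ?z"
        using szego_sums[OF h_int nz, of a] by (simp add: h_def fcoef_modulate)
      have "(\<lambda>k. fcoef g (a + int n + int k) * ?z ^ k) sums szego (h (a + int n)) ?z"
        using szego_sums[OF h_int nz, of "a + int n"] by (simp only: h_def fcoef_modulate)
      then have "(\<lambda>k. ?z ^ n * (fcoef g (a + int n + int k) * ?z ^ k)) sums (?z ^ n * szego (h (a + int n)) ?z)"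
        by (rule sums_mult)
      also have "(\<lambda>k. ?z ^ n * (fcoef g (a + int n + int k) * ?z ^ k))
          = (\<lambda>k. fcoef g (a + int (k + n)) * ?z ^ (k + n))"
        by (simp add: fun_eq_iff power_add add_ac mult_ac)
      finally have "(\<lambda>k. fcoef g (a + int k) * ?z ^ k) sums (?z ^ n * szego (h (a + int n)) ?z + T r x)"
        unfolding T_def using sums_iff_shift[of "\<lambda>k. fcoef g (a + int k) * ?z ^ k" n] by simp
      from sums_unique2[OF 1 this] show ?thesis by simp
    qed
    have cont: "continuous_on UNIV (\<lambda>x. norm (T r x) powr p)" for r
      unfolding T_def using p by (intro continuous_on_powr' continuous_intros) auto
    have T_le: "(LINT x|circ. norm (T r x) powr p) \<le> 2 powr p * (2 * C) * ?I" if r: "0 < r" "r < 1" for r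
    proof -
      let ?z = "\<lambda>x. complex_of_real r * cis x"
      have S_int: "integrable circ (\<lambda>x. norm (szego (h b) (?z x)) powr p)" for b
        using h_int r p by (intro integrable_szego_powr) auto
      have "norm (T r x) powr p \<le> 2 powr p * (norm (szego (h a) (?z x)) powr p
          + norm (szego (h (a + int n)) (?z x)) powr p)" for x
      proof -
        have "norm (T r x) powr p \<le> 2 powr p * (norm (szego (h a) (?z x)) powr p
          + norm (- (?z x ^ n * szego (h (a + int n)) (?z x))) powr p)"
          using norm_add_powr_le[of p "szego (h a) (?z x)" "- (?z x ^ n * szego (h (a + int n)) (?z x))"] p
          by (simp add: T_eq[OF r])
        also have "\<dots> \<le> 2 powr p * (norm (szego (h a) (?z x)) powr p
          + norm (szego (h (a + int n)) (?z x)) powr p)"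
        proof -
          have "norm (?z x ^ n) \<le> 1" using r by (simp add: norm_mult norm_power power_le_one)
          then have "norm (- (?z x ^ n * szego (h (a + int n)) (?z x))) \<le> norm (szego (h (a + int n)) (?z x))"
            using mult_right_mono[OF _ norm_ge_zero, of "norm (?z x ^ n)" 1] by (simp add: norm_mult)
          then show ?thesis
            using p by (intro mult_left_mono add_mono powr_mono2) auto
        qed
        finally show ?thesis .
      qed
      then have "(LINT x|circ. norm (T r x) powr p) \<le> (LINT x|circ. 2 powr p * (norm (szego (h a) (?z x)) powr p
          + norm (szego (h (a + int n)) (?z x)) powr p))"
        using S_int by (intro integral_mono integrable_circ_continuous[OF cont]) auto
      also have "\<dots> = 2 powr p * ((LINT x|circ. norm (szego (h a) (?z x)) powr p)
          + (LINT x|circ. norm (szego (h (a + int n)) (?z x)) powr p))"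
        using S_int by simp
      also have "\<dots> \<le> 2 powr p * (C * ?I + C * ?I)"
        using bound[OF h r] unfolding hI by (intro mult_left_mono add_mono) auto
      finally show ?thesis by (simp add: algebra_simps)
    qed
    \<comment> \<open>Radii strictly between 0 and 1 that tend to 1. \<open>T\<close> is a finite
      sum, so its coefficients give a constant majorant for the limit.\<close>
    define \<rho> where "\<rho> = (\<lambda>j::nat. 1 - inverse (real (Suc (Suc j))))"
    have \<rho>: "0 < \<rho> j" "\<rho> j < 1" for j by (auto simp: \<rho>_def field_simps)
    have \<rho>_lim: "\<rho> \<longlonglongrightarrow> 1"
      unfolding \<rho>_def using tendsto_diff[OF tendsto_const[of 1] LIMSEQ_Suc[OF LIMSEQ_inverse_real_of_nat]]
      by simp
    have "(\<lambda>j. LINT x|circ. norm (T (\<rho> j) x) powr p) \<longlonglongrightarrow> (LINT x|circ. norm (T 1 x) powr p)"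
    proof (rule integral_dominated_convergence)
      let ?K = "\<Sum>k<n. norm (fcoef g (a + int k))"
      show "integrable circ (\<lambda>x. ?K powr p)" by simp
      show "(\<lambda>x. norm (T 1 x) powr p) \<in> borel_measurable circ"
        "(\<lambda>x. norm (T (\<rho> j) x) powr p) \<in> borel_measurable circ" for j
        by (rule continuous_measurable_circ[OF cont])+
      show "AE x in circ. (\<lambda>j. norm (T (\<rho> j) x) powr p) \<longlonglongrightarrow> norm (T 1 x) powr p"
        unfolding T_def using p
        by (intro AE_I2 tendsto_powr' tendsto_norm tendsto_sum tendsto_mult tendsto_power
              tendsto_const tendsto_of_real \<rho>_lim) auto
      have "norm (T (\<rho> j) x) \<le> ?K" for j x
        unfolding T_def
      proof (rule sum_norm_le)
        fix k
        have "norm ((complex_of_real (\<rho> j) * cis x) ^ k) \<le> 1"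
          using \<rho>[of j] by (simp add: norm_mult norm_power power_le_one)
        then show "norm (fcoef g (a + int k) * (complex_of_real (\<rho> j) * cis x) ^ k) \<le> norm (fcoef g (a + int k))"
          by (simp only: norm_mult[of "fcoef g (a + int k)"] mult_left_le norm_ge_zero)
      qed
      then show "AE x in circ. norm (norm (T (\<rho> j) x) powr p) \<le> ?K powr p" for j
        using p by (intro AE_I2) (simp add: powr_mono2)
    qed
    then have "(LINT x|circ. norm (T 1 x) powr p) \<le> 2 powr p * (2 * C) * ?I"
      by (rule LIMSEQ_le_const2) (use T_le[OF \<rho>] in blast)
    moreover have "norm (T 1 x) = norm (fpart g a n x)" for x
    proof -
      have "fpart g a n x = cis (of_int a * x) * T 1 x"
        by (simp add: fpart_def T_def sum_distrib_left Complex.DeMoivre distrib_right flip: cis_mult)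
          (simp add: mult_ac)
      then show ?thesis by (simp add: norm_mult)
    qed
    ultimately show "(LINT x|circ. norm (fpart g a n x) powr p) \<le> 2 powr p * (2 * C) * ?I" by simp
  qed (use C in auto)
qed

text \<open>Without complex conjugation the pairing couples frequency j of one function with -j of
  the other, a form symmetric in the two.\<close>

lemma fpart_mult_integral:
  assumes w: "integrable circ w"
  shows "(LINT x|circ. fpart g a n x * w x) = 2 * pi * (\<Sum>k<n. fcoef g (a + int k) * fcoef w (- (a + int k)))"
proof -
  have eq: "fpart g a n x * w x
      = (\<Sum>k<n. fcoef g (a + int k) * (w x * cis (of_int (a + int k) * x)))" for x
    unfolding fpart_def sum_distrib_right by (intro sum.cong) (simp_all add: mult_ac)
  have "(LINT x|circ. fpart g a n x * w x)
      = (\<Sum>k<n. fcoef g (a + int k) * (LINT x|circ. w x * cis (of_int (a + int k) * x)))"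
    unfolding eq using integrable_circ_mult_cis[OF w]
    by (subst Bochner_Integration.integral_sum) auto
  also have "\<dots> = 2 * pi * (\<Sum>k<n. fcoef g (a + int k) * fcoef w (- (a + int k)))"
  proof -
    have "(LINT x|circ. w x * cis (of_int j * x)) = 2 * pi * fcoef w (- j)" for j
      by (simp add: fcoef_def)
    then show ?thesis by (simp only: sum_distrib_left mult.left_commute)
  qed
  finally show ?thesis .
qed

text \<open>M. Riesz's theorem, phrased as a bilinear estimate so that the roles of \<open>p\<close> and \<open>q\<close> are
  interchangeable and only \<open>p \<le> 2\<close> has to be treated.\<close>

lemma riesz_bilinear:
  fixes p q :: real
  assumes pq: "1 < p" "1 / p + 1 / q = 1"
  shows "\<exists>C\<ge>0. \<forall>g\<in>Lpc p. \<forall>w\<in>Lpc q. \<forall>a n.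
    norm (\<Sum>k<n. fcoef g (a + int k) * fcoef w (- (a + int k))) \<le> C * (pnorm p g * pnorm q w)"
proof -
  have le2: "\<exists>C\<ge>0. \<forall>g\<in>Lpc p. \<forall>w\<in>Lpc q. \<forall>a n.
    norm (\<Sum>k<n. fcoef g (a + int k) * fcoef w (- (a + int k))) \<le> C * (pnorm p g * pnorm q w)"
    if p: "1 < p" "p \<le> 2" "1 / p + 1 / q = 1" for p q :: real
  proof -
    have q: "1 < q" using conjugate_gt1[OF p(1,3)] .
    obtain C where C: "0 \<le> C" and bound: "\<And>g a n. g \<in> Lpc p \<Longrightarrow>
      (LINT x|circ. norm (fpart g a n x) powr p) \<le> C * (LINT t|circ. norm (g t) powr p)"
      using fpart_bound[OF p(1,2)] by metis
    show ?thesis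
    proof (intro exI[of _ "C powr (1 / p)"] conjI ballI allI)
      fix g w :: "real \<Rightarrow> complex" and a :: int and n :: nat
      assume g: "g \<in> Lpc p" and w: "w \<in> Lpc q"
      let ?S = "\<Sum>k<n. fcoef g (a + int k) * fcoef w (- (a + int k))"
      have cont: "continuous_on UNIV (fpart g a n)"
        unfolding fpart_def by (intro continuous_intros)
      have f: "fpart g a n \<in> Lpc p"
        by (intro continuous_Lpc cont) (use p in auto)
      \<comment> \<open>Since 2 pi is at least 1, the factor that turns the sum into an integral can
        simply be inserted.\<close>
      have "norm ?S \<le> norm (2 * pi * ?S)"
        using pi_gt3 by (simp add: norm_mult mult_right_mono[of 1 "2 * pi" "norm ?S", simplified])
      also have "2 * pi * ?S = (LINT x|circ. fpart g a n x * w x)"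
        using fpart_mult_integral[OF Lpc_integrable[OF w]] q by simp
      also have "norm \<dots> \<le> pnorm p (fpart g a n) * pnorm q w"
        by (rule Lpc_Hoelder(2)[OF p(1,3) f w])
      also have "\<dots> \<le> (C powr (1 / p) * pnorm p g) * pnorm q w"
      proof (rule mult_right_mono)
        have "pnorm p (fpart g a n) \<le> (C * (LINT t|circ. norm (g t) powr p)) powr (1 / p)"
          unfolding pnorm_def using bound[OF g] p by (intro powr_mono2) (auto intro!: integral_nonneg_AE)
        also have "\<dots> = C powr (1 / p) * pnorm p g"
          using C by (simp add: pnorm_def powr_mult integral_nonneg_AE)
        finally show "pnorm p (fpart g a n) \<le> C powr (1 / p) * pnorm p g" .
      qed (simp add: pnorm_def)
      finally show "norm ?S \<le> C powr (1 / p) * (pnorm p g * pnorm q w)" by (simp add: mult.assoc)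
    qed simp
  qed
  show ?thesis
  proof (cases "p \<le> 2")
    case False
    have "1 / p < 1 / 2" using False by (intro divide_strict_left_mono) auto
    then have "1 / q > 1 / 2" using pq(2) by linarith
    have q: "1 < q" using conjugate_gt1[OF pq] .
    then have "q \<le> 2" using \<open>1 / q > 1 / 2\<close> by (simp add: field_simps)
    moreover have "1 / q + 1 / p = 1" using pq(2) by simp
    ultimately have "\<exists>C\<ge>0. \<forall>g\<in>Lpc q. \<forall>w\<in>Lpc p. \<forall>a n.
      norm (\<Sum>k<n. fcoef g (a + int k) * fcoef w (- (a + int k))) \<le> C * (pnorm q g * pnorm p w)"
      using le2 q by blast
    then obtain C where C: "0 \<le> C" and bound: "\<forall>g\<in>Lpc q. \<forall>w\<in>Lpc p. \<forall>a n.
      norm (\<Sum>k<n. fcoef g (a + int k) * fcoef w (- (a + int k))) \<le> C * (pnorm q g * pnorm p w)"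
      by blast
    have "norm (\<Sum>k<n. fcoef g (a + int k) * fcoef w (- (a + int k))) \<le> C * (pnorm p g * pnorm q w)"
      if "g \<in> Lpc p" "w \<in> Lpc q" for g w a n
    proof -
      \<comment> \<open>Reversing the window makes the frequencies of w increase from -(a + n - 1),
        so that w can take the place of g.\<close>
      have "(\<Sum>k<n. fcoef g (a + int k) * fcoef w (- (a + int k)))
        = (\<Sum>k<n. fcoef g (a + int (n - Suc k)) * fcoef w (- (a + int (n - Suc k))))"
        by (rule sum.nat_diff_reindex[symmetric])
      also have "\<dots> = (\<Sum>k<n. fcoef w (- (a + int n - 1) + int k) * fcoef g (- (- (a + int n - 1) + int k)))"
      proof (rule sum.cong)
        fix k assume "k \<in> {..<n}"
        then have "int (n - Suc k) = int n - 1 - int k" by auto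
        then show "fcoef g (a + int (n - Suc k)) * fcoef w (- (a + int (n - Suc k)))
          = fcoef w (- (a + int n - 1) + int k) * fcoef g (- (- (a + int n - 1) + int k))"
          by (simp add: algebra_simps)
      qed simp
      also have "norm \<dots> \<le> C * (pnorm q w * pnorm p g)" 
        using bound that by blast
      finally show ?thesis by (simp add: mult.commute)
    qed
    then show ?thesis using C by blast
  qed (use le2 pq in blast)
qed

section \<open>Trigonometric polynomials as test functions\<close>

text \<open>Closure rules replace explicit coefficient lists, so that products, continuity and
  pairings are handled by induction.\<close>

inductive_set trig_polys :: "(real \<Rightarrow> complex) set" where
  cis: "(\<lambda>x. cis (of_int k * x)) \<in> trig_polys"
| add: "f \<in> trig_polys \<Longrightarrow> g \<in> trig_polys \<Longrightarrow> (\<lambda>x. f x + g x) \<in> trig_polys"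
| cmult: "f \<in> trig_polys \<Longrightarrow> (\<lambda>x. c * f x) \<in> trig_polys"

lemma trig_polys_const: "(\<lambda>x. c) \<in> trig_polys"
  using trig_polys.cmult[OF trig_polys.cis[of 0], of c] by simp

lemma trig_polys_mult:
  assumes "f \<in> trig_polys" "g \<in> trig_polys"
  shows "(\<lambda>x. f x * g x) \<in> trig_polys"
  using assms(1)
proof induction
  case (cis k)
  from assms(2) show ?case
  proof induction
    case (cis j)
    show ?case
      using trig_polys.cis[of "k + j"] by (simp add: cis_mult distrib_right)
  next
    case (add f g)
    then show ?case using trig_polys.add by (simp add: distrib_left)
  next
    case (cmult f c)
    then show ?case using trig_polys.cmult[of _ c] by (simp add: mult.left_commute)
  qed
next
  case (add f1 f2)
  then show ?case using trig_polys.add by (simp add: distrib_right)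
next
  case (cmult f c)
  then show ?case using trig_polys.cmult[of _ c] by (simp add: mult.assoc)
qed

lemma continuous_on_trig_polys: "w \<in> trig_polys \<Longrightarrow> continuous_on UNIV w"
  by (induction rule: trig_polys.induct) (auto intro!: continuous_intros)

text \<open>On the circle a real linear functional is a combination of cos and sin; sums and
  products then stay within trigonometric polynomials.\<close>

lemma real_polynomial_function_cis:
  fixes h :: "complex \<Rightarrow> real"
  assumes "real_polynomial_function h"
  shows "(\<lambda>x. complex_of_real (h (cis x))) \<in> trig_polys"
  using assms
proof induction
  case (linear f)
  then interpret bounded_linear f .
  have "f (cis x) = cos x * f 1 + sin x * f \<i>" for x
  proof -
    have "cis x = cos x *\<^sub>R 1 + sin x *\<^sub>R \<i>" by (simp add: complex_eq_iff)
    then show ?thesis by (simp only: add scaleR real_scaleR_def)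
  qed
  moreover have "complex_of_real (cos x) = 1/2 * cis (of_int 1 * x) + 1/2 * cis (of_int (-1) * x)"
    "complex_of_real (sin x) = - \<i> / 2 * cis (of_int 1 * x) + \<i> / 2 * cis (of_int (-1) * x)" for x
    by (simp_all add: complex_eq_iff)
  ultimately have eq: "complex_of_real (f (cis x))
    = of_real (f 1) * (1/2 * cis (of_int 1 * x) + 1/2 * cis (of_int (-1) * x))
      + of_real (f \<i>) * (- \<i> / 2 * cis (of_int 1 * x) + \<i> / 2 * cis (of_int (-1) * x))" for x
    by (simp only: of_real_add of_real_mult mult.commute)
  show ?case unfolding eq by (intro trig_polys.intros)
next
  case (const c)
  show ?case by (rule trig_polys_const)
next
  case (add f g)
  then show ?case using trig_polys.add by simp
next
  case (mult f g)
  then show ?case using trig_polys_mult by simp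
qed

text \<open>The condition \<open>u 0 = u (2 * pi)\<close> lets u descend to the unit circle, where
  the Stone-Weierstrass theorem supplies polynomials in the plane.\<close>

lemma trig_polys_dense_continuous:
  fixes u :: "real \<Rightarrow> complex"
  assumes u: "continuous_on {0..2*pi} u" "u 0 = u (2 * pi)" and e: "0 < e"
  shows "\<exists>w\<in>trig_polys. \<forall>x\<in>{0..2*pi}. norm (u x - w x) < e"
proof -
  define U where "U = (\<lambda>z. u (Arg2pi z))"
  have Ucis: "U (cis x) = u x" if "x \<in> {0..2*pi}" for x
  proof (cases "x = 2 * pi")
    case True
    then have "cis x = 1" by (simp add: complex_eq_iff)
    moreover have "Arg2pi 1 = 0" by (simp add: Arg2pi_eq_0)
    ultimately show ?thesis using u(2) True by (simp add: U_def)
  next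
    case False
    then have "Arg2pi (cis x) = x"
      using that by (intro Arg2pi_unique[of 1]) (auto simp: cis_conv_exp)
    then show ?thesis by (simp add: U_def)
  qed
  have img: "cis ` {0..2*pi} = sphere 0 1"
  proof
    show "sphere 0 1 \<subseteq> cis ` {0..2*pi}"
    proof
      fix z :: complex assume "z \<in> sphere 0 1"
      then have "z = cis (Arg2pi z)"
        using Arg2pi_eq[of z] by (simp add: cis_conv_exp)
      then show "z \<in> cis ` {0..2*pi}"
        using Arg2pi_ge_0[of z] Arg2pi_lt_2pi[of z] by (metis atLeastAtMost_iff image_eqI less_imp_le)
    qed
  qed (auto simp: dist_norm)
  \<comment> \<open>A continuous surjection from a compact onto a Hausdorff space is a quotient map;
    thus continuity of \<open>U\<close>, even at 1 where \<open>Arg2pi\<close> jumps, can be checked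
    on the interval.\<close>
  have "quotient_map (top_of_set {0..2*pi}) (top_of_set (sphere 0 1)) cis"
  proof (rule T1_Spaces.continuous_imp_quotient_map)
    show "continuous_map (top_of_set {0..2*pi}) (top_of_set (sphere 0 1)) cis"
      using img by (auto intro!: continuous_intros)
  qed (auto simp: img compact_space_subtopology Hausdorff_space_subtopology)
  moreover have "continuous_map (top_of_set {0..2*pi}) euclidean (U \<circ> cis)"
    using u(1) by (simp, subst continuous_on_cong[OF refl, of _ _ u]) (auto simp: Ucis)
  ultimately have "continuous_map (top_of_set (sphere 0 1)) euclidean U"
    using continuous_compose_quotient_map_eq by blast
  then have contU: "continuous_on (sphere 0 1) U" by simp
  obtain g where g: "polynomial_function g" "\<And>z. z \<in> sphere 0 1 \<Longrightarrow> norm (U z - g z) < e"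
    using Stone_Weierstrass_polynomial_function[OF compact_sphere contU e] by blast
  have "real_polynomial_function (\<lambda>z. Re (g z))" "real_polynomial_function (\<lambda>z. Im (g z))"
    using g(1) bounded_linear_Re bounded_linear_Im by (auto simp: polynomial_function_def o_def)
  then have "(\<lambda>x. of_real (Re (g (cis x))) + \<i> * of_real (Im (g (cis x)))) \<in> trig_polys"
    by (intro trig_polys.intros real_polynomial_function_cis)
  then have "(\<lambda>x. g (cis x)) \<in> trig_polys" by (simp flip: complex_eq)
  moreover have "norm (u x - g (cis x)) < e" if "x \<in> {0..2*pi}" for x
    using g(2)[of "cis x"] Ucis[OF that] by simp
  ultimately show ?thesis by (intro bexI[of _ "\<lambda>x. g (cis x)"]) auto
qed

lemma AE_circ_interior:
  assumes "AE x in lebesgue. 0 < x \<and> x < 2 * pi \<longrightarrow> P x"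
  shows "AE x in circ. P x"
proof -
  have "AE x in lebesgue. x \<notin> {0, 2 * pi}"
    by (rule AE_not_in) (auto simp: null_sets_completionI)
  with assms have "AE x in lebesgue. x \<in> {0..2*pi} \<longrightarrow> P x" by eventually_elim auto
  then show ?thesis by (subst AE_restrict_space_iff) auto
qed

text \<open>Continuous approximants are pushed into the ball of radius M and forced to agree at the
  endpoints. Each is then replaced by a trigonometric polynomial within 1 / (n + 1), whence the
  bound M + 1.\<close>

lemma trig_polys_approx_bounded:
  fixes w :: "real \<Rightarrow> complex"
  assumes w: "w \<in> borel_measurable circ" and M: "\<And>x. norm (w x) \<le> M"
  shows "\<exists>W. (\<forall>n. W n \<in> trig_polys) \<and> (\<forall>n. \<forall>x\<in>{0..2*pi}. norm (W n x) \<le> M + 1) \<and>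
    (AE x in circ. (\<lambda>n. W n x) \<longlonglongrightarrow> w x)"
proof -
  have "0 \<le> M" using norm_ge_zero M by (rule order_trans)
  have "w measurable_on {0..2*pi}"
    using w by (simp add: measurable_on_iff_borel_measurable)
  then obtain N g where N: "negligible N" and g: "\<And>n. continuous_on UNIV (g n)"
    and lim: "\<And>x. x \<notin> N \<Longrightarrow> (\<lambda>n. g n x) \<longlonglongrightarrow> (if x \<in> {0..2*pi} then w x else 0)"
    unfolding measurable_on_def by blast
  \<comment> \<open>The nearest-point projection is continuous, bounded by M, and fixes the values
    of w.\<close>
  define cl where "cl = closest_point (cball (0::complex) M)"
  have cont_cl: "continuous_on UNIV cl"
    unfolding cl_def using \<open>0 \<le> M\<close> by (intro continuous_on_closest_point) auto
  have cl_le: "norm (cl z) \<le> M" for z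
    using closest_point_in_set[of "cball 0 M" z] \<open>0 \<le> M\<close> by (simp add: cl_def)
  have cl_w: "cl (w x) = w x" for x
    unfolding cl_def using M by (intro closest_point_self) auto
  \<comment> \<open>The cut-off is 0 at both endpoints, so that \<open>u n\<close> agrees there, and
    is eventually 1 at each interior point.\<close>
  define cut where "cut = (\<lambda>(n::nat) x. min 1 (of_nat n * (x * (2 * pi - x))))"
  have cut: "0 \<le> cut n x" "cut n x \<le> 1" if "x \<in> {0..2*pi}" for n x
    using that by (auto simp: cut_def)
  define u where "u = (\<lambda>n x. of_real (cut n x) * cl (g n x))"
  have cont_u: "continuous_on {0..2*pi} (u n)" for n
    unfolding u_def cut_def
    by (intro continuous_intros continuous_on_compose2[OF cont_cl] continuous_on_subset[OF g]) auto
  have norm_u: "norm (u n x) \<le> M" if "x \<in> {0..2*pi}" for n x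
    using mult_mono[OF cut(2)[OF that] cl_le] cut[OF that] by (simp add: u_def norm_mult)
  have "\<exists>W\<in>trig_polys. \<forall>x\<in>{0..2*pi}. norm (u n x - W x) < inverse (real (Suc n))" for n
    by (rule trig_polys_dense_continuous[OF cont_u]) (auto simp: u_def cut_def)
  then obtain W where W: "\<And>n. W n \<in> trig_polys"
    "\<And>n x. x \<in> {0..2*pi} \<Longrightarrow> norm (u n x - W n x) < inverse (real (Suc n))"
    by metis
  have lim_W: "(\<lambda>n. W n x) \<longlonglongrightarrow> w x" if x: "x \<notin> N" "0 < x" "x < 2 * pi" for x
  proof -
    have "(\<lambda>n. g n x) \<longlonglongrightarrow> w x" using lim[OF x(1)] x by simp
    moreover have "isCont cl (w x)" using cont_cl by (simp add: continuous_on_eq_continuous_at)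
    ultimately have 1: "(\<lambda>n. cl (g n x)) \<longlonglongrightarrow> cl (w x)" using isCont_tendsto_compose by blast
    have "\<forall>\<^sub>F n in sequentially. cut n x = 1"
    proof -
      have pos: "0 < x * (2 * pi - x)" using x by simp
      then obtain n0 where n0: "1 < real n0 * (x * (2 * pi - x))" using reals_Archimedean3 by blast
      have "cut n x = 1" if "n \<ge> n0" for n
      proof -
        have "real n0 * (x * (2 * pi - x)) \<le> real n * (x * (2 * pi - x))"
          using that pos by (intro mult_right_mono) auto
        then show ?thesis using n0 by (simp add: cut_def)
      qed
      then show ?thesis by (rule eventually_sequentiallyI)
    qed
    then have "(\<lambda>n. cut n x) \<longlonglongrightarrow> 1" by (rule tendsto_eventually)
    then have "(\<lambda>n. of_real (cut n x) * cl (g n x)) \<longlonglongrightarrow> of_real 1 * cl (w x)"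
      by (intro tendsto_mult tendsto_of_real 1)
    then have 2: "(\<lambda>n. u n x) \<longlonglongrightarrow> w x" by (simp add: u_def cl_w)
    have "(\<lambda>n. u n x - W n x) \<longlonglongrightarrow> 0"
    proof (rule Lim_null_comparison)
      show "\<forall>\<^sub>F n in sequentially. norm (u n x - W n x) \<le> inverse (real (Suc n))"
        using W(2)[of x] x by (auto intro!: always_eventually less_imp_le)
    qed (rule LIMSEQ_inverse_real_of_nat)
    from tendsto_diff[OF 2 this] show ?thesis by simp
  qed
  have "AE x in lebesgue. x \<notin> N"
    using N by (intro AE_not_in) (simp add: negligible_iff_null_sets)
  then have "AE x in lebesgue. 0 < x \<and> x < 2 * pi \<longrightarrow> (\<lambda>n. W n x) \<longlonglongrightarrow> w x"
    by eventually_elim (use lim_W in blast)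
  then have "AE x in circ. (\<lambda>n. W n x) \<longlonglongrightarrow> w x" by (rule AE_circ_interior)
  moreover have "norm (W n x) \<le> M + 1" if x: "x \<in> {0..2*pi}" for n x
  proof -
    have "norm (W n x) \<le> norm (u n x) + norm (u n x - W n x)"
      using norm_triangle_ineq4[of "u n x" "u n x - W n x"] by simp
    also have "\<dots> \<le> M + 1"
      using norm_u[OF x] W(2)[OF x, of n] inverse_le_1_iff[of "real (Suc n)"]
      by (intro add_mono) (auto intro: order_trans[OF less_imp_le])
    finally show ?thesis .
  qed
  ultimately show ?thesis using W(1) by blast
qed

section \<open>Recovering a norm from pairings with trigonometric polynomials\<close>

lemma pnorm_nonneg [simp]: "0 \<le> pnorm p f"
  by (simp add: pnorm_def)

text \<open>Uniformly bounded approximants give dominated convergence on both sides: in the pairing,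
  with majorant \<open>norm (h x) * (M + 1)\<close>, and in the norm of the test function.\<close>

lemma bounded_test_le:
  fixes h w :: "real \<Rightarrow> complex"
  assumes q: "0 < q" and h: "integrable circ h" and B: "0 \<le> B"
    and test: "\<And>w. w \<in> trig_polys \<Longrightarrow> norm (LINT x|circ. h x * w x) \<le> B * pnorm q w"
    and w: "w \<in> borel_measurable circ" "\<And>x. norm (w x) \<le> M"
  shows "norm (LINT x|circ. h x * w x) \<le> B * pnorm q w"
proof -
  obtain W where W: "\<And>n. W n \<in> trig_polys" "\<And>n x. x \<in> {0..2*pi} \<Longrightarrow> norm (W n x) \<le> M + 1"
    and lim: "AE x in circ. (\<lambda>n. W n x) \<longlonglongrightarrow> w x"
    using trig_polys_approx_bounded[OF w] by blast
  have "0 \<le> M" using norm_ge_zero w(2) by (rule order_trans)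
  note [measurable] = borel_measurable_integrable[OF h] w(1)
  have [measurable]: "W n \<in> borel_measurable circ" for n
    by (intro continuous_measurable_circ continuous_on_trig_polys W)
  have "(\<lambda>n. LINT x|circ. h x * W n x) \<longlonglongrightarrow> (LINT x|circ. h x * w x)"
  proof (rule integral_dominated_convergence)
    show "integrable circ (\<lambda>x. norm (h x) * (M + 1))" using h by simp
    show "AE x in circ. (\<lambda>n. h x * W n x) \<longlonglongrightarrow> h x * w x"
      using lim by eventually_elim (intro tendsto_intros)
    show "AE x in circ. norm (h x * W n x) \<le> norm (h x) * (M + 1)" for n
      using W(2) by (intro AE_I2) (simp add: norm_mult mult_left_mono)
  qed measurable
  then have 1: "(\<lambda>n. norm (LINT x|circ. h x * W n x)) \<longlonglongrightarrow> norm (LINT x|circ. h x * w x)"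
    by (rule tendsto_norm)
  have "(\<lambda>n. LINT x|circ. norm (W n x) powr q) \<longlonglongrightarrow> (LINT x|circ. norm (w x) powr q)"
  proof (rule integral_dominated_convergence)
    show "integrable circ (\<lambda>x. (M + 1) powr q)" by simp
    show "AE x in circ. (\<lambda>n. norm (W n x) powr q) \<longlonglongrightarrow> norm (w x) powr q"
      using lim by eventually_elim (use q in \<open>auto intro!: tendsto_powr' tendsto_norm\<close>)
    show "AE x in circ. norm (norm (W n x) powr q) \<le> (M + 1) powr q" for n
      using W(2) q by (intro AE_I2) (simp add: powr_mono2)
  qed measurable
  then have "(\<lambda>n. pnorm q (W n)) \<longlonglongrightarrow> pnorm q w"
    unfolding pnorm_def using q by (intro tendsto_powr') (auto intro!: integral_nonneg_AE)
  then have 2: "(\<lambda>n. B * pnorm q (W n)) \<longlonglongrightarrow> B * pnorm q w" by (intro tendsto_intros)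
  show ?thesis
    by (rule LIMSEQ_le[OF 1 2]) (use test[OF W(1)] in blast)
qed

text \<open>The test function is the dual power \<open>cnj (sgn h) |h| powr (p - 1)\<close>, truncated to
  be bounded.\<close>

lemma pnorm_le_of_trig_tests:
  assumes p: "1 < p" "1 / p + 1 / q = 1" and h: "h \<in> Lpc p" and B: "0 \<le> B"
    and test: "\<And>w. w \<in> trig_polys \<Longrightarrow> norm (LINT x|circ. h x * w x) \<le> B * pnorm q w"
  shows "pnorm p h \<le> B"
proof -
  have q: "1 < q" using conjugate_gt1 p by blast
  note [measurable] = Lpc_measurable[OF h]
  have h_int: "integrable circ h" using Lpc_integrable[OF h] p by simp
  \<comment> \<open>After truncation at height R both \<open>h x * w x\<close> and the q-th power of
    the test function equal \<open>T R x\<close>, so the tested inequality reads I \<le> B * I powr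
    (1 / q) for I the integral of \<open>T R\<close>.\<close>
  define T where "T = (\<lambda>R x. if norm (h x) \<le> R then norm (h x) powr p else 0)"
  have [measurable]: "T R \<in> borel_measurable circ" for R
    unfolding T_def by measurable
  have T: "0 \<le> T R x" "T R x \<le> norm (h x) powr p" for R x by (auto simp: T_def)
  have T_int: "integrable circ (T R)" for R
    by (rule Bochner_Integration.integrable_bound[OF Lpc_integrable_powr[OF h]]) (use T in auto)
  have T_le: "(LINT x|circ. T R x) \<le> B powr p" if R: "0 \<le> R" for R
  proof -
    define w where "w = (\<lambda>x. if norm (h x) \<le> R then cnj (sgn (h x)) * of_real (norm (h x) powr (p - 1)) else 0)"
    have [measurable]: "cnj \<in> borel_measurable borel"
      by (intro borel_measurable_continuous_onI continuous_intros)
    have wm: "w \<in> borel_measurable circ"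
      unfolding w_def sgn_div_norm by measurable
    have "norm (w x) \<le> R powr (p - 1)" for x
      using p R by (auto simp: w_def norm_mult norm_sgn intro!: powr_mono2)
    note bt = bounded_test_le[OF _ h_int B test wm this]
    have hw: "h x * w x = of_real (T R x)" for x
    proof (cases "h x = 0")
      case False
      have "h x * cnj (sgn (h x)) = of_real (norm (h x))"
        using False by (simp add: sgn_div_norm scaleR_conv_of_real complex_norm_square[symmetric]
            power2_eq_square field_simps flip: of_real_mult)
      then have "h x * (cnj (sgn (h x)) * of_real (norm (h x) powr (p - 1))) = of_real (norm (h x) * norm (h x) powr (p - 1))"
        by (simp flip: mult.assoc)
      also have "norm (h x) * norm (h x) powr (p - 1) = norm (h x) powr p"
        using powr_mult_base[of "norm (h x)" "p - 1"] by simp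
      finally show ?thesis by (simp add: w_def T_def)
    qed (use p in \<open>simp add: T_def\<close>)
    have wq: "norm (w x) powr q = T R x" for x
    proof (cases "h x = 0")
      case False
      have "(p - 1) * q = p" using p q by (simp add: field_simps)
      then show ?thesis using False by (simp add: w_def T_def norm_mult norm_sgn powr_powr)
    qed (use p q in \<open>simp add: w_def T_def\<close>)
    let ?I = "LINT x|circ. T R x"
    have I: "0 \<le> ?I" using T by (intro integral_nonneg_AE) auto
    have "?I \<le> B * ?I powr (1 / q)"
      using bt q I by (simp add: hw wq pnorm_def)
    show ?thesis
    proof (cases "?I = 0")
      case False
      with I have pos: "0 < ?I" by simp
      have "?I powr (1 / p) * ?I powr (1 / q) = ?I"
        using pos p(2) by (simp flip: powr_add)
      then have "?I powr (1 / p) * ?I powr (1 / q) \<le> B * ?I powr (1 / q)"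
        using \<open>?I \<le> B * ?I powr (1 / q)\<close> by simp
      then have "?I powr (1 / p) \<le> B" using pos by simp
      then have "(?I powr (1 / p)) powr p \<le> B powr p" using p by (intro powr_mono2) auto
      then show ?thesis using pos p by (simp add: powr_powr)
    qed simp
  qed
  have "(\<lambda>n. LINT x|circ. T (real n) x) \<longlonglongrightarrow> (LINT x|circ. norm (h x) powr p)"
  proof (rule integral_dominated_convergence)
    show "integrable circ (\<lambda>x. norm (h x) powr p)" by (rule Lpc_integrable_powr[OF h])
    show "AE x in circ. (\<lambda>n. T (real n) x) \<longlonglongrightarrow> norm (h x) powr p"
    proof (intro AE_I2 tendsto_eventually)
      fix x
      obtain n0 where n0: "norm (h x) \<le> real n0" using real_arch_simple by blast
      have "T (real n) x = norm (h x) powr p" if "n \<ge> n0" for n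
        using n0 that by (simp add: T_def)
      then show "\<forall>\<^sub>F n in sequentially. T (real n) x = norm (h x) powr p"
        by (rule eventually_sequentiallyI)
    qed
    show "AE x in circ. norm (T (real n) x) \<le> norm (h x) powr p" for n
      using T by (intro AE_I2) simp
  qed measurable
  then have "(LINT x|circ. norm (h x) powr p) \<le> B powr p"
    by (rule LIMSEQ_le_const2) (use T_le in auto)
  then have "pnorm p h \<le> (B powr p) powr (1 / p)"
    unfolding pnorm_def using p by (intro powr_mono2) (auto intro!: integral_nonneg_AE)
  then show ?thesis using p B by (simp add: powr_powr)
qed

section \<open>Coefficients of trigonometric polynomials and of distributional series\<close>

lemma fcoef_cis: "fcoef (\<lambda>x. cis (of_int j * x)) k = (if k = j then 1 else 0)"
proof -
  have "cis (of_int j * x) * cis (- (of_int k * x)) = cis (of_int (j - k) * x)" for x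
    by (simp add: cis_mult algebra_simps)
  then show ?thesis by (simp only: fcoef_def integral_cis) simp
qed

lemma fcoef_cmult: "fcoef (\<lambda>x. c * f x) k = c * fcoef f k"
  by (simp add: fcoef_def mult.assoc)

lemma fcoef_add:
  assumes "integrable circ f" "integrable circ g"
  shows "fcoef (\<lambda>x. f x + g x) k = fcoef f k + fcoef g k"
proof -
  have "integrable circ (\<lambda>x. f x * cis (- (of_int k * x)))" if "integrable circ f" for f
    using integrable_circ_mult_cis[OF that, of "- of_int k"] by simp
  from this[OF assms(1)] this[OF assms(2)] show ?thesis
    by (simp add: fcoef_def distrib_right add_divide_distrib)
qed

lemma integrable_trig_poly: "w \<in> trig_polys \<Longrightarrow> integrable circ w"
  by (intro integrable_circ_continuous continuous_on_trig_polys)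

text \<open>A trigonometric polynomial sees only finitely many coefficients. Stating the identity
  for all large N spares a notion of degree and leaves N free to be chosen at the end of a
  block.\<close>

lemma trig_poly_test:
  assumes h: "integrable circ h" and w: "w \<in> trig_polys"
  shows "\<exists>N0::nat. \<forall>N\<ge>N0. (LINT x|circ. h x * w x)
    = 2 * pi * (\<Sum>k=-int N..int N. fcoef h k * fcoef w (- k))"
  using w
proof induction
  case (cis j)
  have "(LINT x|circ. h x * cis (of_int j * x)) = 2 * pi * fcoef h (- j)"
    by (simp add: fcoef_def)
  moreover have "(\<Sum>k=-int N..int N. fcoef h k * fcoef (\<lambda>x. cis (of_int j * x)) (- k)) = fcoef h (- j)"
    if "N \<ge> nat \<bar>j\<bar>" for N
  proof -
    have "fcoef h k * fcoef (\<lambda>x. cis (of_int j * x)) (- k) = (if k = - j then fcoef h (- j) else 0)" for k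
      by (auto simp: fcoef_cis)
    then have "(\<Sum>k=-int N..int N. fcoef h k * fcoef (\<lambda>x. cis (of_int j * x)) (- k))
      = (\<Sum>k=-int N..int N. if k = - j then fcoef h (- j) else 0)" by simp
    also have "\<dots> = fcoef h (- j)" using that by (subst sum.delta) auto
    finally show ?thesis .
  qed
  ultimately show ?case by (intro exI[of _ "nat \<bar>j\<bar>"]) simp
next
  case (add f g)
  from add.IH(1) obtain N1 where N1: "\<forall>N\<ge>N1. (LINT x|circ. h x * f x)
      = 2 * pi * (\<Sum>k=-int N..int N. fcoef h k * fcoef f (- k))" by blast
  from add.IH(2) obtain N2 where N2: "\<forall>N\<ge>N2. (LINT x|circ. h x * g x)
      = 2 * pi * (\<Sum>k=-int N..int N. fcoef h k * fcoef g (- k))" by blast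
  have int: "integrable circ (\<lambda>x. h x * f x)" if f: "f \<in> trig_polys" for f
  proof -
    obtain M where M: "\<And>x. x \<in> {0..2*pi} \<Longrightarrow> norm (f x) \<le> M"
      using compact_imp_bounded[OF compact_continuous_image[OF
          continuous_on_subset[OF continuous_on_trig_polys[OF f] subset_UNIV] compact_Icc[of 0 "2*pi"]]]
      unfolding bounded_iff by blast
    note [measurable] = borel_measurable_integrable[OF h]
      continuous_measurable_circ[OF continuous_on_trig_polys[OF f]]
    show ?thesis
    proof (rule Bochner_Integration.integrable_bound)
      show "integrable circ (\<lambda>x. norm (h x) * M)" using h by simp
      show "(\<lambda>x. h x * f x) \<in> borel_measurable circ" by measurable
      show "AE x in circ. norm (h x * f x) \<le> norm (norm (h x) * M)"
        using M by (intro AE_I2) (auto simp: norm_mult abs_mult intro!: mult_left_mono order_trans[OF M])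
    qed
  qed
  have "(LINT x|circ. h x * (f x + g x)) = 2 * pi * (\<Sum>k=-int N..int N. fcoef h k * fcoef (\<lambda>x. f x + g x) (- k))"
    if "N \<ge> max N1 N2" for N
  proof -
    have "(LINT x|circ. h x * (f x + g x)) = (LINT x|circ. h x * f x) + (LINT x|circ. h x * g x)"
      using int[OF add.hyps(1)] int[OF add.hyps(2)] by (simp add: distrib_left)
    also have "\<dots> = 2 * pi * (\<Sum>k=-int N..int N. fcoef h k * fcoef (\<lambda>x. f x + g x) (- k))"
      using that N1[rule_format, of N] N2[rule_format, of N] by (simp add: fcoef_add integrable_trig_poly add.hyps distrib_left sum.distrib)
    finally show ?thesis .
  qed
  then show ?case by blast
next
  case (cmult f c)
  then obtain N0 where N: "\<forall>N\<ge>N0. (LINT x|circ. h x * f x)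
      = 2 * pi * (\<Sum>k=-int N..int N. fcoef h k * fcoef f (- k))" by blast
  have "(LINT x|circ. h x * (c * f x)) = 2 * pi * (\<Sum>k=-int N..int N. fcoef h k * fcoef (\<lambda>x. c * f x) (- k))"
    if "N \<ge> N0" for N
  proof -
    have "(LINT x|circ. h x * (c * f x)) = c * (LINT x|circ. h x * f x)"
      by (simp add: mult.left_commute)
    also have "\<dots> = 2 * pi * (\<Sum>k=-int N..int N. fcoef h k * fcoef (\<lambda>x. c * f x) (- k))"
      unfolding N[rule_format, OF that] fcoef_cmult by (simp add: sum_distrib_left mult_ac)
    finally show ?thesis .
  qed
  then show ?case by blast
qed

text \<open>The exponential cis (- j x) is an admissible test function, and orthogonality leaves a
  single term of the series.\<close>

lemma fcoef_distributional_series: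
  assumes "has_distributional_series \<phi> c"
  shows "fcoef (\<lambda>x. of_real (\<phi> x)) j = c j"
proof -
  let ?u = "\<lambda>x::real. cis (- (of_int j * x))"
  have "circle_test_function ?u"
    unfolding circle_test_function_def circle_periodic_def
  proof (intro conjI allI exI[of _ "\<lambda>n x. (- \<i> * of_int j) ^ n * cis (- (of_int j * x))"])
    fix x :: real
    have "cis (- (of_int j * (x + 2 * pi))) = cis (- (of_int j * x)) * cis (2 * pi * of_int (- j))"
      by (simp add: cis_mult algebra_simps)
    also have "cis (2 * pi * of_int (- j)) = 1" by (rule cis_multiple_2pi) simp
    finally show "cis (- (of_int j * (x + 2 * pi))) = cis (- (of_int j * x))" by simp
  next
    fix n and x :: real
    show "((\<lambda>x. (- \<i> * of_int j) ^ n * cis (- (of_int j * x))) has_vector_derivative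
        (- \<i> * of_int j) ^ Suc n * cis (- (of_int j * x))) (at x)"
    proof -
      have "((\<lambda>z. (- \<i> * of_int j) ^ n * exp (- \<i> * of_int j * z)) has_field_derivative
          (- \<i> * of_int j) ^ Suc n * exp (- \<i> * of_int j * of_real x)) (at (of_real x))"
        by (auto intro!: derivative_eq_intros)
      from has_vector_derivative_real_field[OF this] show ?thesis
        by (simp add: cis_conv_exp mult.assoc)
    qed
  qed simp
  from assms[unfolded has_distributional_series_def, rule_format, OF this]
  have sum: "((\<lambda>k. c k * (LINT x|circ. cis (of_int k * x) * ?u x)) has_sum
      (LINT x|circ. of_real (\<phi> x) * ?u x)) UNIV"
    by (simp only: set_lebesgue_integral_circ)
  have "(LINT x|circ. cis (of_int k * x) * ?u x) = (if k = j then 2 * pi else 0)" for k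
  proof -
    have "cis (of_int k * x) * ?u x = cis (of_int (k - j) * x)" for x
      by (simp add: cis_mult algebra_simps)
    then show ?thesis by (simp only: integral_cis) simp
  qed
  then have eq: "(\<lambda>k. c k * (LINT x|circ. cis (of_int k * x) * ?u x)) = (\<lambda>k. if k = j then c j * (2 * pi) else 0)"
    by auto
  have "((\<lambda>k. if k = j then c j * (2 * pi) else 0) has_sum (c j * (2 * pi))) UNIV"
    by (subst has_sum_cong_neutral[where T = "{j}" and g = "\<lambda>_. c j * (2 * pi)"])
      (use has_sum_finite[of "{j}" "\<lambda>_. c j * (2 * pi)"] in auto)
  from has_sum_unique[OF sum[unfolded eq] this]
  have "(LINT x|circ. of_real (\<phi> x) * ?u x) = c j * (2 * pi)" .
  then show ?thesis by (simp add: fcoef_def)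
qed

section \<open>Translations and convolutions\<close>

lemma has_bochner_integral_circ_iff:
  fixes F :: "real \<Rightarrow> 'a::{banach, second_countable_topology}"
  shows "has_bochner_integral circ F i
    \<longleftrightarrow> has_bochner_integral lebesgue (\<lambda>x. indicator {0..2*pi} x *\<^sub>R F x) i"
  by (rule has_bochner_integral_restrict_space) simp

lemma circle_periodic_int:
  assumes "circle_periodic F"
  shows "F (x + 2 * pi * of_int n) = F x"
proof (induction n rule: int_induct[where k = 0])
  case base
  show ?case by simp
next
  case (step1 i)
  have "F (x + 2 * pi * of_int (i + 1)) = F ((x + 2 * pi * of_int i) + 2 * pi)"
    by (simp add: algebra_simps)
  then show ?case using assms step1 by (simp add: circle_periodic_def)
next
  case (step2 i)
  have "F (x + 2 * pi * of_int (i - 1)) = F ((x + 2 * pi * of_int (i - 1)) + 2 * pi)"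
    using assms by (simp only: circle_periodic_def)
  also have "(x + 2 * pi * of_int (i - 1)) + 2 * pi = x + 2 * pi * of_int i"
    by (simp add: algebra_simps)
  finally show ?case using step2 by simp
qed

text \<open>The piece [a, 2 pi] moves to [0, 2 pi - a]; the piece (0, a] moves, with one period
  added, to (2 pi - a, 2 pi]. The half-open choice makes the translated pieces an exact partition,
  while the original ones fail to be one only at the points 0 and a.\<close>

lemma has_bochner_integral_circ_shift_aux:
  fixes F :: "real \<Rightarrow> 'a::euclidean_space"
  assumes per: "circle_periodic F" and F: "integrable circ F" and a: "0 \<le> a" "a \<le> 2 * pi"
  shows "has_bochner_integral circ (\<lambda>y. F (a + y)) (integral\<^sup>L circ F)"
proof -
  define I where "I = (\<lambda>A. LINT x|lebesgue. indicator A x *\<^sub>R F x)"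
  have hF: "has_bochner_integral lebesgue (\<lambda>x. indicator {0..2*pi} x *\<^sub>R F x) (integral\<^sup>L circ F)"
    using F by (simp add: has_bochner_integral_integrable flip: has_bochner_integral_circ_iff)
  have sub: "has_bochner_integral lebesgue (\<lambda>x. indicator A x *\<^sub>R F x) (I A)"
    if "A \<subseteq> {0..2*pi}" "A \<in> sets lebesgue" for A
  proof -
    have "integrable lebesgue (\<lambda>x. indicator A x *\<^sub>R (indicator {0..2*pi} x *\<^sub>R F x))"
      by (rule integrable_mult_indicator) (use hF that in \<open>auto simp: has_bochner_integral_iff\<close>)
    also have "(\<lambda>x. indicator A x *\<^sub>R (indicator {0..2*pi} x *\<^sub>R F x)) = (\<lambda>x. indicator A x *\<^sub>R F x)"
      using that by (auto simp: fun_eq_iff indicator_def)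
    finally show ?thesis unfolding I_def by (rule has_bochner_integral_integrable)
  qed
  have "{0<..a} = {0..a} - {0}" by auto
  then have "{0<..a} \<in> sets lebesgue" by (metis lmeasurable_interval(1) fmeasurableD sets.Diff sets.empty_sets negligible_imp_sets negligible_sing)
  then have sub1: "has_bochner_integral lebesgue (\<lambda>x. indicator {a..2*pi} x *\<^sub>R F x) (I {a..2*pi})"
    and sub2: "has_bochner_integral lebesgue (\<lambda>x. indicator {0<..a} x *\<^sub>R F x) (I {0<..a})"
    using a by (auto intro!: sub)
  have ne: "AE x in lebesgue. x \<noteq> c" for c :: real
    using AE_not_in[of "{c}" lebesgue] by simp
  have "has_bochner_integral lebesgue (\<lambda>x. indicator {0..2*pi} x *\<^sub>R F x) (I {a..2*pi} + I {0<..a})"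
  proof (rule has_bochner_integral_cong_AE[THEN iffD1])
    show "has_bochner_integral lebesgue (\<lambda>x. indicator {a..2*pi} x *\<^sub>R F x + indicator {0<..a} x *\<^sub>R F x) (I {a..2*pi} + I {0<..a})"
      by (intro has_bochner_integral_add sub1 sub2)
    show "(\<lambda>x. indicator {a..2*pi} x *\<^sub>R F x + indicator {0<..a} x *\<^sub>R F x) \<in> borel_measurable lebesgue"
      by (intro borel_measurable_add borel_measurable_has_bochner_integral[OF sub1] borel_measurable_has_bochner_integral[OF sub2])
    show "(\<lambda>x. indicator {0..2*pi} x *\<^sub>R F x) \<in> borel_measurable lebesgue"
      by (rule borel_measurable_has_bochner_integral[OF hF])
    show "AE x in lebesgue. indicator {a..2*pi} x *\<^sub>R F x + indicator {0<..a} x *\<^sub>R F x = indicator {0..2*pi} x *\<^sub>R F x"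
      using ne[of a] ne[of 0] by eventually_elim (use a in \<open>auto simp: indicator_def\<close>)
  qed
  with hF have I: "integral\<^sup>L circ F = I {a..2*pi} + I {0<..a}"
    by (rule has_bochner_integral_eq)
  have 1: "has_bochner_integral lebesgue (\<lambda>y. indicator {0..2*pi-a} y *\<^sub>R F (a + y)) (I {a..2*pi})"
  proof -
    have "has_bochner_integral lebesgue (\<lambda>y. indicator {a..2*pi} (a + 1 * y) *\<^sub>R F (a + 1 * y)) (I {a..2*pi} /\<^sub>R \<bar>1\<bar>)"
      by (subst has_bochner_integral_lebesgue_real_affine_iff[symmetric]) (use sub1 sub2 in auto)
    moreover have "indicator {a..2*pi} (a + 1 * y) = (indicator {0..2*pi-a} y :: real)" for y
      by (auto simp: indicator_def)
    ultimately show ?thesis by simp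
  qed
  have 2: "has_bochner_integral lebesgue (\<lambda>y. indicator {2*pi-a<..2*pi} y *\<^sub>R F (a + y)) (I {0<..a})"
  proof -
    have "has_bochner_integral lebesgue (\<lambda>y. indicator {0<..a} ((a - 2 * pi) + 1 * y) *\<^sub>R F ((a - 2 * pi) + 1 * y)) (I {0<..a} /\<^sub>R \<bar>1\<bar>)"
      by (subst has_bochner_integral_lebesgue_real_affine_iff[symmetric]) (use sub1 sub2 in auto)
    moreover have "indicator {0<..a} ((a - 2 * pi) + 1 * y) = (indicator {2*pi-a<..2*pi} y :: real)" for y
      by (auto simp: indicator_def)
    moreover have "F ((a - 2 * pi) + 1 * y) = F (a + y)" for y
      using per[unfolded circle_periodic_def, rule_format, of "(a - 2 * pi) + 1 * y"] by (simp add: algebra_simps)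
    ultimately show ?thesis by simp
  qed
  have "has_bochner_integral lebesgue (\<lambda>y. indicator {0..2*pi-a} y *\<^sub>R F (a + y)
      + indicator {2*pi-a<..2*pi} y *\<^sub>R F (a + y)) (I {a..2*pi} + I {0<..a})"
    by (intro has_bochner_integral_add 1 2)
  also have "(\<lambda>y. indicator {0..2*pi-a} y *\<^sub>R F (a + y) + indicator {2*pi-a<..2*pi} y *\<^sub>R F (a + y))
      = (\<lambda>y. indicator {0..2*pi} y *\<^sub>R F (a + y))"
    using a by (auto simp: fun_eq_iff indicator_def)
  finally  show ?thesis by (simp add: has_bochner_integral_circ_iff I)
qed

lemma has_bochner_integral_circ_shift:
  fixes F :: "real \<Rightarrow> 'a::euclidean_space"
  assumes per: "circle_periodic F" and F: "integrable circ F"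
  shows "has_bochner_integral circ (\<lambda>y. F (a + y)) (integral\<^sup>L circ F)"
proof -
  define n where "n = \<lfloor>a / (2 * pi)\<rfloor>"
  define b where "b = a - 2 * pi * of_int n"
  have "of_int n \<le> a / (2 * pi)" "a / (2 * pi) < of_int n + 1"
    unfolding n_def by linarith+
  then have "0 \<le> b" "b \<le> 2 * pi"
    by (auto simp: b_def field_simps)
  from has_bochner_integral_circ_shift_aux[OF per F this]
  have "has_bochner_integral circ (\<lambda>y. F (b + y)) (integral\<^sup>L circ F)" .
  moreover have "F (b + y) = F (a + y)" for y
    using circle_periodic_int[OF per, of "b + y" n] by (simp add: b_def add_ac)
  ultimately show ?thesis by simp
qed

lemma has_bochner_integral_circ_reflect:
  fixes F :: "real \<Rightarrow> 'a::euclidean_space"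
  assumes per: "circle_periodic F" and F: "integrable circ F"
  shows "has_bochner_integral circ (\<lambda>y. F (- y)) (integral\<^sup>L circ F)"
proof -
  have "has_bochner_integral lebesgue (\<lambda>x. indicator {0..2*pi} x *\<^sub>R F x) (integral\<^sup>L circ F)"
    using F by (simp add: has_bochner_integral_integrable flip: has_bochner_integral_circ_iff)
  then have "has_bochner_integral lebesgue (\<lambda>y. indicator {0..2*pi} (2 * pi + (-1) * y) *\<^sub>R F (2 * pi + (-1) * y))
      (integral\<^sup>L circ F /\<^sub>R \<bar>-1\<bar>)"
    by (subst has_bochner_integral_lebesgue_real_affine_iff[symmetric]) auto
  moreover have "indicator {0..2*pi} (2 * pi + (-1) * y) = (indicator {0..2*pi} y :: real)" for y
    by (auto simp: indicator_def)
  moreover have "F (2 * pi + (-1) * y) = F (- y)" for y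
    using per[unfolded circle_periodic_def, rule_format, of "- y"] by (simp add: algebra_simps)
  ultimately show ?thesis by (simp add: has_bochner_integral_circ_iff)
qed

lemma circle_periodic_shift: "circle_periodic F \<Longrightarrow> circle_periodic (\<lambda>y. F (a + y))"
  by (simp add: circle_periodic_def flip: add.assoc)

lemma
  fixes F :: "real \<Rightarrow> 'a::euclidean_space"
  assumes per: "circle_periodic F" and F: "integrable circ F"
  shows integrable_circ_diff: "integrable circ (\<lambda>y. F (a - y))"
    and integral_circ_diff: "(LINT y|circ. F (a - y)) = integral\<^sup>L circ F"
    and integrable_circ_minus: "integrable circ (\<lambda>y. F (y - a))"
    and integral_circ_minus: "(LINT y|circ. F (y - a)) = integral\<^sup>L circ F"
proof -
  note s = has_bochner_integral_circ_shift[OF per F]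
  have "integrable circ (\<lambda>y. F (a + y))" "integral\<^sup>L circ (\<lambda>y. F (a + y)) = integral\<^sup>L circ F"
    using s[of a] by (auto simp: has_bochner_integral_iff)
  with has_bochner_integral_circ_reflect[OF circle_periodic_shift[OF per], of a]
  have "has_bochner_integral circ (\<lambda>y. F (a - y)) (integral\<^sup>L circ F)" by simp
  then show "integrable circ (\<lambda>y. F (a - y))" "(LINT y|circ. F (a - y)) = integral\<^sup>L circ F"
    by (auto simp: has_bochner_integral_iff)
  have "has_bochner_integral circ (\<lambda>y. F (y - a)) (integral\<^sup>L circ F)"
    using s[of "- a"] by simp
  then show "integrable circ (\<lambda>y. F (y - a))" "(LINT y|circ. F (y - a)) = integral\<^sup>L circ F"
    by (auto simp: has_bochner_integral_iff)
qed

lemma circle_periodic_cis: "circle_periodic (\<lambda>x. cis (- (of_int k * x)))"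
  unfolding circle_periodic_def
proof
  fix x
  have "cis (- (of_int k * (x + 2 * pi))) = cis (- (of_int k * x)) * cis (2 * pi * of_int (- k))"
    by (simp add: cis_mult algebra_simps)
  also have "cis (2 * pi * of_int (- k)) = 1" by (rule cis_multiple_2pi) simp
  finally show "cis (- (of_int k * (x + 2 * pi))) = cis (- (of_int k * x))" by simp
qed

lemma circle_periodic_mult:
  "circle_periodic f \<Longrightarrow> circle_periodic g \<Longrightarrow> circle_periodic (\<lambda>x. f x * g x)"
  by (simp add: circle_periodic_def)

lemma circle_periodic_of_real: "circle_periodic f \<Longrightarrow> circle_periodic (\<lambda>x. of_real (f x))"
  by (simp add: circle_periodic_def)

lemma integrable_circ_cis:
  assumes "integrable circ f"
  shows "integrable circ (\<lambda>x. f x * cis (- (of_int k * x)))"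
  using integrable_circ_mult_cis[OF assms, of "- of_int k"] by simp

lemma integral_shift_cis:
  assumes per: "circle_periodic g" and g: "integrable circ g"
  shows "(LINT x|circ. g (x - s) * cis (- (of_int k * x))) = 2 * pi * (cis (- (of_int k * s)) * fcoef g k)"
proof -
  have "g (x - s) * cis (- (of_int k * x))
      = cis (- (of_int k * s)) * (g (x - s) * cis (- (of_int k * (x - s))))" for x
  proof -
    have "cis (- (of_int k * x)) = cis (- (of_int k * s)) * cis (- (of_int k * (x - s)))"
      by (simp add: cis_mult algebra_simps)
    then show ?thesis by (simp only: mult.left_commute)
  qed
  then have "(LINT x|circ. g (x - s) * cis (- (of_int k * x)))
      = cis (- (of_int k * s)) * (LINT x|circ. g (x - s) * cis (- (of_int k * (x - s))))"
    by (simp only: integral_mult_right_zero)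
  also have "(LINT x|circ. g (x - s) * cis (- (of_int k * (x - s)))) = (LINT x|circ. g x * cis (- (of_int k * x)))"
    by (rule integral_circ_minus[OF circle_periodic_mult[OF per circle_periodic_cis] integrable_circ_cis[OF g]])
  finally show ?thesis by (simp add: fcoef_def)
qed

lemma fcoef_shift:
  assumes "circle_periodic g" "integrable circ g"
  shows "fcoef (\<lambda>x. g (x - s)) k = cis (- (of_int k * s)) * fcoef g k"
  by (subst fcoef_def, subst integral_shift_cis[OF assms]) simp

lemma AE_lebesgue_affine:
  assumes "AE x in lebesgue. P x" "c \<noteq> 0"
  shows "AE x in lebesgue. P (t + c * x :: real)"
proof -
  have T: "(\<lambda>x. t + c * x) \<in> lebesgue \<rightarrow>\<^sub>M lebesgue"
    using lebesgue_affine_measurable[where c = "\<lambda>x::real. c" and t = t] assms(2) by simp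
  have "AE x in density (distr lebesgue lebesgue (\<lambda>x. t + c * x)) (\<lambda>_. ennreal \<bar>c\<bar>). P x"
    using assms by (subst lebesgue_real_affine[symmetric]) auto
  then have "AE x in distr lebesgue lebesgue (\<lambda>x. t + c * x). P x"
    using assms(2) by (subst (asm) AE_density) auto
  then show ?thesis using T by (rule AE_distrD[rotated])
qed

lemma AE_lebesgue_imp_circ: "AE x in lebesgue. P x \<Longrightarrow> AE x in circ. P x"
  by (subst AE_restrict_space_iff) (auto elim: eventually_mono)

text \<open>Fubini's theorem needs a Borel representative of \<open>g\<close>, because \<open>(x, y) \<mapsto> g (x - y)\<close> need
  not be measurable for the product of the Lebesgue sigma-algebras.\<close>

lemma
  fixes \<phi> g :: "real \<Rightarrow> real"
  assumes \<phi>: "integrable circ \<phi>" and g: "integrable circ g" "circle_periodic g" "g \<in> borel_measurable lebesgue"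
  shows integrable_circle_conv_cis: "integrable circ (\<lambda>x. complex_of_real (circle_conv \<phi> g x) * cis (- (of_int k * x)))"
    and fcoef_circle_conv: "fcoef (\<lambda>x. of_real (circle_conv \<phi> g x)) k
    = fcoef (\<lambda>x. of_real (\<phi> x)) k * fcoef (\<lambda>x. of_real (g x)) k"
proof -
  obtain g' where "g' \<in> borel_measurable lborel" "AE x in lborel. g x = g' x"
    using completion_ex_borel_measurable_real[OF g(3)] by blast
  then have g'[measurable]: "g' \<in> borel_measurable borel" and gg': "AE x in lebesgue. g x = g' x"
    by (simp_all add: AE_completion)
  note [measurable] = borel_measurable_integrable[OF \<phi>]
  let ?G = "\<lambda>x. complex_of_real (g x)"
  have Gper: "circle_periodic ?G" by (rule circle_periodic_of_real[OF g(2)])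
  have Gint: "integrable circ ?G" using g by simp
  define f where "f = (\<lambda>(y, x). complex_of_real (\<phi> y * g' (x - y)) * cis (- (of_int k * x)))"
  have fm[measurable]: "f \<in> borel_measurable (circ \<Otimes>\<^sub>M circ)"
    unfolding f_def by measurable
  \<comment> \<open>For fixed y the identity holds for almost all x, and for fixed x for almost all
    y. This suffices because g is exchanged for g' only inside one inner integral at a time.\<close>
  have ae_x: "AE x in circ. g' (x - y) = g (x - y)" for y
    using AE_lebesgue_affine[OF gg', of 1 "- y"] by (intro AE_lebesgue_imp_circ) (simp add: eq_commute)
  have ae_y: "AE y in circ. g' (x - y) = g (x - y)" for x
    using AE_lebesgue_affine[OF gg', of "-1" x] by (intro AE_lebesgue_imp_circ) (simp add: eq_commute)
  have gx_int: "integrable circ (\<lambda>x. g (x - y))" for y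
    by (rule integrable_circ_minus[OF g(2,1)])
  have g'x_int: "integrable circ (\<lambda>x. g' (x - y))" for y
    using gx_int[of y] ae_x[of y] borel_measurable_integrable[OF gx_int[of y]]
    by (subst integrable_cong_AE[where g = "\<lambda>x. g (x - y)"]) auto
  \<comment> \<open>By translation invariance the inner integral is |\<phi> y| times the L^1 norm of
    g, which is integrable in y: the hypothesis of Fubini's theorem.\<close>
  have norm_int: "(LINT x|circ. norm (f (y, x))) = \<bar>\<phi> y\<bar> * (LINT x|circ. \<bar>g x\<bar>)" for y
  proof -
    have "(LINT x|circ. norm (f (y, x))) = \<bar>\<phi> y\<bar> * (LINT x|circ. \<bar>g' (x - y)\<bar>)"
      by (simp add: f_def norm_mult abs_mult)
    also have "(LINT x|circ. \<bar>g' (x - y)\<bar>) = (LINT x|circ. \<bar>g (x - y)\<bar>)"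
      using ae_x[of y] borel_measurable_integrable[OF gx_int[of y]] by (intro integral_cong_AE) auto
    also have "\<dots> = (LINT x|circ. \<bar>g x\<bar>)"
      by (rule integral_circ_minus) (use g in \<open>auto simp: circle_periodic_def\<close>)
    finally show ?thesis .
  qed
  have fx: "integrable circ (\<lambda>x. f (y, x))" for y
  proof -
    have "integrable circ (\<lambda>x. complex_of_real (\<phi> y * g' (x - y)) * cis (- (of_int k * x)))"
      by (rule integrable_circ_cis) (use g'x_int[of y] in simp)
    then show ?thesis by (simp add: f_def)
  qed
  have fint: "integrable (circ \<Otimes>\<^sub>M circ) f"
    by (rule circ_pair.Fubini_integrable) (use fx \<phi> in \<open>auto simp: norm_int\<close>)
  have swap: "(LINT y|circ. LINT x|circ. f (y, x)) = (LINT x|circ. LINT y|circ. f (y, x))"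
    by (rule circ_pair.Fubini_integral[symmetric]) (use fint in simp)
  moreover have inner: "(LINT y|circ. f (y, x)) = 2 * pi * (of_real (circle_conv \<phi> g x) * cis (- (of_int k * x)))" for x
  proof -
    have "(LINT y|circ. f (y, x)) = of_real (LINT y|circ. \<phi> y * g' (x - y)) * cis (- (of_int k * x))"
      by (simp only: f_def case_prod_conv integral_mult_left_zero integral_complex_of_real)
    also have "(LINT y|circ. \<phi> y * g' (x - y)) = (LINT y|circ. \<phi> y * g (x - y))"
      using ae_y[of x] borel_measurable_integrable[OF integrable_circ_diff[OF g(2,1), of x]]
      by (intro integral_cong_AE) (auto elim: eventually_mono)
    also have "\<dots> = 2 * pi * circle_conv \<phi> g x"
      by (simp add: circle_conv_def set_lebesgue_integral_circ)
    finally show ?thesis by simp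
  qed
  moreover have "(LINT x|circ. f (y, x)) = 2 * pi * fcoef ?G k * (of_real (\<phi> y) * cis (- (of_int k * y)))" for y
  proof -
    have "(LINT x|circ. f (y, x)) = of_real (\<phi> y) * (LINT x|circ. of_real (g' (x - y)) * cis (- (of_int k * x)))"
      unfolding f_def by (simp add: mult.assoc)
    also have "(LINT x|circ. of_real (g' (x - y)) * cis (- (of_int k * x)))
        = (LINT x|circ. ?G (x - y) * cis (- (of_int k * x)))"
      using ae_x[of y] borel_measurable_integrable[OF gx_int[of y]]
      by (intro integral_cong_AE) (auto elim: eventually_mono)
    also have "\<dots> = 2 * pi * (cis (- (of_int k * y)) * fcoef ?G k)"
      by (rule integral_shift_cis[OF Gper Gint])
    finally show ?thesis by (simp add: mult_ac)
  qed
  ultimately have eq: "2 * pi * fcoef ?G k * (LINT y|circ. of_real (\<phi> y) * cis (- (of_int k * y)))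
      = 2 * pi * (LINT x|circ. of_real (circle_conv \<phi> g x) * cis (- (of_int k * x)))"
    by simp
  have "integrable circ (\<lambda>x. LINT y|circ. f (y, x))"
    by (rule circ_pair.integrable_snd) (use fint in simp)
  then have "integrable circ (\<lambda>x. inverse (complex_of_real (2 * pi)) * (LINT y|circ. f (y, x)))"
    by (rule integrable_mult_right)
  moreover have "inverse (complex_of_real (2 * pi)) * (LINT y|circ. f (y, x))
      = of_real (circle_conv \<phi> g x) * cis (- (of_int k * x))" for x
    unfolding inner by simp
  ultimately show "integrable circ (\<lambda>x. complex_of_real (circle_conv \<phi> g x) * cis (- (of_int k * x)))"
    by (simp only:)
  from eq have "fcoef ?G k * (LINT y|circ. of_real (\<phi> y) * cis (- (of_int k * y)))
      = (LINT x|circ. of_real (circle_conv \<phi> g x) * cis (- (of_int k * x)))"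
    by simp
  then show "fcoef (\<lambda>x. of_real (circle_conv \<phi> g x)) k
    = fcoef (\<lambda>x. of_real (\<phi> x)) k * fcoef (\<lambda>x. of_real (g x)) k"
    by (simp add: fcoef_def[of "\<lambda>x. of_real (circle_conv \<phi> g x)"] fcoef_def[of "\<lambda>x. of_real (\<phi> x)"] mult.commute)
qed

section \<open>Summation by parts and the discrete Fourier transform\<close>

lemma geometric_cis_bound:
  fixes z :: complex
  assumes "norm z = 1" "z \<noteq> 1"
  shows "norm (\<Sum>i<n. z ^ i) \<le> 2 / norm (1 - z)"
proof -
  have "(\<Sum>i<n. z ^ i) = (1 - z ^ n) / (1 - z)"
    using assms(2) by (simp add: sum_gp_strict)
  moreover have "norm (1 - z ^ n) \<le> 2"
    using norm_triangle_ineq4[of 1 "z ^ n"] assms(1) by (simp add: norm_power)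
  ultimately show ?thesis by (simp add: norm_divide divide_right_mono)
qed

lemma cis_ne_1:
  assumes "0 < x" "x < 2 * pi"
  shows "cis x \<noteq> 1"
proof
  assume "cis x = 1"
  then have "cos x = 1" by (simp add: complex_eq_iff)
  then obtain n :: int where n: "x = of_int n * 2 * pi" unfolding cos_one_2pi_int by blast
  then have "0 < of_int n * (2 * pi)" "of_int n * (2 * pi) < 1 * (2 * pi)" using assms by simp_all
  then have "0 < (of_int n :: real)" "of_int n < (1 :: real)"
    by (simp_all add: zero_less_mult_iff)
  then show False by simp
qed

text \<open>A weak Riemann-Lebesgue lemma: away from multiples of 2 pi the geometric sums stay
  bounded, so the averaged exponentials tend to 0 almost everywhere, and they never exceed 1. The
  sign \<open>\<sigma>\<close> selects the direction of the walk.\<close>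

lemma fcoef_average_tendsto_0:
  assumes g: "integrable circ g" and \<sigma>: "\<sigma> \<in> {1, -1}"
  shows "(\<lambda>n. (\<Sum>i<n. fcoef g (N + \<sigma> * int i)) / of_nat n) \<longlonglongrightarrow> 0"
proof -
  define K where "K = (\<lambda>n x. cis (- (of_int N * x)) * (\<Sum>i<n. cis (- (of_int \<sigma> * x)) ^ i) / of_nat n)"
  have K_le: "norm (K n x) \<le> 1" for n x
  proof -
    have "norm (\<Sum>i<n. cis (- (of_int \<sigma> * x)) ^ i) \<le> (\<Sum>i<n. 1)"
      by (rule sum_norm_le) (simp add: norm_power)
    then show ?thesis by (simp add: K_def norm_mult norm_divide divide_le_eq_1) auto
  qed
  have K_meas: "K n \<in> borel_measurable circ" for n
    unfolding K_def divide_inverse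
    by (intro continuous_measurable_circ continuous_intros)
  have eq: "(\<Sum>i<n. fcoef g (N + \<sigma> * int i)) / of_nat n = (LINT x|circ. g x * K n x) / (2 * pi)" for n
  proof -
    have "g x * K n x = (\<Sum>i<n. g x * cis (- (of_int (N + \<sigma> * int i) * x))) / of_nat n" for x
    proof -
      have "cis (- (of_int N * x)) * cis (- (of_int \<sigma> * x)) ^ i = cis (- (of_int (N + \<sigma> * int i) * x))" for i
        by (simp add: Complex.DeMoivre cis_mult algebra_simps)
      then show ?thesis
        unfolding K_def by (simp only: sum_distrib_left times_divide_eq_right)
    qed
    then have "(LINT x|circ. g x * K n x) = (\<Sum>i<n. LINT x|circ. g x * cis (- (of_int (N + \<sigma> * int i) * x))) / of_nat n"
      by (simp only: integral_divide_zero, subst Bochner_Integration.integral_sum)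
        (rule integrable_circ_cis[OF g], simp)
    then show ?thesis by (simp add: fcoef_def flip: sum_divide_distrib)
  qed
  have "(\<lambda>n. LINT x|circ. g x * K n x) \<longlonglongrightarrow> (LINT x|circ. 0)"
  proof (rule integral_dominated_convergence)
    show "integrable circ (\<lambda>x. norm (g x))" using g by simp
    show "(\<lambda>x. g x * K n x) \<in> borel_measurable circ" for n
      by (intro borel_measurable_times borel_measurable_integrable[OF g] K_meas)
    show "AE x in circ. norm (g x * K n x) \<le> norm (g x)" for n
      using K_le by (intro AE_I2) (simp add: norm_mult mult_left_le)
    show "AE x in circ. (\<lambda>n. g x * K n x) \<longlonglongrightarrow> 0"
    proof (rule AE_circ_interior, rule AE_I2, rule impI)
      fix x assume x: "0 < x \<and> x < 2 * pi"
      let ?z = "cis (- (of_int \<sigma> * x))"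
      have z: "?z \<noteq> 1"
        using \<sigma> cis_ne_1[of x] x by (auto simp flip: cis_cnj)
      have "(\<lambda>n. K n x) \<longlonglongrightarrow> 0"
      proof (rule Lim_null_comparison)
        have "norm (K n x) \<le> 2 / norm (1 - ?z) * (1 / real n)" for n
          using divide_right_mono[OF geometric_cis_bound[of ?z n], of "real n"] z
          by (simp add: K_def norm_mult norm_divide)
        then show "\<forall>\<^sub>F n in sequentially. norm (K n x) \<le> 2 / norm (1 - ?z) * (1 / real n)"
          by (rule always_eventually[rule_format])
        show "(\<lambda>n. 2 / norm (1 - ?z) * (1 / real n)) \<longlonglongrightarrow> 0"
          by (intro tendsto_mult_right_zero lim_1_over_n)
      qed
      then show "(\<lambda>n. g x * K n x) \<longlonglongrightarrow> 0" by (rule tendsto_mult_right_zero)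
    qed
  qed simp
  then have "(\<lambda>n. (LINT x|circ. g x * K n x) / of_real (2 * pi)) \<longlonglongrightarrow> 0"
    by (intro tendsto_divide_zero) simp
  then show ?thesis by (simp only: eq)
qed

text \<open>Averages of consecutive coefficients tend to 0, so a coefficient is bounded by the variation
  of the coefficients beyond it.\<close>

lemma fcoef_le_variation:
  assumes g: "integrable circ g" and \<sigma>: "\<sigma> \<in> {1, -1}"
    and var: "\<And>n. (\<Sum>i<n. norm (fcoef g (N + \<sigma> * int i) - fcoef g (N + \<sigma> * int (Suc i)))) \<le> E"
  shows "norm (fcoef g N) \<le> E"
proof -
  let ?\<theta> = "\<lambda>i. fcoef g (N + \<sigma> * int i)"
  have diff: "norm (?\<theta> 0 - ?\<theta> i) \<le> E" for i
  proof -
    have "?\<theta> 0 - ?\<theta> i = (\<Sum>j<i. ?\<theta> j - ?\<theta> (Suc j))"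
      by (rule sum_lessThan_telescope'[symmetric])
    then show ?thesis using var[of i] norm_sum[of "\<lambda>j. ?\<theta> j - ?\<theta> (Suc j)" "{..<i}"] by simp
  qed
  have le: "norm (?\<theta> 0 - (\<Sum>i<n. ?\<theta> i) / of_nat n) \<le> E" if "0 < n" for n
  proof -
    have "?\<theta> 0 - (\<Sum>i<n. ?\<theta> i) / of_nat n = (\<Sum>i<n. ?\<theta> 0 - ?\<theta> i) / of_nat n"
      using that by (simp add: sum_subtractf field_simps)
    also have "norm \<dots> \<le> (\<Sum>i<n. E) / real n"
      unfolding norm_divide norm_of_nat
      by (intro divide_right_mono sum_norm_le diff) simp
    also have "\<dots> = E" using that by simp
    finally show ?thesis .
  qed
  have "(\<lambda>n. norm (?\<theta> 0 - (\<Sum>i<n. ?\<theta> i) / of_nat n)) \<longlonglongrightarrow> norm (?\<theta> 0 - 0)"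
    by (intro tendsto_intros fcoef_average_tendsto_0 g \<sigma>)
  then have "norm (?\<theta> 0 - 0) \<le> E"
    by (rule LIMSEQ_le_const2) (use le in \<open>auto intro!: exI[of _ 1]\<close>)
  then show ?thesis by simp
qed

lemma abel_summation:
  fixes c a :: "nat \<Rightarrow> 'a::comm_ring"
  shows "(\<Sum>k<Suc m. c k * a k)
    = (\<Sum>k<m. (c k - c (Suc k)) * (\<Sum>j<Suc k. a j)) + c m * (\<Sum>j<Suc m. a j)"
  by (induction m) (simp_all add: algebra_simps)

text \<open>Only initial partial sums of \<open>a\<close> are bounded, not its terms in absolute
  value; the price is the boundary value \<open>c m\<close>.\<close>

lemma abel_summation_bound:
  fixes c a :: "nat \<Rightarrow> complex"
  assumes K: "\<And>j. norm (\<Sum>k<j. a k) \<le> K"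
  shows "norm (\<Sum>k<Suc m. c k * a k) \<le> ((\<Sum>k<m. norm (c k - c (Suc k))) + norm (c m)) * K"
proof -
  have "norm (\<Sum>k<Suc m. c k * a k)
    \<le> norm (\<Sum>k<m. (c k - c (Suc k)) * (\<Sum>j<Suc k. a j)) + norm (c m * (\<Sum>j<Suc m. a j))"
    unfolding abel_summation by (rule norm_triangle_ineq)
  also have "\<dots> \<le> (\<Sum>k<m. norm (c k - c (Suc k)) * K) + norm (c m) * K"
    unfolding norm_mult[of "c m"]
    by (intro add_mono sum_norm_le mult_left_mono K) (simp_all add: norm_mult mult_left_mono K del: sum.lessThan_Suc)
  finally show ?thesis by (simp add: distrib_right sum_distrib_right)
qed

text \<open>Carries a bound on a possibly infinite sum over to finite real sums along an injective
  enumeration, without a summability condition.\<close>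

lemma ennreal_sum_le_infsum:
  fixes u :: "'a \<Rightarrow> real"
  assumes "\<And>k. 0 \<le> u k" "finite I" "inj_on h I" "h ` I \<subseteq> S"
  shows "ennreal (\<Sum>i\<in>I. u (h i)) \<le> (\<Sum>\<^sub>\<infinity>k\<in>S. ennreal (u k))"
proof -
  have "ennreal (\<Sum>i\<in>I. u (h i)) = (\<Sum>k\<in>h ` I. ennreal (u k))"
    using assms(1,3) by (simp add: sum.reindex)
  also have "\<dots> \<le> (\<Sum>\<^sub>\<infinity>k\<in>S. ennreal (u k))"
    by (subst nonneg_infsum_complete) (use assms(2,4) in \<open>auto intro!: SUP_upper\<close>)
  finally show ?thesis .
qed

section \<open>Blocks of length 2m+1 and centred residues\<close>

lemma centred_residue_eqI:
  assumes "j \<in> {- int m..int m}" "(2 * int m + 1) dvd (k - j)"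
  shows "centred_residue m k = j"
  unfolding centred_residue_def
proof (rule the_equality)
  fix i assume i: "i \<in> {- int m..int m} \<and> (2 * int m + 1) dvd (k - i)"
  then have "(2 * int m + 1) dvd (k - j) - (k - i)" using assms(2) by (blast intro: dvd_diff)
  then have "(2 * int m + 1) dvd (i - j)" by simp
  moreover have "\<bar>i - j\<bar> < 2 * int m + 1" using i assms(1) by auto
  ultimately show "i = j" using dvd_imp_le_int[of "i - j" "2 * int m + 1"] by auto
qed (use assms in auto)

text \<open>Within a block the residues increase by 1, so that sums of coefficients at residues are
  again sums over windows.\<close>

lemma centred_residue_block:
  assumes "i < 2 * m + 1"
  shows "centred_residue m (r * (2 * int m + 1) - int m + int i) = int i - int m"
  by (rule centred_residue_eqI) (use assms in auto)

lemma centred_residue_props: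
  shows "centred_residue m k \<in> {- int m..int m}" "(2 * int m + 1) dvd (k - centred_residue m k)"
proof -
  define j where "j = (k + int m) mod (2 * int m + 1) - int m"
  have "j \<in> {- int m..int m}"
    using pos_mod_bound[of "2 * int m + 1" "k + int m"] pos_mod_sign[of "2 * int m + 1" "k + int m"]
    by (auto simp: j_def)
  moreover have "k - j = (2 * int m + 1) * ((k + int m) div (2 * int m + 1))"
    unfolding j_def using mult_div_mod_eq[of "2 * int m + 1" "k + int m"] by linarith
  then have "(2 * int m + 1) dvd (k - j)" by simp
  ultimately show "centred_residue m k \<in> {- int m..int m}" "(2 * int m + 1) dvd (k - centred_residue m k)"
    using centred_residue_eqI by auto
qed

text \<open>Division of k + m by n with remainder is the bijection; the omitted block r = 0 is
  exactly the range -m..m.\<close>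

lemma sum_over_blocks:
  fixes f :: "int \<Rightarrow> 'a::comm_monoid_add" and m R :: nat
  defines "n \<equiv> 2 * int m + 1"
  shows "(\<Sum>k\<in>{- (int R * n + int m)..int R * n + int m} - {- int m..int m}. f k)
    = (\<Sum>r\<in>{- int R..int R} - {0}. \<Sum>i<Suc (2 * m). f (r * n - int m + int i))"
proof -
  have "(\<Sum>r\<in>{- int R..int R} - {0}. \<Sum>i<Suc (2 * m). f (r * n - int m + int i))
    = (\<Sum>(r, i)\<in>({- int R..int R} - {0}) \<times> {..<Suc (2 * m)}. f (r * n - int m + int i))"
    by (rule sum.cartesian_product)
  also have "\<dots> = (\<Sum>k\<in>{- (int R * n + int m)..int R * n + int m} - {- int m..int m}. f k)"
  proof (rule sum.reindex_bij_witness[where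
        j = "\<lambda>(r, i). r * n - int m + int i" and i = "\<lambda>k. ((k + int m) div n, nat ((k + int m) mod n))"])
    fix ri assume ri: "ri \<in> ({- int R..int R} - {0}) \<times> {..<Suc (2 * m)}"
    obtain r i where [simp]: "ri = (r, i)" by (cases ri)
    have r: "- int R \<le> r" "r \<le> int R" "r \<noteq> 0" and i: "int i < n" using ri by (auto simp: n_def)
    have "(r * n + int i) div n = r" "(r * n + int i) mod n = int i" using i by auto
    then show "((\<lambda>k. ((k + int m) div n, nat ((k + int m) mod n))) ((\<lambda>(r, i). r * n - int m + int i) ri)) = ri"
      by simp
    have "- int R * n \<le> r * n" "r * n \<le> int R * n"
      using r by (auto intro!: mult_right_mono simp: n_def simp del: mult_minus_left)
    moreover have "r * n \<ge> n \<or> r * n \<le> - n"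
    proof (cases "r > 0")
      case True
      then have "1 * n \<le> r * n" by (intro mult_right_mono) (auto simp: n_def)
      then show ?thesis by simp
    next
      case False
      then have "r * n \<le> (-1) * n" using r by (intro mult_right_mono) (auto simp: n_def)
      then show ?thesis by simp
    qed
    moreover have "x - int m + int i \<in> {- (b + int m)..b + int m} - {- int m..int m}"
      if "- b \<le> x" "x \<le> b" "n \<le> x \<or> x \<le> - n" for x b
      using that i by (auto simp: n_def)
    ultimately show "(\<lambda>(r, i). r * n - int m + int i) ri \<in> {- (int R * n + int m)..int R * n + int m} - {- int m..int m}"
      unfolding \<open>ri = (r, i)\<close> case_prod_conv by (metis mult_minus_left)
  next
    fix k assume k: "k \<in> {- (int R * n + int m)..int R * n + int m} - {- int m..int m}"
    define r where "r = (k + int m) div n"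
    define i where "i = (k + int m) mod n"
    have npos: "0 < n" by (simp add: n_def)
    have i: "0 \<le> i" "i < n" using npos by (auto simp: i_def)
    have k_eq: "k = r * n - int m + i"
      using div_mult_mod_eq[of "k + int m" n] unfolding r_def i_def by linarith
    show "(\<lambda>(r, i). r * n - int m + int i) ((\<lambda>k. ((k + int m) div n, nat ((k + int m) mod n))) k) = k"
      using i by (simp add: i_def[symmetric] r_def[symmetric] k_eq)
    have "r \<noteq> 0" using k i by (auto simp: k_eq n_def)
    moreover have "r * n < (int R + 1) * n" using k i by (auto simp: k_eq n_def algebra_simps)
    then have "r < int R + 1" using npos by (simp add: mult_less_cancel_right)
    moreover have "(- int R - 1) * n < r * n" using k i by (auto simp: k_eq n_def algebra_simps)
    then have "- int R - 1 < r" using npos by (simp only: mult_less_cancel_right)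
    ultimately show "(\<lambda>k. ((k + int m) div n, nat ((k + int m) mod n))) k \<in> ({- int R..int R} - {0}) \<times> {..<Suc (2 * m)}"
      using i by (simp add: i_def[symmetric] r_def[symmetric]) (auto simp: n_def)
  qed auto
  finally show ?thesis ..
qed

text \<open>Discrete orthogonality: a geometric sum of a (2m+1)-th root of unity, which is 1 exactly
  when 2m+1 divides d.\<close>

lemma sum_roots_of_unity:
  fixes d :: int
  shows "(\<Sum>l = 0..2 * m. cis (of_int d * (mesh m * real l)))
    = (if (2 * int m + 1) dvd d then of_nat (2 * m + 1) else 0)"
proof -
  define z where "z = cis (2 * pi * of_int d / (2 * real m + 1))"
  have z: "cis (of_int d * (mesh m * real l)) = z ^ l" for l
    by (simp add: z_def mesh_def Complex.DeMoivre mult_ac)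
  have zn: "z ^ (2 * m + 1) = 1"
  proof -
    have "z ^ (2 * m + 1) = cis (2 * pi * of_int d)"
      unfolding z_def Complex.DeMoivre by (rule arg_cong[of _ _ cis]) (simp add: field_simps)
    also have "\<dots> = 1" by (rule cis_multiple_2pi) simp
    finally show ?thesis .
  qed
  have "(\<Sum>l = 0..2 * m. cis (of_int d * (mesh m * real l))) = (\<Sum>l<2 * m + 1. z ^ l)"
    unfolding z by (intro sum.cong) auto
  also have "\<dots> = (if (2 * int m + 1) dvd d then of_nat (2 * m + 1) else 0)"
  proof (cases "(2 * int m + 1) dvd d")
    case True
    then obtain e where e: "d = (2 * int m + 1) * e" by (auto elim: dvdE)
    have "2 * pi * of_int d / (2 * real m + 1) = 2 * pi * of_int e"
      using e by (simp add: field_simps)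
    then have "z = 1" unfolding z_def by (simp add: cis_multiple_2pi)
    then show ?thesis using True by simp
  next
    case False
    have "z \<noteq> 1"
    proof
      assume "z = 1"
      then have "cos (2 * pi * of_int d / (2 * real m + 1)) = 1" by (simp add: z_def complex_eq_iff)
      then obtain e :: int where "2 * pi * of_int d / (2 * real m + 1) = of_int e * 2 * pi"
        unfolding cos_one_2pi_int by blast
      then have "2 * pi * (of_int d / (2 * real m + 1)) = 2 * pi * of_int e" by simp
      then have "of_int d / (2 * real m + 1) = of_int e" by (simp only: mult_cancel_left) simp
      then have "of_int d = (2 * real m + 1) * of_int e" by (simp add: field_simps)
      then have "real_of_int d = of_int ((2 * int m + 1) * e)" by simp
      then have "d = (2 * int m + 1) * e" by (simp only: of_int_eq_iff)
      then show False using False by simp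
    qed
    then show ?thesis using False zn by (simp only: sum_gp_strict) simp
  qed
  finally show ?thesis .
qed

section \<open>The approximation operator\<close>

lemma block_index_gt:
  fixes r :: int
  assumes "r \<noteq> 0" "i < 2 * m + 1"
  shows "int m < \<bar>r * (2 * int m + 1) - int m + int i\<bar>"
proof -
  let ?n = "2 * int m + 1"
  have "?n \<le> r * ?n \<or> r * ?n \<le> - ?n"
  proof (cases "r > 0")
    case True
    then have "1 * ?n \<le> r * ?n" by (intro mult_right_mono) auto
    then show ?thesis by simp
  next
    case False
    then have "r * ?n \<le> (-1) * ?n" using assms(1) by (intro mult_right_mono) auto
    then show ?thesis by simp
  qed
  moreover have "int m < \<bar>x - int m + int i\<bar>" if "?n \<le> x \<or> x \<le> - ?n" for x
    using that assms(2) by auto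
  ultimately show ?thesis by blast
qed

lemma block_index_inj:
  "inj_on (\<lambda>(r, i). r * (2 * int m + 1) - int m + int i) (UNIV \<times> {..<2 * m + 1})"
proof (rule inj_onI)
  fix x y :: "int \<times> nat"
  assume *: "x \<in> UNIV \<times> {..<2 * m + 1}" "y \<in> UNIV \<times> {..<2 * m + 1}"
    "(case x of (r, i) \<Rightarrow> r * (2 * int m + 1) - int m + int i)
      = (case y of (r, i) \<Rightarrow> r * (2 * int m + 1) - int m + int i)"
  obtain r i r' i' where [simp]: "x = (r, i)" "y = (r', i')" by (cases x, cases y)
  have "int i = centred_residue m (r * (2 * int m + 1) - int m + int i) + int m"
    using * by (subst centred_residue_block) auto
  also have "r * (2 * int m + 1) - int m + int i = r' * (2 * int m + 1) - int m + int i'"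
    using *(3) by simp
  also have "centred_residue m \<dots> + int m = int i'"
    using * by (subst centred_residue_block) auto
  finally have "i = i'" by simp
  then have "r * (2 * int m + 1) = r' * (2 * int m + 1)" using *(3) by simp
  moreover have "2 * int m + 1 \<noteq> 0" by presburger
  ultimately have "r = r'" by (simp only: mult_cancel_right) simp
  then show "x = y" using \<open>i = i'\<close> by simp
qed

text \<open>Summation by parts: on each of the two tails \<open>|k| > m\<close> for \<open>\<theta>\<close>, and on each block of length
  \<open>2 m + 1\<close> for \<open>\<gamma>\<close>, where \<open>centred_residue m\<close> runs through consecutive integers.\<close>

lemma residual_sum_bound:
  fixes \<theta> \<gamma> G W :: "int \<Rightarrow> complex" and m R :: nat
  assumes K: "\<And>a n s. norm (\<Sum>i<n. G (a + int i) * W (a + int i + s)) \<le> K" and e: "0 \<le> e"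
    and \<theta>_var: "(\<Sum>\<^sub>\<infinity>k\<in>{k. \<bar>k\<bar> > int m}. ennreal (norm (fdiff \<theta> k))) \<le> ennreal e"
    and \<theta>_le: "\<And>k. \<bar>k\<bar> > int m \<Longrightarrow> norm (\<theta> k) \<le> e"
    and \<gamma>_var: "(\<Sum>\<^sub>\<infinity>k\<in>{k. \<bar>k\<bar> > int m}. ennreal (norm (fdiff \<gamma> k)))
      + (\<Sum>\<^sub>\<infinity>k\<in>UNIV. ennreal (norm (\<gamma> (k * (2 * int m + 1) + int m)))) \<le> ennreal e"
  defines "L \<equiv> int R * (2 * int m + 1) + int m"
  shows "norm (\<Sum>k\<in>{-L..L} - {- int m..int m}. (\<theta> k * G k - \<gamma> k * G (centred_residue m k)) * W k)
    \<le> 5 * (e * K)"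
proof -
  define n where "n = 2 * int m + 1"
  have K0: "0 \<le> K" using K[where n = 0] by simp
  have var_sum: "(\<Sum>i<M. norm (fdiff \<theta> (h i))) \<le> e"
    if "inj h" "\<And>i. \<bar>h i\<bar> > int m" for h :: "nat \<Rightarrow> int" and M
  proof -
    have "ennreal (\<Sum>i<M. norm (fdiff \<theta> (h i))) \<le> (\<Sum>\<^sub>\<infinity>k\<in>{k. \<bar>k\<bar> > int m}. ennreal (norm (fdiff \<theta> k)))"
      by (rule ennreal_sum_le_infsum) (use that in \<open>auto intro: inj_on_subset\<close>)
    also note \<theta>_var
    finally show ?thesis using e by simp
  qed
  \<comment> \<open>On one tail: variation at most e plus a boundary value at most e. The separate
    map \<open>h'\<close> is there because \<open>fdiff\<close> is attached to the smaller of two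
    neighbours, which on the left tail is the one reached later.\<close>
  have tail: "norm (\<Sum>i<N. \<theta> (h i) * (G (h i) * W (h i))) \<le> 2 * (e * K)"
    if h: "inj h'" "\<And>i. \<bar>h' i\<bar> > int m" "\<And>i. \<bar>h i\<bar> > int m"
      "\<And>i. norm (\<theta> (h i) - \<theta> (h (Suc i))) = norm (fdiff \<theta> (h' i))"
      "\<And>j. norm (\<Sum>i<j. G (h i) * W (h i)) \<le> K" for h h' :: "nat \<Rightarrow> int" and N
  proof (cases N)
    case (Suc M)
    have "norm (\<Sum>i<Suc M. \<theta> (h i) * (G (h i) * W (h i)))
      \<le> ((\<Sum>i<M. norm (\<theta> (h i) - \<theta> (h (Suc i)))) + norm (\<theta> (h M))) * K"
      by (rule abel_summation_bound[where c = "\<lambda>i. \<theta> (h i)" and a = "\<lambda>i. G (h i) * W (h i)"]) (rule h(5))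
    also have "\<dots> \<le> (e + e) * K"
      unfolding h(4) by (intro mult_right_mono add_mono var_sum \<theta>_le h K0)
    finally show ?thesis using Suc by (simp add: algebra_simps)
  qed (use K0 e in simp)
  define N where "N = nat (int R * n)"
  have N: "int N = int R * n" by (simp add: N_def n_def)
  have L: "L = int N + int m" by (simp add: L_def N n_def)
  let ?A = "{-L..L} - {- int m..int m}"
  have A_split: "?A = {int m + 1..int m + int N} \<union> {- (int m + int N)..- (int m + 1)}"
    by (auto simp: L)
  have sum_split: "(\<Sum>k\<in>?A. F k) = (\<Sum>i<N. F (int m + 1 + int i)) + (\<Sum>i<N. F (- (int m + 1) - int i))"
    for F :: "int \<Rightarrow> complex"
  proof -
    have "(\<Sum>k\<in>?A. F k) = (\<Sum>k = int m + 1..int m + int N. F k) + (\<Sum>k = - (int m + int N)..- (int m + 1). F k)"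
      unfolding A_split by (rule sum.union_disjoint) auto
    also have "(\<Sum>k = int m + 1..int m + int N. F k) = (\<Sum>i<N. F (int m + 1 + int i))"
      by (rule sum.reindex_bij_witness[where i = "\<lambda>i. int m + 1 + int i" and j = "\<lambda>k. nat (k - int m - 1)"]) auto
    also have "(\<Sum>k = - (int m + int N)..- (int m + 1). F k) = (\<Sum>i<N. F (- (int m + 1) - int i))"
      by (rule sum.reindex_bij_witness[where i = "\<lambda>i. - (int m + 1) - int i" and j = "\<lambda>k. nat (- k - int m - 1)"]) auto
    finally show ?thesis .
  qed
  have \<theta>1: "norm (\<Sum>i<N. \<theta> (int m + 1 + int i) * (G (int m + 1 + int i) * W (int m + 1 + int i))) \<le> 2 * (e * K)"
  proof (rule tail[where h' = "\<lambda>i. int m + 1 + int i"])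
    show "norm (\<Sum>i<j. G (int m + 1 + int i) * W (int m + 1 + int i)) \<le> K" for j
      using K[of "int m + 1" 0 j] by simp
  qed (auto simp: inj_def fdiff_def add_ac)
  have \<theta>2: "norm (\<Sum>i<N. \<theta> (- (int m + 1) - int i) * (G (- (int m + 1) - int i) * W (- (int m + 1) - int i))) \<le> 2 * (e * K)"
  proof (rule tail[where h' = "\<lambda>i. - (int m + 1) - int (Suc i)"])
    fix j
    \<comment> \<open>Read from left to right, an initial sum of the left tail is a window starting
      at -(m + j).\<close>
    have "(\<Sum>i<j. G (- (int m + 1) - int i) * W (- (int m + 1) - int i))
      = (\<Sum>i<j. G (- (int m + 1) - int (j - Suc i)) * W (- (int m + 1) - int (j - Suc i)))"
      by (rule sum.nat_diff_reindex[symmetric])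
    also have "\<dots> = (\<Sum>i<j. G (- (int m + int j) + int i) * W (- (int m + int j) + int i + 0))"
    proof (rule sum.cong)
      fix i assume "i \<in> {..<j}"
      then have "- (int m + 1) - int (j - Suc i) = - (int m + int j) + int i" by auto
      then show "G (- (int m + 1) - int (j - Suc i)) * W (- (int m + 1) - int (j - Suc i))
        = G (- (int m + int j) + int i) * W (- (int m + int j) + int i + 0)"
        by (simp only: add_0_right)
    qed simp
    also have "norm \<dots> \<le> K" by (rule K)
    finally show "norm (\<Sum>i<j. G (- (int m + 1) - int i) * W (- (int m + 1) - int i)) \<le> K" .
  next
    fix i
    have "- (int m + 1) - int (Suc i) + 1 = - (int m + 1) - int i" by simp
    then show "norm (\<theta> (- (int m + 1) - int i) - \<theta> (- (int m + 1) - int (Suc i)))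
      = norm (fdiff \<theta> (- (int m + 1) - int (Suc i)))"
      unfolding fdiff_def by (simp only: norm_minus_commute)
  qed (auto simp: inj_def)
  have \<gamma>: "norm (\<Sum>k\<in>?A. \<gamma> k * (G (centred_residue m k) * W k)) \<le> e * K"
  proof -
    let ?I = "{- int R..int R} - {0}"
    \<comment> \<open>Differences occur only for i < 2m, so none straddles a block edge, where the
      residue jumps from m to -m. The last index of block r is r n + m, where the second sum of the
      hypothesis evaluates \<open>\<gamma>\<close>.\<close>
    define k where "k = (\<lambda>r i. r * n - int m + int i)"
    have "(\<Sum>k\<in>?A. \<gamma> k * (G (centred_residue m k) * W k))
      = (\<Sum>r\<in>?I. \<Sum>i<Suc (2 * m). \<gamma> (k r i) * (G (centred_residue m (k r i)) * W (k r i)))"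
      unfolding L_def k_def n_def by (rule sum_over_blocks)
    \<comment> \<open>The index of \<open>W\<close> is that of \<open>G\<close> shifted by r n,
      which is why the bound \<open>K\<close> allows a shift s.\<close>
    also have "\<dots> = (\<Sum>r\<in>?I. \<Sum>i<Suc (2 * m). \<gamma> (k r i) * (G (- int m + int i) * W (- int m + int i + r * n)))"
    proof (intro sum.cong refl)
      fix r i assume "i \<in> {..<Suc (2 * m)}"
      then have 1: "centred_residue m (k r i) = - int m + int i"
        unfolding k_def n_def by (subst centred_residue_block) auto
      have 2: "k r i = - int m + int i + r * n" by (simp add: k_def)
      show "\<gamma> (k r i) * (G (centred_residue m (k r i)) * W (k r i))
        = \<gamma> (k r i) * (G (- int m + int i) * W (- int m + int i + r * n))"
        unfolding 1 by (simp only: 2)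
    qed
    also have "norm \<dots> \<le> (\<Sum>r\<in>?I. ((\<Sum>i<2 * m. norm (\<gamma> (k r i) - \<gamma> (k r (Suc i)))) + norm (\<gamma> (k r (2 * m)))) * K)"
      by (intro sum_norm_le abel_summation_bound[where a = "\<lambda>i. G (- int m + int i) * W (- int m + int i + r * n)" for r] K)
    also have "\<dots> = ((\<Sum>r\<in>?I. \<Sum>i<2 * m. norm (\<gamma> (k r i) - \<gamma> (k r (Suc i)))) + (\<Sum>r\<in>?I. norm (\<gamma> (k r (2 * m))))) * K"
      by (simp add: sum.distrib flip: sum_distrib_right)
    also have "\<dots> \<le> e * K"
    proof (rule mult_right_mono[OF _ K0])
      let ?X = "\<Sum>r\<in>?I. \<Sum>i<2 * m. norm (\<gamma> (k r i) - \<gamma> (k r (Suc i)))"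
      let ?Y = "\<Sum>r\<in>?I. norm (\<gamma> (k r (2 * m)))"
      have "?X = (\<Sum>ri\<in>?I \<times> {..<2 * m}. norm (fdiff \<gamma> ((\<lambda>(r, i). r * (2 * int m + 1) - int m + int i) ri)))"
        by (subst sum.cartesian_product) (auto intro!: sum.cong simp: k_def n_def fdiff_def add_ac)
      also have "ennreal \<dots> \<le> (\<Sum>\<^sub>\<infinity>k\<in>{k. \<bar>k\<bar> > int m}. ennreal (norm (fdiff \<gamma> k)))"
      proof (rule ennreal_sum_le_infsum)
        show "inj_on (\<lambda>(r, i). r * (2 * int m + 1) - int m + int i) (?I \<times> {..<2 * m})"
          by (rule inj_on_subset[OF block_index_inj]) auto
        show "(\<lambda>(r, i). r * (2 * int m + 1) - int m + int i) ` (?I \<times> {..<2 * m}) \<subseteq> {k. \<bar>k\<bar> > int m}"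
          using block_index_gt by fastforce
      qed auto
      finally have X: "ennreal ?X \<le> (\<Sum>\<^sub>\<infinity>k\<in>{k. \<bar>k\<bar> > int m}. ennreal (norm (fdiff \<gamma> k)))" .
      have "k r (2 * m) = r * (2 * int m + 1) + int m" for r by (simp add: k_def n_def)
      then have "ennreal ?Y \<le> (\<Sum>\<^sub>\<infinity>k\<in>UNIV. ennreal (norm (\<gamma> (k * (2 * int m + 1) + int m))))"
        using ennreal_sum_le_infsum[of "\<lambda>k. norm (\<gamma> (k * (2 * int m + 1) + int m))" ?I id UNIV] by simp
      with X have "ennreal ?X + ennreal ?Y \<le> ennreal e"
        using \<gamma>_var by (meson add_mono order_trans)
      then show "?X + ?Y \<le> e"
        using e by (simp add: sum_nonneg flip: ennreal_plus)
    qed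
    finally show ?thesis .
  qed
  have "(\<Sum>k\<in>?A. (\<theta> k * G k - \<gamma> k * G (centred_residue m k)) * W k)
    = (\<Sum>k\<in>?A. \<theta> k * (G k * W k)) - (\<Sum>k\<in>?A. \<gamma> k * (G (centred_residue m k) * W k))"
    by (simp add: left_diff_distrib mult.assoc sum_subtractf)
  also have "norm \<dots> \<le> norm (\<Sum>k\<in>?A. \<theta> k * (G k * W k)) + norm (\<Sum>k\<in>?A. \<gamma> k * (G (centred_residue m k) * W k))"
    by (rule norm_triangle_ineq4)
  \<comment> \<open>Two units from each tail of \<open>\<theta>\<close> and one from all blocks of
    \<open>\<gamma>\<close> together make the constant 5.\<close>
  also have "\<dots> \<le> (2 * (e * K) + 2 * (e * K)) + e * K"
    unfolding sum_split[of "\<lambda>k. \<theta> k * (G k * W k)"]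
    by (intro add_mono \<gamma> order_trans[OF norm_triangle_ineq] \<theta>1 \<theta>2)
  finally show ?thesis by (simp add: mult.commute)
qed

text \<open>\<open>H_kernel\<close> is a finite sum, so the convolution is a trigonometric
  polynomial given at every point s; sampling it on the mesh is therefore meaningful although g is
  an L^p function.\<close>

lemma V_op_eq:
  assumes g: "integrable circ g" "circle_periodic g"
  shows "V_op lam bet m g s
    = (\<Sum>j=-int m..int m. alpha_seq lam bet j * (fcoef (\<lambda>x. of_real (g x)) j * cis (of_int j * s)))"
proof -
  let ?G = "\<lambda>x. complex_of_real (g x)"
  have per: "circle_periodic (\<lambda>y. ?G y * cis (- (of_int j * y)))" for j
    by (intro circle_periodic_mult circle_periodic_of_real g circle_periodic_cis)
  have int: "integrable circ (\<lambda>y. ?G y * cis (- (of_int j * y)))" for j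
    using g by (intro integrable_circ_cis) simp
  have eq: "H_kernel lam bet m y * ?G (s - y)
    = (\<Sum>j=-int m..int m. (alpha_seq lam bet j * cis (of_int j * s)) * (?G (s - y) * cis (- (of_int j * (s - y)))))" for y
  proof -
    have "cis (of_int j * y) = cis (of_int j * s) * cis (- (of_int j * (s - y)))" for j
      by (simp add: cis_mult algebra_simps)
    then show ?thesis
      unfolding H_kernel_def sum_distrib_right by (intro sum.cong refl) (simp add: mult_ac)
  qed
  have "(LINT y|circ. H_kernel lam bet m y * ?G (s - y))
    = (\<Sum>j=-int m..int m. (alpha_seq lam bet j * cis (of_int j * s)) * (LINT y|circ. ?G (s - y) * cis (- (of_int j * (s - y)))))"
    unfolding eq using integrable_circ_diff[OF per int]
    by (subst Bochner_Integration.integral_sum) auto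
  also have "\<dots> = (\<Sum>j=-int m..int m. (alpha_seq lam bet j * cis (of_int j * s)) * (2 * pi * fcoef ?G j))"
    unfolding integral_circ_diff[OF per int] by (simp add: fcoef_def)
  finally show ?thesis
    unfolding V_op_def circle_conv_def set_lebesgue_integral_circ
    by (simp add: scaleR_conv_of_real sum_distrib_left field_simps)
qed

text \<open>Aliasing: on a mesh of 2m+1 points the frequency k cannot be told from its residue in
  -m..m.\<close>

lemma V_op_discrete_coefficient:
  assumes g: "integrable circ g" "circle_periodic g"
  shows "(\<Sum>l=0..2*m. V_op lam bet m g (mesh m * real l) * cis (- (of_int k * (mesh m * real l)))) / of_nat (2 * m + 1)
    = alpha_seq lam bet (centred_residue m k) * fcoef (\<lambda>x. of_real (g x)) (centred_residue m k)"
proof -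
  let ?n = "of_nat (2 * m + 1) :: complex"
  define a where "a = (\<lambda>j. alpha_seq lam bet j * fcoef (\<lambda>x. of_real (g x)) j)"
  have "(\<Sum>l=0..2*m. V_op lam bet m g (mesh m * real l) * cis (- (of_int k * (mesh m * real l))))
    = (\<Sum>l=0..2*m. \<Sum>j=-int m..int m. a j * cis (of_int (j - k) * (mesh m * real l)))"
  proof (rule sum.cong[OF refl])
    fix l
    have "cis (of_int j * (mesh m * real l)) * cis (- (of_int k * (mesh m * real l))) = cis (of_int (j - k) * (mesh m * real l))" for j
      by (simp add: cis_mult algebra_simps)
    then show "V_op lam bet m g (mesh m * real l) * cis (- (of_int k * (mesh m * real l)))
      = (\<Sum>j=-int m..int m. a j * cis (of_int (j - k) * (mesh m * real l)))"
      unfolding V_op_eq[OF g] a_def sum_distrib_right by (simp only: mult.assoc)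
  qed
  also have "\<dots> = (\<Sum>j=-int m..int m. \<Sum>l=0..2*m. a j * cis (of_int (j - k) * (mesh m * real l)))"
    by (rule sum.swap)
  also have "\<dots> = (\<Sum>j=-int m..int m. if j = centred_residue m k then a (centred_residue m k) * ?n else 0)"
  proof (rule sum.cong[OF refl])
    fix j assume j: "j \<in> {-int m..int m}"
    have "(2 * int m + 1) dvd (j - k) \<longleftrightarrow> j = centred_residue m k"
      using centred_residue_eqI[OF j, of k] centred_residue_props(2)[of m k] by (metis dvd_diff_commute)
    then show "(\<Sum>l=0..2*m. a j * cis (of_int (j - k) * (mesh m * real l)))
      = (if j = centred_residue m k then a (centred_residue m k) * ?n else 0)"
      unfolding sum_distrib_left[symmetric] sum_roots_of_unity by auto
  qed
  also have "\<dots> = a (centred_residue m k) * ?n"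
    using centred_residue_props(1)[of m k] by (subst sum.delta) auto
  finally show ?thesis
    by (simp only: a_def nonzero_mult_div_cancel_right of_nat_eq_0_iff)
qed

section \<open>Passing between \<open>Lp_circle\<close> and \<open>Lpc\<close>; reality of the
  samples\<close>

lemma Lp_circle_Lpc:
  assumes "g \<in> Lp_circle p"
  shows "(\<lambda>x. complex_of_real (g x)) \<in> Lpc p"
proof -
  have "g \<in> borel_measurable circ"
    using assms by (simp add: Lp_circle_def measurable_restrict_space1)
  then show ?thesis
    using assms by (simp add: Lp_circle_def Lpc_def set_integrable_circ)
qed

lemma Lp_circle_integrable:
  assumes "g \<in> Lp_circle p" "1 \<le> p"
  shows "integrable circ g"
  using Lpc_integrable[OF Lp_circle_Lpc[OF assms(1)] assms(2)] by (simp add: complex_of_real_integrable_eq)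

lemma Lp_norm_eq_pnorm: "Lp_norm p f = (2 * pi) powr (- 1 / p) * pnorm p f" for f :: "real \<Rightarrow> complex"
  by (simp add: Lp_norm_def pnorm_def set_lebesgue_integral_circ)

lemma Lp_norm_of_real: "Lp_norm p (\<lambda>x. complex_of_real (f x)) = Lp_norm p f"
  by (simp add: Lp_norm_def)

lemma cnj_fcoef_real: "cnj (fcoef (\<lambda>x. of_real (f x)) k) = fcoef (\<lambda>x. of_real (f x)) (- k)"
proof -
  have "cnj (LINT x|circ. of_real (f x) * cis (- (of_int k * x))) = (LINT x|circ. cnj (of_real (f x) * cis (- (of_int k * x))))"
    by (rule Bochner_Integration.integral_cnj[symmetric])
  then show ?thesis by (simp add: fcoef_def cis_cnj)
qed

lemma Lpc_shift:
  assumes g: "g \<in> Lp_circle p" "1 \<le> p"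
  shows "(\<lambda>x. complex_of_real (g (x - s))) \<in> Lpc p"
proof -
  have per: "circle_periodic g" and int: "integrable circ (\<lambda>x. \<bar>g x\<bar> powr p)"
    using g by (auto simp: Lp_circle_def set_integrable_circ)
  have "(\<lambda>x. g (x - s)) \<in> borel_measurable circ"
    by (rule borel_measurable_integrable[OF integrable_circ_minus[OF per Lp_circle_integrable[OF g]]])
  moreover have "integrable circ (\<lambda>x. \<bar>g (x - s)\<bar> powr p)"
    by (rule integrable_circ_minus[OF _ int]) (use per in \<open>simp add: circle_periodic_def\<close>)
  ultimately show ?thesis by (simp add: Lpc_def)
qed

text \<open>Competing sums of translates must have real coefficients; conjugate symmetry of lam and
  bet passes to their quotient.\<close>

lemma V_op_real:
  assumes g: "integrable circ g" "circle_periodic g"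
    and lam: "\<And>k. lam (- k) = cnj (lam k)" and bet: "\<And>k. bet (- k) = cnj (bet k)"
  shows "V_op lam bet m g s \<in> \<real>"
proof -
  let ?F = "\<lambda>j. alpha_seq lam bet j * (fcoef (\<lambda>x. of_real (g x)) j * cis (of_int j * s))"
  have "cnj (\<Sum>j=-int m..int m. ?F j) = (\<Sum>j=-int m..int m. ?F (- j))"
    unfolding cnj_sum by (intro sum.cong refl) (simp add: cnj_fcoef_real cis_cnj alpha_seq_def lam bet)
  also have "\<dots> = (\<Sum>j=-int m..int m. ?F j)"
    by (rule sum.reindex_bij_witness[where i = uminus and j = uminus]) auto
  finally show ?thesis unfolding V_op_eq[OF g] by (simp add: Reals_cnj_iff)
qed

section \<open>The error of \<open>Q_op\<close>\<close>

context
  fixes p p' :: real and lam bet :: "int \<Rightarrow> complex" and \<phi>lam \<phi>bet :: "real \<Rightarrow> real"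
  assumes p: "1 < p" "1 / p + 1 / p' = 1"
    and lam0: "\<And>k. lam k \<noteq> 0" and bet0: "\<And>k. bet k \<noteq> 0"
    and lam_series: "has_distributional_series \<phi>lam (\<lambda>k. inverse (lam k))"
    and bet_series: "has_distributional_series \<phi>bet (\<lambda>k. inverse (bet k))"
    and lam_Lp: "\<phi>lam \<in> Lp_circle p'" and bet_Lp: "\<phi>bet \<in> Lp_circle p"
begin

lemma p'_gt_1: "1 < p'"
  using conjugate_gt1 p by blast

lemma lam_integrable: "integrable circ \<phi>lam" and bet_integrable: "integrable circ \<phi>bet"
  using Lp_circle_integrable[OF lam_Lp] Lp_circle_integrable[OF bet_Lp] p p'_gt_1 by auto

text \<open>Both functions are real-valued, so their coefficients 1/lam k and 1/bet k are conjugate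
  symmetric.\<close>

lemma lam_bet_cnj: "lam (- k) = cnj (lam k)" "bet (- k) = cnj (bet k)"
  using cnj_fcoef_real[of \<phi>lam k] cnj_fcoef_real[of \<phi>bet k]
  by (simp_all add: fcoef_distributional_series[OF lam_series] fcoef_distributional_series[OF bet_series])

lemma generator:
  assumes "f \<in> Phi_space \<phi>lam p"
  shows "Phi_generator \<phi>lam p f \<in> Lp_circle p"
    "AE x in lebesgue. f x = circle_conv \<phi>lam (Phi_generator \<phi>lam p f) x"
proof -
  have "\<exists>g. conv_generates \<phi>lam p g f" using assms by (simp add: Phi_space_def)
  then have "conv_generates \<phi>lam p (Phi_generator \<phi>lam p f) f"
    unfolding Phi_generator_def by (rule someI_ex)
  then show "Phi_generator \<phi>lam p f \<in> Lp_circle p"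
    "AE x in lebesgue. f x = circle_conv \<phi>lam (Phi_generator \<phi>lam p f) x"
    by (simp_all add: conv_generates_def)
qed

text \<open>The duality argument bounds a norm that is already known to be finite, so membership in
  L^p comes first.\<close>

lemma residual_Lpc:
  assumes f: "f \<in> Phi_space \<phi>lam p"
  shows "(\<lambda>x. of_real (f x) - Q_op lam bet \<phi>lam \<phi>bet p m f x) \<in> Lpc p"
proof -
  define V where "V = V_op lam bet m (Phi_generator \<phi>lam p f)"
  have "(\<lambda>x. \<Sum>l=0..2*m. V (mesh m * real l) * of_real (\<phi>bet (x - mesh m * real l))) \<in> Lpc p"
    by (intro Lpc_sum Lpc_cmult Lpc_shift bet_Lp) (use p in auto)
  then have "(\<lambda>x. (- 1 / of_nat (2 * m + 1)) * (\<Sum>l=0..2*m. V (mesh m * real l) * of_real (\<phi>bet (x - mesh m * real l)))) \<in> Lpc p"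
    by (rule Lpc_cmult) (use p in auto)
  from Lpc_add[OF Lp_circle_Lpc this, of f] f p show ?thesis
    by (simp add: Q_op_def V_def Phi_space_def)
qed

text \<open>Translation by a node s multiplies the coefficient 1/bet k by cis (- k s); the sum over
  the nodes is then the discrete transform of the samples, which sees only the residue of k.\<close>

lemma fcoef_residual:
  assumes f: "f \<in> Phi_space \<phi>lam p"
  defines "G \<equiv> fcoef (\<lambda>x. of_real (Phi_generator \<phi>lam p f x))"
  shows "fcoef (\<lambda>x. of_real (f x) - Q_op lam bet \<phi>lam \<phi>bet p m f x) k
    = inverse (lam k) * G k - gamma_seq lam bet m k * G (centred_residue m k)"
proof -
  let ?g = "Phi_generator \<phi>lam p f"
  note g = generator[OF f]
  have g_int: "integrable circ ?g" using Lp_circle_integrable[OF g(1)] p by simp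
  have g_per: "circle_periodic ?g" using g(1) by (simp add: Lp_circle_def)
  have g_meas: "?g \<in> borel_measurable lebesgue" using g(1) by (simp add: Lp_circle_def)
  have f_Lp: "f \<in> Lp_circle p" using f by (simp add: Phi_space_def)
  have f_int: "integrable circ (\<lambda>x. complex_of_real (f x))"
    using Lp_circle_integrable[OF f_Lp] p by simp
  have bet_per: "circle_periodic (\<lambda>x. complex_of_real (\<phi>bet x))"
    using bet_Lp by (intro circle_periodic_of_real) (simp add: Lp_circle_def)
  have bet_int: "integrable circ (\<lambda>x. complex_of_real (\<phi>bet x))" using bet_integrable by simp
  have fk: "fcoef (\<lambda>x. of_real (f x)) k = inverse (lam k) * G k"
  proof -
    have "AE x in circ. f x = circle_conv \<phi>lam ?g x" by (rule AE_lebesgue_imp_circ[OF g(2)])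
    moreover note m1 = borel_measurable_integrable[OF integrable_circ_cis[OF f_int, of k]]
      and m2 = borel_measurable_integrable[OF integrable_circle_conv_cis[OF lam_integrable g_int g_per g_meas, of k]]
    ultimately have "(LINT x|circ. complex_of_real (f x) * cis (- (of_int k * x)))
      = (LINT x|circ. complex_of_real (circle_conv \<phi>lam ?g x) * cis (- (of_int k * x)))"
      by (intro integral_cong_AE) auto
    then have "fcoef (\<lambda>x. of_real (f x)) k = fcoef (\<lambda>x. of_real (circle_conv \<phi>lam ?g x)) k"
      by (simp only: fcoef_def)
    also have "\<dots> = inverse (lam k) * G k"
      unfolding G_def fcoef_circle_conv[OF lam_integrable g_int g_per g_meas]
        fcoef_distributional_series[OF lam_series] ..
    finally show ?thesis .
  qed
  define V where "V = V_op lam bet m ?g"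
  let ?s = "\<lambda>l. mesh m * real l"
  have shift_int: "integrable circ (\<lambda>x. complex_of_real (\<phi>bet (x - s)))" for s
    by (rule integrable_circ_minus[OF bet_per bet_int])
  have Qk: "fcoef (Q_op lam bet \<phi>lam \<phi>bet p m f) k = gamma_seq lam bet m k * G (centred_residue m k)"
    and Q_int: "integrable circ (Q_op lam bet \<phi>lam \<phi>bet p m f)"
  proof -
    have Q: "Q_op lam bet \<phi>lam \<phi>bet p m f
      = (\<lambda>x. \<Sum>l=0..2*m. V (?s l) / of_nat (2 * m + 1) * of_real (\<phi>bet (x - ?s l)))"
      by (simp add: fun_eq_iff Q_op_def V_def sum_divide_distrib)
    show "integrable circ (Q_op lam bet \<phi>lam \<phi>bet p m f)"
      unfolding Q by (intro Bochner_Integration.integrable_sum integrable_mult_right shift_int)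
    have "fcoef (Q_op lam bet \<phi>lam \<phi>bet p m f) k
      = (\<Sum>l=0..2*m. V (?s l) / of_nat (2 * m + 1) * fcoef (\<lambda>x. of_real (\<phi>bet (x - ?s l))) k)"
      unfolding Q fcoef_def sum_distrib_right mult.assoc
      using integrable_circ_cis[OF shift_int]
      by (subst Bochner_Integration.integral_sum) (auto simp: sum_divide_distrib)
    also have "\<dots> = (\<Sum>l=0..2*m. V (?s l) * cis (- (of_int k * ?s l))) / of_nat (2 * m + 1) * inverse (bet k)"
      unfolding fcoef_shift[OF bet_per bet_int] fcoef_distributional_series[OF bet_series]
        sum_divide_distrib sum_distrib_right by (intro sum.cong refl) simp
    also have "\<dots> = gamma_seq lam bet m k * G (centred_residue m k)"
      unfolding V_def V_op_discrete_coefficient[OF g_int g_per] gamma_seq_def G_def by (simp add: mult_ac)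
    finally show "fcoef (Q_op lam bet \<phi>lam \<phi>bet p m f) k = gamma_seq lam bet m k * G (centred_residue m k)" .
  qed
  have "fcoef (\<lambda>x. of_real (f x) + (-1) * Q_op lam bet \<phi>lam \<phi>bet p m f x) k
    = fcoef (\<lambda>x. of_real (f x)) k + (-1) * fcoef (Q_op lam bet \<phi>lam \<phi>bet p m f) k"
    by (subst fcoef_add[OF f_int]) (use Q_int in \<open>simp_all only: fcoef_cmult integrable_mult_right\<close>)
  then show ?thesis by (simp add: fk Qk)
qed

lemma residual_pairing_bound:
  assumes C: "\<And>g w a n. g \<in> Lpc p \<Longrightarrow> w \<in> Lpc p' \<Longrightarrow>
      norm (\<Sum>k<n. fcoef g (a + int k) * fcoef w (- (a + int k))) \<le> C * (pnorm p g * pnorm p' w)"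
    and f: "f \<in> Phi_space \<phi>lam p" and e: "0 \<le> e" "eps lam bet m \<le> ennreal e"
    and w: "w \<in> Lpc p'"
  defines "h \<equiv> \<lambda>x. of_real (f x) - Q_op lam bet \<phi>lam \<phi>bet p m f x"
    and "K \<equiv> C * (pnorm p (\<lambda>x. of_real (Phi_generator \<phi>lam p f x)) * pnorm p' w)"
  shows "norm (\<Sum>k=- (int R * (2 * int m + 1) + int m)..int R * (2 * int m + 1) + int m. fcoef h k * fcoef w (- k))
    \<le> 5 * (e * K)"
proof -
  define g where "g = (\<lambda>x. complex_of_real (Phi_generator \<phi>lam p f x))"
  have g: "g \<in> Lpc p" unfolding g_def by (rule Lp_circle_Lpc[OF generator(1)[OF f]])
  let ?L = "int R * (2 * int m + 1) + int m"
  let ?\<theta> = "\<lambda>k. inverse (lam k)" and ?\<gamma> = "gamma_seq lam bet m"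
  have coef: "fcoef h k = ?\<theta> k * fcoef g k - ?\<gamma> k * fcoef g (centred_residue m k)" for k
    unfolding h_def g_def by (rule fcoef_residual[OF f])
  \<comment> \<open>The shift s is absorbed into a modulation of w, which leaves its norm
    unchanged.\<close>
  have K: "norm (\<Sum>i<n. fcoef g (a + int i) * fcoef w (- (a + int i + s))) \<le> K" for a n s
  proof -
    let ?w = "\<lambda>t. w t * cis (- (of_int (- s) * t))"
    have [measurable]: "w \<in> borel_measurable circ" by (rule Lpc_measurable[OF w])
    have "?w \<in> Lpc p'"
      by (rule Lpc_bound[OF w, where C = 1]) (use p'_gt_1 in \<open>auto simp: norm_mult\<close>)
    from C[OF g this, of a n]
    have "norm (\<Sum>i<n. fcoef g (a + int i) * fcoef w (- s + - (a + int i))) \<le> C * (pnorm p g * pnorm p' ?w)"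
      unfolding fcoef_modulate .
    moreover have "- s + - (a + int i) = - (a + int i + s)" for i by simp
    moreover have "pnorm p' ?w = pnorm p' w" by (simp add: pnorm_def norm_mult)
    ultimately show ?thesis by (simp only: K_def g_def)
  qed
  have var: "(\<Sum>\<^sub>\<infinity>k\<in>{k. \<bar>k\<bar> > int m}. ennreal (norm (fdiff ?\<theta> k))) \<le> ennreal e"
    and gam: "(\<Sum>\<^sub>\<infinity>k\<in>{k. \<bar>k\<bar> > int m}. ennreal (norm (fdiff ?\<gamma> k)))
      + (\<Sum>\<^sub>\<infinity>k\<in>UNIV. ennreal (norm (?\<gamma> (k * (2 * int m + 1) + int m)))) \<le> ennreal e"
    using e(2) unfolding eps_def by simp_all
  \<comment> \<open>As the coefficient of an integrable function, 1/lam k is at most the variation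
    met on a walk from k away from 0, and this walk stays in |j| > m.\<close>
  have tail: "norm (?\<theta> k) \<le> e" if k: "\<bar>k\<bar> > int m" for k
  proof -
    define \<sigma> :: int where "\<sigma> = (if k > 0 then 1 else -1)"
    define h where "h = (\<lambda>i. if k > 0 then k + int i else k - int (Suc i))"
    have lam_eq: "?\<theta> j = fcoef (\<lambda>x. of_real (\<phi>lam x)) j" for j
      by (simp add: fcoef_distributional_series[OF lam_series])
    have "(\<Sum>i<M. norm (?\<theta> (k + \<sigma> * int i) - ?\<theta> (k + \<sigma> * int (Suc i)))) \<le> e" for M
    proof -
      have "norm (?\<theta> (k + \<sigma> * int i) - ?\<theta> (k + \<sigma> * int (Suc i))) = norm (fdiff ?\<theta> (h i))" for i
      proof (cases "k > 0")
        case False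
        then have "h i + 1 = k + \<sigma> * int i" "h i = k + \<sigma> * int (Suc i)"
          by (simp_all add: h_def \<sigma>_def)
        then show ?thesis
          unfolding fdiff_def by (metis norm_minus_commute)
      qed (simp add: fdiff_def h_def \<sigma>_def add_ac)
      then have "ennreal (\<Sum>i<M. norm (?\<theta> (k + \<sigma> * int i) - ?\<theta> (k + \<sigma> * int (Suc i))))
        = ennreal (\<Sum>i<M. norm (fdiff ?\<theta> (h i)))" by simp
      also have "\<dots> \<le> (\<Sum>\<^sub>\<infinity>k\<in>{k. \<bar>k\<bar> > int m}. ennreal (norm (fdiff ?\<theta> k)))"
        by (rule ennreal_sum_le_infsum) (use k in \<open>auto simp: h_def inj_on_def\<close>)
      also note var
      finally show ?thesis using e by simp
    qed
    then show ?thesis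
      unfolding lam_eq using lam_integrable
      by (intro fcoef_le_variation[where \<sigma> = \<sigma>]) (auto simp: \<sigma>_def)
  qed
  have "norm (\<Sum>k\<in>{-?L..?L} - {- int m..int m}. fcoef h k * fcoef w (- k)) \<le> 5 * (e * K)"
    unfolding coef
    by (rule residual_sum_bound[where W = "\<lambda>k. fcoef w (- k)", OF K e(1) var tail gam])
  also have "(\<Sum>k\<in>{-?L..?L} - {- int m..int m}. fcoef h k * fcoef w (- k)) = (\<Sum>k=-?L..?L. fcoef h k * fcoef w (- k))"
  proof (rule sum.mono_neutral_left)
    \<comment> \<open>Here k is its own residue and \<open>gamma_seq\<close> reduces to 1/lam k, so
      the error contains no frequency in -m..m.\<close>
    have "fcoef h k = 0" if "k \<in> {- int m..int m}" for k
    proof -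
      have "centred_residue m k = k" by (rule centred_residue_eqI) (use that in auto)
      then show ?thesis using bet0[of k] by (simp add: coef gamma_seq_def alpha_seq_def field_simps)
    qed
    then show "\<forall>k\<in>{-?L..?L} - ({-?L..?L} - {- int m..int m}). fcoef h k * fcoef w (- k) = 0" by auto
  qed auto
  finally show ?thesis .
qed

text \<open>The factor 10 pi is the 5 from summation by parts times the 2 pi between an integral and
  a sum of coefficients.\<close>

lemma residual_norm_le:
  assumes C: "0 \<le> C" "\<And>g w a n. g \<in> Lpc p \<Longrightarrow> w \<in> Lpc p' \<Longrightarrow>
      norm (\<Sum>k<n. fcoef g (a + int k) * fcoef w (- (a + int k))) \<le> C * (pnorm p g * pnorm p' w)"
    and f: "f \<in> Phi_space \<phi>lam p" and e: "0 \<le> e" "eps lam bet m \<le> ennreal e"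
  shows "Lp_norm p (\<lambda>x. of_real (f x) - Q_op lam bet \<phi>lam \<phi>bet p m f x) \<le> 10 * pi * C * e * Phi_norm \<phi>lam p f"
proof -
  define h where "h = (\<lambda>x. of_real (f x) - Q_op lam bet \<phi>lam \<phi>bet p m f x)"
  define N where "N = pnorm p (\<lambda>x. of_real (Phi_generator \<phi>lam p f x))"
  have h: "h \<in> Lpc p" unfolding h_def by (rule residual_Lpc[OF f])
  have "pnorm p h \<le> 10 * pi * C * e * N"
  proof (rule pnorm_le_of_trig_tests[OF p h])
    show "0 \<le> 10 * pi * C * e * N" using C(1) e(1) by (simp add: N_def)
    fix w assume w: "w \<in> trig_polys"
    have w_Lpc: "w \<in> Lpc p'"
      by (rule continuous_Lpc[OF continuous_on_trig_polys[OF w]]) (use p'_gt_1 in simp)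
    obtain N0 where N0: "\<forall>N\<ge>N0. (LINT x|circ. h x * w x)
        = 2 * pi * (\<Sum>k=-int N..int N. fcoef h k * fcoef w (- k))"
      using trig_poly_test[OF Lpc_integrable[OF h] w] p by auto
    \<comment> \<open>Rounding N0 up makes the symmetric range -M..M a union of whole
      blocks.\<close>
    define M where "M = N0 * (2 * m + 1) + m"
    have "N0 \<le> M" by (simp add: M_def)
    have M: "int M = int N0 * (2 * int m + 1) + int m" by (simp add: M_def algebra_simps)
    have "norm (LINT x|circ. h x * w x) = 2 * pi * norm (\<Sum>k=-int M..int M. fcoef h k * fcoef w (- k))"
      using N0[rule_format, OF \<open>N0 \<le> M\<close>] by (simp add: norm_mult)
    also have "\<dots> \<le> 2 * pi * (5 * (e * (C * (N * pnorm p' w))))"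
      unfolding M N_def h_def
      by (intro mult_left_mono residual_pairing_bound[OF C(2) f e w_Lpc]) auto
    finally show "norm (LINT x|circ. h x * w x) \<le> 10 * pi * C * e * N * pnorm p' w"
      by (simp add: mult_ac)
  qed
  then have "(2 * pi) powr (- 1 / p) * pnorm p h \<le> (2 * pi) powr (- 1 / p) * (10 * pi * C * e * N)"
    by (rule mult_left_mono) simp
  moreover have "Phi_norm \<phi>lam p f = (2 * pi) powr (- 1 / p) * N"
    unfolding Phi_norm_def N_def Lp_norm_eq_pnorm[symmetric] by (rule Lp_norm_of_real[symmetric])
  ultimately show ?thesis
    unfolding h_def[symmetric] Lp_norm_eq_pnorm by (simp add: mult_ac)
qed

text \<open>If \<open>eps\<close> is infinite but \<open>f\<close> has norm 0, the claimed bound is 0 (as \<open>\<infinity> * 0 = 0\<close>); then all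
  coefficients of the generator vanish.\<close>

lemma residual_norm_zero:
  assumes f: "f \<in> Phi_space \<phi>lam p" and 0: "Phi_norm \<phi>lam p f = 0"
  shows "Lp_norm p (\<lambda>x. of_real (f x) - Q_op lam bet \<phi>lam \<phi>bet p m f x) = 0"
proof -
  define g where "g = (\<lambda>x. complex_of_real (Phi_generator \<phi>lam p f x))"
  define h where "h = (\<lambda>x. of_real (f x) - Q_op lam bet \<phi>lam \<phi>bet p m f x)"
  have g: "g \<in> Lpc p" unfolding g_def by (rule Lp_circle_Lpc[OF generator(1)[OF f]])
  have h: "h \<in> Lpc p" unfolding h_def by (rule residual_Lpc[OF f])
  have "Lp_norm p g = 0" using 0 unfolding Phi_norm_def g_def Lp_norm_of_real .
  then have "pnorm p g = 0" by (simp add: Lp_norm_eq_pnorm)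
  then have "(LINT x|circ. norm (g x) powr p) = 0" by (simp add: pnorm_def)
  then have "AE x in circ. norm (g x) powr p = 0"
    using integral_nonneg_eq_0_iff_AE[OF Lpc_integrable_powr[OF g]] by simp
  then have "AE x in circ. g x = 0" by eventually_elim simp
  then have "fcoef g k = 0" for k
    unfolding fcoef_def by (subst integral_eq_zero_AE) (auto elim: eventually_mono)
  then have coef: "fcoef h k = 0" for k
    unfolding h_def fcoef_residual[OF f] g_def by simp
  have "pnorm p h \<le> 0"
  proof (rule pnorm_le_of_trig_tests[OF p h])
    fix w assume w: "w \<in> trig_polys"
    show "norm (LINT x|circ. h x * w x) \<le> 0 * pnorm p' w"
      using trig_poly_test[OF Lpc_integrable[OF h] w] p by (auto simp: coef)
  qed simp
  then have "pnorm p h = 0" by (simp add: antisym)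
  then show ?thesis by (simp add: h_def Lp_norm_eq_pnorm)
qed

text \<open>Taking real parts loses nothing because the samples are real; the index moves from 0..2m
  to 1..2m+1 to fit \<open>translate_approx\<close>.\<close>

lemma Q_op_eq_translates:
  assumes f: "f \<in> Phi_space \<phi>lam p"
  shows "Q_op lam bet \<phi>lam \<phi>bet p m f x = of_real (\<Sum>l=1..2*m+1.
    Re (V_op lam bet m (Phi_generator \<phi>lam p f) (mesh m * real (l - 1))) / real (2 * m + 1)
      * \<phi>bet (x - mesh m * real (l - 1)))"
proof -
  let ?V = "\<lambda>s. V_op lam bet m (Phi_generator \<phi>lam p f) s"
  have g: "Phi_generator \<phi>lam p f \<in> Lp_circle p" by (rule generator(1)[OF f])
  have V: "?V s = of_real (Re (?V s))" for s
  proof -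
    have "?V s \<in> \<real>"
      by (intro V_op_real lam_bet_cnj Lp_circle_integrable[OF g]) (use p g in \<open>auto simp: Lp_circle_def\<close>)
    then show ?thesis by simp
  qed
  have shift: "(\<Sum>l=1..2*m+1. Re (?V (mesh m * real (l - 1))) / real (2 * m + 1) * \<phi>bet (x - mesh m * real (l - 1)))
    = (\<Sum>l=0..2*m. Re (?V (mesh m * real l)) / real (2 * m + 1) * \<phi>bet (x - mesh m * real l))"
    by (rule sum.reindex_bij_witness[where i = Suc and j = "\<lambda>l. l - 1"]) auto
  have "Q_op lam bet \<phi>lam \<phi>bet p m f x
    = (\<Sum>l=0..2*m. ?V (mesh m * real l) / of_nat (2 * m + 1) * of_real (\<phi>bet (x - mesh m * real l)))"
    unfolding Q_op_def sum_divide_distrib by (intro sum.cong refl) simp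
  then show ?thesis
    unfolding shift of_real_sum of_real_mult of_real_divide V[symmetric] of_real_of_nat_eq .
qed

end

theorem theorem2p9:
  fixes p p' :: real
    and lam bet :: "int \<Rightarrow> complex"
    and \<phi>lam \<phi>bet :: "real \<Rightarrow> real"
  assumes "1 < p" and "1 / p + 1 / p' = 1"
    and "\<And>k. lam k \<noteq> 0" and "\<And>k. bet k \<noteq> 0"
    and "has_distributional_series \<phi>lam (\<lambda>k. inverse (lam k))"
    and "has_distributional_series \<phi>bet (\<lambda>k. inverse (bet k))"
    and "\<phi>lam \<in> Lp_circle p'" and "\<phi>bet \<in> Lp_circle p"
  shows "\<exists>c::real. c > 0 \<and>
    (\<forall>f \<in> Phi_space \<phi>lam p. \<forall>m\<ge>1.
       ennreal (Lp_norm p (\<lambda>x. complex_of_real (f x) - Q_op lam bet \<phi>lam \<phi>bet p m f x))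
         \<le> ennreal c * eps lam bet m * ennreal (Phi_norm \<phi>lam p f)) \<and>
    (\<forall>m\<ge>1. translate_approx (2 * m + 1) (Phi_ball \<phi>lam p) \<phi>bet p
         \<le> ennreal c * eps lam bet m)"
proof -
  obtain C where C: "0 \<le> C" "\<And>g w a n. g \<in> Lpc p \<Longrightarrow> w \<in> Lpc p' \<Longrightarrow>
      norm (\<Sum>k<n. fcoef g (a + int k) * fcoef w (- (a + int k))) \<le> C * (pnorm p g * pnorm p' w)"
    using riesz_bilinear[OF assms(1,2)] by blast
  \<comment> \<open>The summand 1 keeps c positive should C be 0.\<close>
  define c where "c = 10 * pi * C + 1"
  have c: "0 < c" using C(1) by (simp add: c_def add_nonneg_pos)
  have bound: "ennreal (Lp_norm p (\<lambda>x. complex_of_real (f x) - Q_op lam bet \<phi>lam \<phi>bet p m f x))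
    \<le> ennreal c * eps lam bet m * ennreal (Phi_norm \<phi>lam p f)" if f: "f \<in> Phi_space \<phi>lam p" for f m
  proof (cases "eps lam bet m = \<infinity>")
    case True
    show ?thesis
    proof (cases "Phi_norm \<phi>lam p f = 0")
      case True
      then show ?thesis using residual_norm_zero[OF assms f] by simp
    next
      case False
      \<comment> \<open>The right-hand side is then infinite.\<close>
      then have "0 < Phi_norm \<phi>lam p f" by (simp add: Phi_norm_def Lp_norm_def less_le)
      then show ?thesis using True c by (simp add: ennreal_mult_top ennreal_top_mult)
    qed
  next
    case False
    then obtain e where e: "0 \<le> e" "eps lam bet m = ennreal e" by (cases "eps lam bet m") auto
    have N: "0 \<le> Phi_norm \<phi>lam p f" by (simp add: Phi_norm_def Lp_norm_def)
    have "Lp_norm p (\<lambda>x. complex_of_real (f x) - Q_op lam bet \<phi>lam \<phi>bet p m f x)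
      \<le> 10 * pi * C * e * Phi_norm \<phi>lam p f"
      by (rule residual_norm_le[OF assms C f e(1) eq_refl[OF e(2)]])
    also have "\<dots> \<le> c * e * Phi_norm \<phi>lam p f"
      using e(1) N by (intro mult_right_mono) (auto simp: c_def)
    finally show ?thesis
      using c e N by (simp add: ennreal_leI flip: ennreal_mult)
  qed
  have approx: "translate_approx (2 * m + 1) (Phi_ball \<phi>lam p) \<phi>bet p \<le> ennreal c * eps lam bet m" for m
    unfolding translate_approx_def
  proof (rule SUP_least)
    fix f assume "f \<in> Phi_ball \<phi>lam p"
    then have f: "f \<in> Phi_space \<phi>lam p" and N: "Phi_norm \<phi>lam p f \<le> 1"
      by (auto simp: Phi_ball_def)
    define b where "b = (\<lambda>l. Re (V_op lam bet m (Phi_generator \<phi>lam p f) (mesh m * real (l - 1))) / real (2 * m + 1))"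
    define y where "y = (\<lambda>l. mesh m * real (l - 1))"
    \<comment> \<open>The last node is 2m mesh steps from 0, and 2m+1 steps make a full
      period.\<close>
    have y: "y \<in> {1..2 * m + 1} \<rightarrow> {0..2*pi}"
    proof
      fix l assume "l \<in> {1..2 * m + 1}"
      then have "real (l - 1) \<le> 2 * real m + 1" by auto
      then have "mesh m * real (l - 1) \<le> mesh m * (2 * real m + 1)"
        by (intro mult_left_mono) (auto simp: mesh_def)
      then show "y l \<in> {0..2*pi}" by (simp add: y_def mesh_def)
    qed
    have "(INF c\<in>UNIV. INF y\<in>{1..2 * m + 1} \<rightarrow> {0..2*pi}.
        ennreal (Lp_norm p (\<lambda>x. f x - (\<Sum>l = 1..2 * m + 1. c l * \<phi>bet (x - y l)))))
      \<le> ennreal (Lp_norm p (\<lambda>x. f x - (\<Sum>l = 1..2 * m + 1. b l * \<phi>bet (x - y l))))"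
      by (rule INF_lower2[where i = b], simp, rule INF_lower[OF y])
    also have "Lp_norm p (\<lambda>x. f x - (\<Sum>l = 1..2 * m + 1. b l * \<phi>bet (x - y l)))
      = Lp_norm p (\<lambda>x. complex_of_real (f x) - Q_op lam bet \<phi>lam \<phi>bet p m f x)"
      unfolding Q_op_eq_translates[OF assms f] b_def y_def of_real_diff[symmetric]
      by (rule Lp_norm_of_real[symmetric])
    also have "ennreal \<dots> \<le> ennreal c * eps lam bet m * ennreal (Phi_norm \<phi>lam p f)"
      by (rule bound[OF f])
    also have "\<dots> \<le> ennreal c * eps lam bet m * 1"
      using N by (intro mult_left_mono) auto
    finally show "(INF c\<in>UNIV. INF y\<in>{1..2 * m + 1} \<rightarrow> {0..2*pi}.
        ennreal (Lp_norm p (\<lambda>x. f x - (\<Sum>l = 1..2 * m + 1. c l * \<phi>bet (x - y l)))))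
      \<le> ennreal c * eps lam bet m" by simp
  qed
  show ?thesis using c bound approx by blast
qed

end
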